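(* Let $\varphi:M^2\to N^n$ be a biconservative surface in a Riemannian manifold. Denote by $\lambda_1$ and $\lambda_2$ the principal curvatures of $M$ corresponding to $\varphi$ and set $\mu=\lambda_1-\lambda_2$. Assume that $\lambda_1$ and $\lambda_2$ are constants and $\lambda_1>\lambda_2$. Then: a) locally, there exists $\psi:M^2\to N^3(c)$ an isoparametric surface such that $A^\varphi_{H^\varphi}$ is the shape operator of $\psi$ in the direction of the unit normal vector field, where $$c=\frac{\mu^2}{4}-\left|H^\varphi\right|^4;$$ moreover $\left|H^\psi\right|=\left|H^\varphi\right|^2$; b) locally, there exists $\psi:M^2\to N^3(c)$ an isoparametric surface such that $S_2^\varphi$ is the shape operator of $\psi$ in the direction of the unit normal vector field, where $$c=4\left(\mu^2-\left|H^\varphi\right|^4\right);$$ moreover $\left|H^\psi\right|=2\left|H^\varphi\right|^2$.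
   Context: All manifolds, metrics and maps are smooth; all manifolds are connected and oriented. A surface $\varphi:M^2\to N^n$ is a Riemannian (isometric) immersion of a 2-dimensional Riemannian manifold $(M^2,g)$ into a Riemannian manifold. $B$ is the second fundamental form, $H=H^\varphi=\frac12\operatorname{trace}B$ the mean curvature vector field, and $A_H=A^\varphi_{H^\varphi}$ the shape operator in the direction of $H$, with $\langle A_H(X),Y\rangle=\langle B(X,Y),H\rangle$. The stress-bienergy tensor of a surface is $S_2=S_2^\varphi=-2|H|^2I+4A_H$ ($I$ the identity), and the surface is biconservative if $\operatorname{div}S_2=0$, where $\operatorname{div}T=\sum_i(\nabla_{X_i}T)(X_i)$ for a local orthonormal frame $\{X_i\}$. The principal curvatures corresponding to $\varphi$ are the eigenvalue functions of $A^\varphi_{H^\varphi}$. $N^3(c)$ denotes a 3-dimensional space form of constant sectional curvature $c$. "Locally" means: every point of $M$ has an open neighbourhood (with the metric $g$) on which such an isometric immersion $\psi$ into $N^3(c)$ exists; $H^\psi$ is the mean curvature vector field of $\psi$ (half the trace of its second fundamental form). Isoparametric means that the eigenvalues of the shape operator of $\psi$ with respect to the unit normal are constant. *)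

theory Defs
  imports "HOL-Analysis.Analysis"
begin

section \<open>Smooth maps between Euclidean spaces\<close>

abbreviation deriv_along :: "('a::real_normed_vector \<Rightarrow> 'b::real_normed_vector) \<Rightarrow> 'a \<Rightarrow> 'a \<Rightarrow> 'b"
  where "deriv_along f x v \<equiv> frechet_derivative f (at x) v"

text \<open>Only used for open \<open>S\<close> and finite-dimensional domains, where continuity of all
  directional derivatives of a differentiable map is continuity of its differential.\<close>

fun Ck_on :: "nat \<Rightarrow> ('a::real_normed_vector \<Rightarrow> 'b::real_normed_vector) \<Rightarrow> 'a set \<Rightarrow> bool" where
  "Ck_on 0 f S \<longleftrightarrow> continuous_on S f"
| "Ck_on (Suc k) f S \<longleftrightarrow>
     (\<forall>x\<in>S. f differentiable (at x)) \<and> (\<forall>v. Ck_on k (\<lambda>x. deriv_along f x v) S)"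

definition smooth_on :: "('a::real_normed_vector \<Rightarrow> 'b::real_normed_vector) \<Rightarrow> 'a set \<Rightarrow> bool" where
  "smooth_on f S \<longleftrightarrow> (\<forall>k. Ck_on k f S)"


section \<open>Riemannian manifolds\<close>

text \<open>A chart is a pair \<open>(U, f)\<close> of an open set and a coordinate map, which is only meaningful
  on \<open>U\<close>. Tensor fields are given by their components in each chart, as functions of the
  coordinates; in particular \<open>metric M c x u v\<close> is the value of the metric, in the chart \<open>c\<close> and at
  the point with coordinates \<open>x\<close>, on the tangent vectors with coordinate vectors \<open>u\<close> and \<open>v\<close>.\<close>

type_synonym ('p, 'n) chart = "'p set \<times> ('p \<Rightarrow> real ^ 'n)"

record ('p, 'n::finite) riem_mfd =
  mtop :: "'p topology"
  atlas :: "('p, 'n) chart set"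
  metric :: "('p, 'n) chart \<Rightarrow> real ^ 'n \<Rightarrow> real ^ 'n \<Rightarrow> real ^ 'n \<Rightarrow> real"

abbreviation points :: "('p, 'n::finite) riem_mfd \<Rightarrow> 'p set" where
  "points M \<equiv> topspace (mtop M)"

abbreviation cdom :: "('p, 'n::finite) chart \<Rightarrow> 'p set" where
  "cdom c \<equiv> fst c"

abbreviation cmap :: "('p, 'n::finite) chart \<Rightarrow> 'p \<Rightarrow> real ^ 'n" where
  "cmap c \<equiv> snd c"

abbreviation cimg :: "('p, 'n::finite) chart \<Rightarrow> (real ^ 'n) set" where
  "cimg c \<equiv> cmap c ` cdom c"

definition cinv :: "('p, 'n::finite) chart \<Rightarrow> real ^ 'n \<Rightarrow> 'p" where
  "cinv c = inv_into (cdom c) (cmap c)"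

definition transition :: "('p, 'n::finite) chart \<Rightarrow> ('p, 'n) chart \<Rightarrow> real ^ 'n \<Rightarrow> real ^ 'n" where
  "transition c c' = cmap c' \<circ> cinv c"

definition is_chart :: "'p topology \<Rightarrow> ('p, 'n::finite) chart \<Rightarrow> bool" where
  "is_chart X c \<longleftrightarrow> openin X (cdom c) \<and> open (cimg c) \<and>
     homeomorphic_map (subtopology X (cdom c)) (top_of_set (cimg c)) (cmap c)"

definition oriented_smooth_atlas :: "'p topology \<Rightarrow> ('p, 'n::finite) chart set \<Rightarrow> bool" where
  "oriented_smooth_atlas X A \<longleftrightarrow>
     (\<forall>c\<in>A. is_chart X c) \<and> (\<Union>c\<in>A. cdom c) = topspace X \<and>
     (\<forall>c\<in>A. \<forall>c'\<in>A.
        smooth_on (transition c c') (cmap c ` (cdom c \<inter> cdom c')) \<and>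
        (\<forall>x\<in>cmap c ` (cdom c \<inter> cdom c').
           det (matrix (deriv_along (transition c c') x)) > 0))"

definition riemannian_metric ::
  "('p, 'n::finite) chart set \<Rightarrow> (('p, 'n) chart \<Rightarrow> real ^ 'n \<Rightarrow> real ^ 'n \<Rightarrow> real ^ 'n \<Rightarrow> real) \<Rightarrow> bool" where
  "riemannian_metric A g \<longleftrightarrow>
     (\<forall>c\<in>A. \<forall>x\<in>cimg c.
        bilinear (g c x) \<and> (\<forall>u v. g c x u v = g c x v u) \<and> (\<forall>u. u \<noteq> 0 \<longrightarrow> g c x u u > 0)) \<and>
     (\<forall>c\<in>A. \<forall>u v. smooth_on (\<lambda>x. g c x u v) (cimg c)) \<and>
     (\<forall>c\<in>A. \<forall>c'\<in>A. \<forall>x\<in>cmap c ` (cdom c \<inter> cdom c'). \<forall>u v.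
        g c x u v = g c' (transition c c' x)
          (deriv_along (transition c c') x u) (deriv_along (transition c c') x v))"

definition riemannian_manifold :: "('p, 'n::finite) riem_mfd \<Rightarrow> bool" where
  "riemannian_manifold M \<longleftrightarrow>
     Hausdorff_space (mtop M) \<and> second_countable (mtop M) \<and>
     connected_space (mtop M) \<and> points M \<noteq> {} \<and>
     oriented_smooth_atlas (mtop M) (atlas M) \<and> riemannian_metric (atlas M) (metric M)"


section \<open>Levi-Civita connection, curvature, space forms\<close>

text \<open>In coordinates, \<open>\<nabla>\<^sub>u V = D\<^sub>u V + \<Gamma>(u, V)\<close>, where \<open>\<Gamma>\<close> is given by Koszul's
  formula for the coordinate fields; its components are the usual Christoffel symbols.\<close>

definition christoffel ::
  "(real ^ 'n::finite \<Rightarrow> real ^ 'n \<Rightarrow> real ^ 'n \<Rightarrow> real) \<Rightarrow> real ^ 'n \<Rightarrow> real ^ 'n \<Rightarrow> real ^ 'n \<Rightarrow> real ^ 'n" where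
  "christoffel g x u v = (THE z. \<forall>w. g x z w =
     (deriv_along (\<lambda>y. g y v w) x u + deriv_along (\<lambda>y. g y u w) x v
        - deriv_along (\<lambda>y. g y u v) x w) / 2)"

text \<open>\<open>R(u, v) w = \<nabla>\<^sub>u \<nabla>\<^sub>v w - \<nabla>\<^sub>v \<nabla>\<^sub>u w\<close> for constant-coefficient fields \<open>u\<close>, \<open>v\<close>, \<open>w\<close>.\<close>

definition riemann ::
  "(real ^ 'n::finite \<Rightarrow> real ^ 'n \<Rightarrow> real ^ 'n \<Rightarrow> real) \<Rightarrow>
     real ^ 'n \<Rightarrow> real ^ 'n \<Rightarrow> real ^ 'n \<Rightarrow> real ^ 'n \<Rightarrow> real ^ 'n" where
  "riemann g x u v w =
     deriv_along (\<lambda>y. christoffel g y v w) x u - deriv_along (\<lambda>y. christoffel g y u w) x v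
     + christoffel g x u (christoffel g x v w) - christoffel g x v (christoffel g x u w)"

definition sectional ::
  "(real ^ 'n::finite \<Rightarrow> real ^ 'n \<Rightarrow> real ^ 'n \<Rightarrow> real) \<Rightarrow> real ^ 'n \<Rightarrow> real ^ 'n \<Rightarrow> real ^ 'n \<Rightarrow> real" where
  "sectional g x u v = g x (riemann g x u v v) u / (g x u u * g x v v - (g x u v)\<^sup>2)"

definition constant_sectional_curvature :: "('p, 'n::finite) riem_mfd \<Rightarrow> real \<Rightarrow> bool" where
  "constant_sectional_curvature M k \<longleftrightarrow>
     (\<forall>c\<in>atlas M. \<forall>x\<in>cimg c. \<forall>u v.
        u \<noteq> v \<and> independent {u, v} \<longrightarrow> sectional (metric M c) x u v = k)"

definition complete_geodesic :: "('p, 'n::finite) riem_mfd \<Rightarrow> (real \<Rightarrow> 'p) \<Rightarrow> bool" where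
  "complete_geodesic M \<gamma> \<longleftrightarrow> continuous_map euclideanreal (mtop M) \<gamma> \<and>
     (\<forall>c\<in>atlas M. smooth_on (cmap c \<circ> \<gamma>) {t. \<gamma> t \<in> cdom c} \<and>
        (\<forall>t. \<gamma> t \<in> cdom c \<longrightarrow>
           vector_derivative (\<lambda>s. vector_derivative (cmap c \<circ> \<gamma>) (at s)) (at t)
             + christoffel (metric M c) (cmap c (\<gamma> t))
                 (vector_derivative (cmap c \<circ> \<gamma>) (at t))
                 (vector_derivative (cmap c \<circ> \<gamma>) (at t)) = 0))"

text \<open>Completeness: for every initial velocity the geodesic exists for all time.\<close>

definition geodesically_complete :: "('p, 'n::finite) riem_mfd \<Rightarrow> bool" where
  "geodesically_complete M \<longleftrightarrow>
     (\<forall>c\<in>atlas M. \<forall>p\<in>cdom c. \<forall>u. \<exists>\<gamma>. complete_geodesic M \<gamma> \<and> \<gamma> 0 = p \<and>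
        vector_derivative (cmap c \<circ> \<gamma>) (at 0) = u)"

text \<open>Since the points of \<open>N\<close> are \<open>topspace (mtop N)\<close>, with a topology unrelated to the one of the
  type \<open>'p\<close>, every connected manifold of positive dimension has a copy over any type of the
  cardinality of the continuum, such as \<open>real ^ 4\<close>; this is used to quantify over space forms.\<close>

definition space_form :: "('p, 'n::finite) riem_mfd \<Rightarrow> real \<Rightarrow> bool" where
  "space_form N k \<longleftrightarrow>
     riemannian_manifold N \<and> geodesically_complete N \<and> constant_sectional_curvature N k"


section \<open>Isometric immersions and the second fundamental form\<close>

definition local_rep ::
  "('p \<Rightarrow> 'q) \<Rightarrow> ('p, 'm::finite) chart \<Rightarrow> ('q, 'n::finite) chart \<Rightarrow> real ^ 'm \<Rightarrow> real ^ 'n" where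
  "local_rep \<phi> c d = cmap d \<circ> \<phi> \<circ> cinv c"

text \<open>\<open>charts_at V M N \<phi> p c d\<close>: \<open>c\<close> is a chart of \<open>M\<close> around the point \<open>p\<close> of \<open>V\<close> and \<open>d\<close> is a
  chart of \<open>N\<close> around \<open>\<phi> p\<close>. Statements about tensors at \<open>p\<close> are made for all such charts.\<close>

definition charts_at ::
  "'p set \<Rightarrow> ('p, 'm::finite) riem_mfd \<Rightarrow> ('q, 'n::finite) riem_mfd \<Rightarrow> ('p \<Rightarrow> 'q) \<Rightarrow>
     'p \<Rightarrow> ('p, 'm) chart \<Rightarrow> ('q, 'n) chart \<Rightarrow> bool" where
  "charts_at V M N \<phi> p c d \<longleftrightarrow>
     p \<in> V \<and> c \<in> atlas M \<and> d \<in> atlas N \<and> p \<in> cdom c \<and> \<phi> p \<in> cdom d"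

text \<open>\<open>V\<close> is an open subset of \<open>M\<close>, carrying the metric of \<open>M\<close>; the values of \<open>\<phi>\<close> outside \<open>V\<close>
  are irrelevant.\<close>

definition isometric_immersion_on ::
  "'p set \<Rightarrow> ('p, 'm::finite) riem_mfd \<Rightarrow> ('q, 'n::finite) riem_mfd \<Rightarrow> ('p \<Rightarrow> 'q) \<Rightarrow> bool" where
  "isometric_immersion_on V M N \<phi> \<longleftrightarrow>
     continuous_map (subtopology (mtop M) V) (mtop N) \<phi> \<and>
     (\<forall>c\<in>atlas M. \<forall>d\<in>atlas N.
        smooth_on (local_rep \<phi> c d) (cmap c ` {p. charts_at V M N \<phi> p c d})) \<and>
     (\<forall>p c d. charts_at V M N \<phi> p c d \<longrightarrow>
        (\<forall>u v. metric N d (cmap d (\<phi> p))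
                 (deriv_along (local_rep \<phi> c d) (cmap c p) u)
                 (deriv_along (local_rep \<phi> c d) (cmap c p) v)
               = metric M c (cmap c p) u v))"

text \<open>The Gauss formula \<open>B(X, Y) = \<nabla>\<^sup>N\<^sub>X d\<phi>(Y) - d\<phi>(\<nabla>\<^sup>M\<^sub>X Y)\<close> for fields \<open>X\<close>, \<open>Y\<close> with
  constant coefficients \<open>u\<close>, \<open>v\<close> in the chart \<open>c\<close>. The argument \<open>x\<close> is the coordinate of a point
  of \<open>M\<close>, the value is the coordinate vector in the chart \<open>d\<close> of a tangent vector of \<open>N\<close>.\<close>

definition second_ff ::
  "('p, 'm::finite) riem_mfd \<Rightarrow> ('q, 'n::finite) riem_mfd \<Rightarrow> ('p \<Rightarrow> 'q) \<Rightarrow>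
     ('p, 'm) chart \<Rightarrow> ('q, 'n) chart \<Rightarrow> real ^ 'm \<Rightarrow> real ^ 'm \<Rightarrow> real ^ 'm \<Rightarrow> real ^ 'n" where
  "second_ff M N \<phi> c d x u v = (let F = local_rep \<phi> c d in
     deriv_along (\<lambda>y. deriv_along F y v) x u
     + christoffel (metric N d) (F x) (deriv_along F x u) (deriv_along F x v)
     - deriv_along F x (christoffel (metric M c) x u v))"

definition orthonormal_basis_at ::
  "(real ^ 'm::finite \<Rightarrow> real ^ 'm \<Rightarrow> real ^ 'm \<Rightarrow> real) \<Rightarrow> real ^ 'm \<Rightarrow> ('m \<Rightarrow> real ^ 'm) \<Rightarrow> bool" where
  "orthonormal_basis_at g x e \<longleftrightarrow> (\<forall>i j. g x (e i) (e j) = (if i = j then 1 else 0))"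

text \<open>The trace of a bilinear form with respect to the metric (independent of the basis).\<close>

definition metric_trace ::
  "(real ^ 'm::finite \<Rightarrow> real ^ 'm \<Rightarrow> real ^ 'm \<Rightarrow> real) \<Rightarrow> real ^ 'm \<Rightarrow>
     (real ^ 'm \<Rightarrow> real ^ 'm \<Rightarrow> 'b::real_vector) \<Rightarrow> 'b" where
  "metric_trace g x \<beta> = (let e = (SOME e. orthonormal_basis_at g x e) in \<Sum>i\<in>UNIV. \<beta> (e i) (e i))"

definition mean_curvature ::
  "('p, 2) riem_mfd \<Rightarrow> ('q, 'n::finite) riem_mfd \<Rightarrow> ('p \<Rightarrow> 'q) \<Rightarrow>
     ('p, 2) chart \<Rightarrow> ('q, 'n) chart \<Rightarrow> real ^ 2 \<Rightarrow> real ^ 'n" where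
  "mean_curvature M N \<phi> c d x = (1/2) *\<^sub>R metric_trace (metric M c) x (second_ff M N \<phi> c d x)"

definition mean_curvature_norm ::
  "('p, 2) riem_mfd \<Rightarrow> ('q, 'n::finite) riem_mfd \<Rightarrow> ('p \<Rightarrow> 'q) \<Rightarrow>
     ('p, 2) chart \<Rightarrow> ('q, 'n) chart \<Rightarrow> real ^ 2 \<Rightarrow> real" where
  "mean_curvature_norm M N \<phi> c d x =
     sqrt (metric N d (local_rep \<phi> c d x) (mean_curvature M N \<phi> c d x) (mean_curvature M N \<phi> c d x))"

definition shape_operator ::
  "('p, 2) riem_mfd \<Rightarrow> ('q, 'n::finite) riem_mfd \<Rightarrow> ('p \<Rightarrow> 'q) \<Rightarrow>
     ('p, 2) chart \<Rightarrow> ('q, 'n) chart \<Rightarrow> real ^ 2 \<Rightarrow> real ^ 'n \<Rightarrow> real ^ 2 \<Rightarrow> real ^ 2" where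
  "shape_operator M N \<phi> c d x \<eta> u = (THE z. \<forall>w.
     metric M c x z w = metric N d (local_rep \<phi> c d x) (second_ff M N \<phi> c d x u w) \<eta>)"

definition shape_H ::
  "('p, 2) riem_mfd \<Rightarrow> ('q, 'n::finite) riem_mfd \<Rightarrow> ('p \<Rightarrow> 'q) \<Rightarrow>
     ('p, 2) chart \<Rightarrow> ('q, 'n) chart \<Rightarrow> real ^ 2 \<Rightarrow> real ^ 2 \<Rightarrow> real ^ 2" where
  "shape_H M N \<phi> c d x = shape_operator M N \<phi> c d x (mean_curvature M N \<phi> c d x)"


section \<open>Biconservative surfaces\<close>

definition stress_bienergy ::
  "('p, 2) riem_mfd \<Rightarrow> ('q, 'n::finite) riem_mfd \<Rightarrow> ('p \<Rightarrow> 'q) \<Rightarrow>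
     ('p, 2) chart \<Rightarrow> ('q, 'n) chart \<Rightarrow> real ^ 2 \<Rightarrow> real ^ 2 \<Rightarrow> real ^ 2" where
  "stress_bienergy M N \<phi> c d x u =
     (- 2 * (mean_curvature_norm M N \<phi> c d x)\<^sup>2) *\<^sub>R u + 4 *\<^sub>R shape_H M N \<phi> c d x u"

text \<open>\<open>(\<nabla>\<^sub>u T)(v) = \<nabla>\<^sub>u (T v) - T (\<nabla>\<^sub>u v)\<close> for constant-coefficient fields \<open>u\<close>, \<open>v\<close>; the expression
  is tensorial in \<open>u\<close> and \<open>v\<close>, so an orthonormal basis at the point suffices for the divergence.\<close>

definition cov_deriv_endo ::
  "(real ^ 'm::finite \<Rightarrow> real ^ 'm \<Rightarrow> real ^ 'm \<Rightarrow> real) \<Rightarrow> (real ^ 'm \<Rightarrow> real ^ 'm \<Rightarrow> real ^ 'm) \<Rightarrow>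
     real ^ 'm \<Rightarrow> real ^ 'm \<Rightarrow> real ^ 'm \<Rightarrow> real ^ 'm" where
  "cov_deriv_endo g T x u v =
     deriv_along (\<lambda>y. T y v) x u + christoffel g x u (T x v) - T x (christoffel g x u v)"

definition divergence_endo ::
  "(real ^ 'm::finite \<Rightarrow> real ^ 'm \<Rightarrow> real ^ 'm \<Rightarrow> real) \<Rightarrow> (real ^ 'm \<Rightarrow> real ^ 'm \<Rightarrow> real ^ 'm) \<Rightarrow>
     real ^ 'm \<Rightarrow> real ^ 'm" where
  "divergence_endo g T x = metric_trace g x (cov_deriv_endo g T x)"

definition biconservative ::
  "('p, 2) riem_mfd \<Rightarrow> ('q, 'n::finite) riem_mfd \<Rightarrow> ('p \<Rightarrow> 'q) \<Rightarrow> bool" where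
  "biconservative M N \<phi> \<longleftrightarrow>
     (\<forall>p c d. charts_at (points M) M N \<phi> p c d \<longrightarrow>
        divergence_endo (metric M c) (stress_bienergy M N \<phi> c d) (cmap c p) = 0)"

definition eigenvalues :: "(real ^ 'm::finite \<Rightarrow> real ^ 'm) \<Rightarrow> real set" where
  "eigenvalues A = {t. \<exists>v. v \<noteq> 0 \<and> A v = t *\<^sub>R v}"

definition principal_curvatures ::
  "('p, 2) riem_mfd \<Rightarrow> ('q, 'n::finite) riem_mfd \<Rightarrow> ('p \<Rightarrow> 'q) \<Rightarrow>
     ('p \<Rightarrow> real) \<Rightarrow> ('p \<Rightarrow> real) \<Rightarrow> bool" where
  "principal_curvatures M N \<phi> l\<^sub>1 l\<^sub>2 \<longleftrightarrow>
     (\<forall>p c d. charts_at (points M) M N \<phi> p c d \<longrightarrow>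
        eigenvalues (shape_H M N \<phi> c d (cmap c p)) = {l\<^sub>1 p, l\<^sub>2 p})"


section \<open>Surfaces in three-dimensional manifolds\<close>

text \<open>The unit normal field is the one determined by the orientations of the surface and of the
  ambient manifold.\<close>

definition unit_normal ::
  "('p, 2) riem_mfd \<Rightarrow> ('q, 3) riem_mfd \<Rightarrow> ('p \<Rightarrow> 'q) \<Rightarrow>
     ('p, 2) chart \<Rightarrow> ('q, 3) chart \<Rightarrow> real ^ 2 \<Rightarrow> real ^ 3" where
  "unit_normal M N \<psi> c d x = (let F = local_rep \<psi> c d; h = metric N d (F x) in
     THE \<eta>. h \<eta> \<eta> = 1 \<and> (\<forall>u. h (deriv_along F x u) \<eta> = 0) \<and>
       det (vector [deriv_along F x (axis 1 1), deriv_along F x (axis 2 1), \<eta>] :: real ^ 3 ^ 3) > 0)"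

definition shape_unit_normal ::
  "('p, 2) riem_mfd \<Rightarrow> ('q, 3) riem_mfd \<Rightarrow> ('p \<Rightarrow> 'q) \<Rightarrow>
     ('p, 2) chart \<Rightarrow> ('q, 3) chart \<Rightarrow> real ^ 2 \<Rightarrow> real ^ 2 \<Rightarrow> real ^ 2" where
  "shape_unit_normal M N \<psi> c d x = shape_operator M N \<psi> c d x (unit_normal M N \<psi> c d x)"

definition isoparametric_on ::
  "'p set \<Rightarrow> ('p, 2) riem_mfd \<Rightarrow> ('q, 3) riem_mfd \<Rightarrow> ('p \<Rightarrow> 'q) \<Rightarrow> bool" where
  "isoparametric_on V M N \<psi> \<longleftrightarrow>
     (\<exists>\<kappa>\<^sub>1 \<kappa>\<^sub>2. \<forall>p c d. charts_at V M N \<psi> p c d \<longrightarrow>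
        eigenvalues (shape_unit_normal M N \<psi> c d (cmap c p)) = {\<kappa>\<^sub>1, \<kappa>\<^sub>2})"

definition isoparametric_surface ::
  "'p set \<Rightarrow> ('p, 2) riem_mfd \<Rightarrow> ('q, 3) riem_mfd \<Rightarrow> ('p \<Rightarrow> 'q) \<Rightarrow> bool" where
  "isoparametric_surface V M N \<psi> \<longleftrightarrow>
     openin (mtop M) V \<and> connectedin (mtop M) V \<and>
     isometric_immersion_on V M N \<psi> \<and> isoparametric_on V M N \<psi>"

end

theory Submission
  imports Defs
begin

text \<open>Since the eigenvalues of \<open>T = A\<^sub>H\<close> are constant, \<open>|H|\<^sup>2\<close> is constant and biconservativity says
  that \<open>T\<close> is divergence free. Differentiating \<open>T\<^sup>2 = (a + b) T - a b\<close> shows that each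
  \<open>\<nabla>\<^sub>u T\<close> interchanges the two eigenspaces, and with vanishing divergence this forces \<open>\<nabla>T = 0\<close>.
  Hence the unit eigenvector fields are parallel and their dual forms closed; their potentials are
  flat coordinates \<open>(s, t)\<close> in which \<open>T\<close> is diagonal. Any operator \<open>\<alpha> I + \<beta> T\<close>, with eigenvalues
  \<open>k\<^sub>1\<close> and \<open>k\<^sub>2\<close>, is then the shape operator of the torus, cylinder or tube with these principal
  curvatures in the space form of curvature \<open>- k\<^sub>1 k\<^sub>2\<close>, parametrised by \<open>(s, t)\<close>; the theorem is the
  cases \<open>T\<close> and \<open>S\<^sub>2 = - (a + b) I + 4 T\<close>. That the data fit together on overlapping charts is
  the tensoriality of the second fundamental form.\<close>

section \<open>Calculus of smooth maps\<close>

text \<open>The value of \<open>c\<close> is the Gauss equation: parallel eigenvectors make the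
  metric flat, so principal curvatures \<open>k1\<close>, \<open>k2\<close> in a space of curvature
  \<open>c\<close> require c + k1 k2 = 0. With a + b = 2 |H|^2 and \<mu> = a - b this reads c =
  \<mu>^2/4 - |H|^4 for T, and c = 4 (\<mu>^2 - |H|^4) for S_2, whose eigenvalues are 3a - b and 3b
  - a. The surfaces are written down explicitly, so no existence theorem for prescribed fundamental
  forms has to be proved; the flat coordinates take over the role of the Gauss and Codazzi
  equations. Three demands shape the rest. The ambient space must be complete, so for c > 0 a whole
  sphere with an atlas is built although only a neighbourhood of one point is met. The claims
  concern all charts, so this atlas is arranged to have a single chart near that point. The unit
  normal is fixed by the orientations, so the flat coordinates must have positive Jacobian;
  otherwise the shape operator would change its sign.\<close>

lemma deriv_along_eq:
  "(f has_derivative f') (at x) \<Longrightarrow> deriv_along f x v = f' v"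
  by (metis frechet_derivative_at)

lemma has_derivative_deriv_along:
  "f differentiable (at x) \<Longrightarrow> (f has_derivative deriv_along f x) (at x)"
  by (simp add: frechet_derivative_works[symmetric])

lemma deriv_along_cong:
  assumes "open S" "x \<in> S" "\<And>y. y \<in> S \<Longrightarrow> f y = g y"
  shows "deriv_along f x v = deriv_along g x v"
proof (cases "f differentiable (at x)")
  case True
  then show ?thesis
    using frechet_derivative_transform_within_open[of f x S g] assms by metis
next
  case False
  \<comment> \<open>\<open>frechet_derivative\<close> is a Hilbert choice. Both maps have the same
    candidates at \<open>x\<close>, so the chosen values agree even where no derivative
    exists.\<close>
  have "(f has_derivative D) (at x) \<longleftrightarrow> (g has_derivative D) (at x)" for D
    using has_derivative_transform_within_open[of f D x UNIV S g]
      has_derivative_transform_within_open[of g D x UNIV S f] assms by auto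
  then show ?thesis
    by (simp add: frechet_derivative_def)
qed

lemma differentiable_cong:
  assumes "open S" "x \<in> S" "\<And>y. y \<in> S \<Longrightarrow> f y = g y" "f differentiable (at x)"
  shows "g differentiable (at x)"
  using has_derivative_transform_within_open[of f _ x UNIV S g] assms
  unfolding differentiable_def by blast

section \<open>Closure properties of maps of class C^k\<close>

lemma Ck_on_cong:
  assumes "open S" "\<And>y. y \<in> S \<Longrightarrow> f y = g y" "Ck_on k f S"
  shows "Ck_on k g S"
  using assms(2,3)
proof (induction k arbitrary: f g)
  case 0
  then show ?case by (metis Ck_on.simps(1) continuous_on_cong)
next
  case (Suc k)
  have "g differentiable (at x)" if "x \<in> S" for x
    using differentiable_cong[OF assms(1) that] Suc.prems that by auto
  moreover have "Ck_on k (\<lambda>x. deriv_along g x v) S" for v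
    by (rule Suc.IH[of "\<lambda>x. deriv_along f x v"])
      (use Suc.prems deriv_along_cong[OF assms(1) _ Suc.prems(1)] in auto)
  ultimately show ?case by simp
qed

lemma Ck_on_subset: "Ck_on k f S \<Longrightarrow> T \<subseteq> S \<Longrightarrow> Ck_on k f T"
  by (induction k arbitrary: f) (auto intro: continuous_on_subset)

lemma Ck_on_SucD: "Ck_on (Suc k) f S \<Longrightarrow> Ck_on k f S"
proof (induction k arbitrary: f)
  case 0
  then show ?case
    by (auto intro!: continuous_at_imp_continuous_on differentiable_imp_continuous_within)
next
  case (Suc k)
  then have "Ck_on k (\<lambda>x. deriv_along f x v) S" for v using Suc.IH by simp
  with Suc.prems show ?case by simp
qed

lemma Ck_on_const [simp]: "Ck_on k (\<lambda>x. c) S"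
  by (induction k arbitrary: c) auto

lemma Ck_on_linear:
  assumes "bounded_linear L" shows "Ck_on k L S"
proof (cases k)
  case 0
  then show ?thesis using assms by (simp add: linear_continuous_on)
next
  case (Suc m)
  have "(L has_derivative L) (at x)" for x
    using assms by (simp add: bounded_linear_imp_has_derivative)
  then show ?thesis
    using Suc by (auto simp: differentiable_def deriv_along_eq[of L L])
qed

lemma Ck_on_add:
  assumes "Ck_on k f S" "Ck_on k g S" "open S"
  shows "Ck_on k (\<lambda>x. f x + g x) S"
  using assms(1,2)
proof (induction k arbitrary: f g)
  case 0
  then show ?case by (simp add: continuous_on_add)
next
  case (Suc k)
  have d: "((\<lambda>x. f x + g x) has_derivative (\<lambda>v. deriv_along f x v + deriv_along g x v)) (at x)"
    if "x \<in> S" for x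
    using Suc.prems that by (auto intro!: derivative_eq_intros has_derivative_deriv_along)
  have "Ck_on k (\<lambda>x. deriv_along f x v + deriv_along g x v) S" for v
    using Suc by auto
  then have "Ck_on k (\<lambda>x. deriv_along (\<lambda>x. f x + g x) x v) S" for v
    by (rule Ck_on_cong[OF assms(3), rotated]) (simp add: deriv_along_eq[OF d])
  then show ?case using d by (auto simp: differentiable_def)
qed

text \<open>Leibniz' rule puts \<open>f\<close> and \<open>g\<close> undifferentiated next to their
  derivatives, so the induction needs both factors one order lower as well;
  \<open>Ck_on_SucD\<close> supplies this.\<close>

lemma Ck_on_bilinear:
  assumes "Ck_on k f S" "Ck_on k g S" "open S" and bl: "bounded_bilinear bop"
  shows "Ck_on k (\<lambda>x. bop (f x) (g x)) S"
  using assms(1,2)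
proof (induction k arbitrary: f g)
  case 0
  then show ?case by (simp add: bounded_bilinear.continuous_on[OF bl])
next
  case (Suc k)
  have d: "((\<lambda>x. bop (f x) (g x)) has_derivative
      (\<lambda>v. bop (f x) (deriv_along g x v) + bop (deriv_along f x v) (g x))) (at x)"
    if "x \<in> S" for x
    using Suc.prems that
    by (intro bounded_bilinear.FDERIV[OF bl] has_derivative_deriv_along) auto
  have "Ck_on k (\<lambda>x. bop (f x) (deriv_along g x v) + bop (deriv_along f x v) (g x)) S" for v
    using Suc.prems Ck_on_SucD[OF Suc.prems(1)] Ck_on_SucD[OF Suc.prems(2)] assms(3)
    by (intro Ck_on_add Suc.IH) auto
  then have "Ck_on k (\<lambda>x. deriv_along (\<lambda>x. bop (f x) (g x)) x v) S" for v
    by (rule Ck_on_cong[OF assms(3), rotated]) (simp add: deriv_along_eq[OF d])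
  then show ?case using d by (auto simp: differentiable_def)
qed

lemma Ck_on_sum:
  assumes "\<And>i. i \<in> I \<Longrightarrow> Ck_on k (f i) S" "open S"
  shows "Ck_on k (\<lambda>x. \<Sum>i\<in>I. f i x) S"
  using assms(1) by (induction I rule: infinite_finite_induct) (auto intro!: Ck_on_add assms(2))

lemma deriv_along_compose:
  fixes g :: "'a::real_normed_vector \<Rightarrow> 'b::euclidean_space"
  assumes "f differentiable (at (g x))" "g differentiable (at x)"
  shows "deriv_along (\<lambda>x. f (g x)) x v = deriv_along f (g x) (deriv_along g x v)"
  using frechet_derivative_compose[OF assms(2,1)] by (simp add: o_def)

lemma linear_deriv_along: "f differentiable (at x) \<Longrightarrow> linear (deriv_along f x)"
  by (rule linear_frechet_derivative)

lemma linear_Basis_expand: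
  fixes L :: "'a::euclidean_space \<Rightarrow> 'b::real_vector"
  assumes "linear L"
  shows "L v = (\<Sum>b\<in>Basis. (v \<bullet> b) *\<^sub>R L b)"
proof -
  have "L v = L (\<Sum>b\<in>Basis. (v \<bullet> b) *\<^sub>R b)" by (simp add: euclidean_representation)
  also have "\<dots> = (\<Sum>b\<in>Basis. (v \<bullet> b) *\<^sub>R L b)"
    by (simp add: linear_sum[OF assms] linear_scale[OF assms])
  finally show ?thesis .
qed

text \<open>The chain rule differentiates \<open>f\<close> in the direction
  \<open>deriv_along g x v\<close>, which moves with \<open>x\<close>, whereas \<open>Ck_on\<close>
  speaks of fixed directions. Expansion over \<open>Basis\<close> leaves fixed directions with
  varying coefficients.\<close>

lemma Ck_on_compose:
  fixes f :: "'b::euclidean_space \<Rightarrow> 'c::real_normed_vector" and g :: "'a::real_normed_vector \<Rightarrow> 'b"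
  assumes "Ck_on k f T" "Ck_on k g S" "open S" "g ` S \<subseteq> T"
  shows "Ck_on k (\<lambda>x. f (g x)) S"
  using assms(1,2)
proof (induction k arbitrary: f)
  case 0
  then show ?case using assms(4) by (auto intro: continuous_on_compose2)
next
  case (Suc k)
  have df: "f differentiable (at (g x))" and dg: "g differentiable (at x)" if "x \<in> S" for x
    using Suc.prems that assms(4) by auto
  have d: "deriv_along (\<lambda>x. f (g x)) x v
      = (\<Sum>b\<in>Basis. (deriv_along g x v \<bullet> b) *\<^sub>R deriv_along f (g x) b)" if "x \<in> S" for x v
    unfolding deriv_along_compose[OF df[OF that] dg[OF that]]
    by (rule linear_Basis_expand[OF linear_deriv_along[OF df[OF that]]])
  have "Ck_on k (\<lambda>x. deriv_along f (g x) b) S" for b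
    using Suc.prems Ck_on_SucD by (intro Suc.IH) auto
  then have "Ck_on k (\<lambda>x. \<Sum>b\<in>Basis. (deriv_along g x v \<bullet> b) *\<^sub>R deriv_along f (g x) b) S" for v
    using Suc.prems
    by (intro Ck_on_sum Ck_on_bilinear[OF _ _ _ bounded_bilinear_scaleR]
        Ck_on_bilinear[OF _ _ _ bounded_bilinear_inner] assms(3)) auto
  then have "Ck_on k (\<lambda>x. deriv_along (\<lambda>x. f (g x)) x v) S" for v
    by (rule Ck_on_cong[OF assms(3), rotated]) (simp add: d)
  moreover have "(\<lambda>x. f (g x)) differentiable (at x)" if "x \<in> S" for x
    using differentiable_chain_at[OF dg[OF that] df[OF that]] by (simp add: o_def)
  ultimately show ?case by simp
qed

text \<open>The derivative of \<open>inverse\<close> is a polynomial in \<open>inverse\<close>, so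
  each order of regularity yields the next.\<close>

lemma Ck_on_inverse: "Ck_on k (inverse :: real \<Rightarrow> real) (- {0})"
proof (induction k)
  case 0
  then show ?case by (auto intro!: continuous_intros)
next
  case (Suc k)
  have o: "open (- {0::real})" by auto
  have d: "((inverse :: real \<Rightarrow> real) has_derivative (\<lambda>v. - v * (inverse x * inverse x))) (at x)"
    if "x \<in> - {0}" for x :: real
    using that by (auto intro!: derivative_eq_intros)
  have "Ck_on k (\<lambda>x::real. - v * (inverse x * inverse x)) (- {0})" for v
    by (intro Ck_on_bilinear[OF _ _ o bounded_bilinear_mult] Suc Ck_on_const)
  then have "Ck_on k (\<lambda>x::real. deriv_along inverse x v) (- {0})" for v
    by (rule Ck_on_cong[OF o, rotated]) (simp add: deriv_along_eq[OF d])
  then show ?case using d by (auto simp: differentiable_def)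
qed

text \<open>The derivative is a constant times \<open>inverse (sqrt x)\<close>, so the induction
  closes by composition with \<open>inverse\<close>.\<close>

lemma Ck_on_sqrt: "Ck_on k sqrt {0<..}"
proof (induction k)
  case 0
  then show ?case by (auto intro!: continuous_intros)
next
  case (Suc k)
  have o: "open {0::real<..}" by auto
  have d: "(sqrt has_derivative (\<lambda>v. (v / 2) * inverse (sqrt x))) (at x)"
    if "x \<in> {0<..}" for x :: real
    using that by (auto intro!: derivative_eq_intros simp: field_simps)
  have "Ck_on k (\<lambda>x. inverse (sqrt x)) {0<..}"
    by (rule Ck_on_compose[OF Ck_on_inverse Suc o]) auto
  then have "Ck_on k (\<lambda>x::real. (v / 2) * inverse (sqrt x)) {0<..}" for v
    by (intro Ck_on_bilinear[OF _ _ o bounded_bilinear_mult] Ck_on_const)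
  then have "Ck_on k (\<lambda>x::real. deriv_along sqrt x v) {0<..}" for v
    by (rule Ck_on_cong[OF o, rotated]) (simp add: deriv_along_eq[OF d])
  then show ?case using d by (auto simp: differentiable_def)
qed

named_theorems smooth_intros

lemma smooth_on_cong:
  "open S \<Longrightarrow> smooth_on f S \<Longrightarrow> (\<And>y. y \<in> S \<Longrightarrow> f y = g y) \<Longrightarrow> smooth_on g S"
  unfolding smooth_on_def by (intro allI) (rule Ck_on_cong[of S f g], auto)

lemma smooth_on_subset: "smooth_on f S \<Longrightarrow> T \<subseteq> S \<Longrightarrow> smooth_on f T"
  unfolding smooth_on_def by (intro allI) (rule Ck_on_subset[of _ f S], auto)

lemma smooth_on_empty [simp]: "smooth_on f {}"
proof -
  have "Ck_on k f {}" for k by (induction k arbitrary: f) auto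
  then show ?thesis by (simp add: smooth_on_def)
qed

lemma smooth_on_differentiable: "smooth_on f S \<Longrightarrow> x \<in> S \<Longrightarrow> f differentiable (at x)"
  unfolding smooth_on_def by (drule spec[of _ 1]) simp

lemma smooth_on_imp_continuous_on: "smooth_on f S \<Longrightarrow> continuous_on S f"
  unfolding smooth_on_def by (drule spec[of _ 0]) simp

lemma smooth_on_const [smooth_intros]: "smooth_on (\<lambda>x. c) S"
  by (simp add: smooth_on_def)

lemma smooth_on_linear: "bounded_linear L \<Longrightarrow> smooth_on L S"
  by (simp add: smooth_on_def Ck_on_linear)

lemma smooth_on_id [smooth_intros]: "smooth_on (\<lambda>x. x) S"
  by (rule smooth_on_linear) (rule bounded_linear_ident)

lemma smooth_on_add [smooth_intros]:
  "smooth_on f S \<Longrightarrow> smooth_on g S \<Longrightarrow> open S \<Longrightarrow> smooth_on (\<lambda>x. f x + g x) S"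
  by (simp add: smooth_on_def Ck_on_add)

lemma smooth_on_bilinear:
  "bounded_bilinear bop \<Longrightarrow> smooth_on f S \<Longrightarrow> smooth_on g S \<Longrightarrow> open S \<Longrightarrow>
    smooth_on (\<lambda>x. bop (f x) (g x)) S"
  by (simp add: smooth_on_def Ck_on_bilinear)

lemmas smooth_on_mult [smooth_intros] = smooth_on_bilinear[OF bounded_bilinear_mult]
lemmas smooth_on_scaleR [smooth_intros] = smooth_on_bilinear[OF bounded_bilinear_scaleR]
lemmas smooth_on_inner [smooth_intros] = smooth_on_bilinear[OF bounded_bilinear_inner]

lemma smooth_on_linear_compose:
  assumes "bounded_linear L" "smooth_on f S" "open S"
  shows "smooth_on (\<lambda>x. L (f x)) S"
proof -
  \<comment> \<open>A linear map is treated as a bilinear one whose scalar argument is frozen at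
    1.\<close>
  have "bounded_bilinear (\<lambda>(c::real) x. c *\<^sub>R L x)"
    by (rule bounded_bilinear.comp[OF bounded_bilinear_scaleR bounded_linear_ident assms(1)])
  from smooth_on_bilinear[OF this smooth_on_const[of 1] assms(2,3)] show ?thesis by simp
qed

lemmas smooth_on_minus [smooth_intros] =
  smooth_on_linear_compose[OF bounded_linear_minus[OF bounded_linear_ident]]
lemmas smooth_on_nth [smooth_intros] = smooth_on_linear_compose[OF bounded_linear_vec_nth]

lemma smooth_on_diff [smooth_intros]:
  "smooth_on f S \<Longrightarrow> smooth_on g S \<Longrightarrow> open S \<Longrightarrow> smooth_on (\<lambda>x. f x - g x) S"
  using smooth_on_add[of f S "\<lambda>x. - g x"] smooth_on_minus[of g S] by simp

lemma smooth_on_sum [smooth_intros]: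
  "(\<And>i. i \<in> I \<Longrightarrow> smooth_on (f i) S) \<Longrightarrow> open S \<Longrightarrow> smooth_on (\<lambda>x. \<Sum>i\<in>I. f i x) S"
  by (simp add: smooth_on_def Ck_on_sum)

lemma smooth_on_power [smooth_intros]:
  fixes f :: "'a::real_normed_vector \<Rightarrow> 'b::real_normed_algebra_1"
  shows "smooth_on f S \<Longrightarrow> open S \<Longrightarrow> smooth_on (\<lambda>x. f x ^ n) S"
  by (induction n) (auto intro!: smooth_intros)

lemma smooth_on_prod [smooth_intros]:
  fixes f :: "'i \<Rightarrow> 'a::real_normed_vector \<Rightarrow> real"
  assumes "\<And>i. i \<in> I \<Longrightarrow> smooth_on (f i) S" "open S"
  shows "smooth_on (\<lambda>x. \<Prod>i\<in>I. f i x) S"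
  using assms(1) by (induction I rule: infinite_finite_induct) (auto intro!: smooth_intros assms(2))

lemma smooth_on_compose:
  fixes f :: "'b::euclidean_space \<Rightarrow> 'c::real_normed_vector" and g :: "'a::real_normed_vector \<Rightarrow> 'b"
  shows "smooth_on f T \<Longrightarrow> smooth_on g S \<Longrightarrow> open S \<Longrightarrow> g ` S \<subseteq> T \<Longrightarrow> smooth_on (\<lambda>x. f (g x)) S"
  unfolding smooth_on_def by (intro allI) (rule Ck_on_compose[of _ f T g S], auto)

lemma smooth_on_inverse [smooth_intros]:
  fixes f :: "'a::real_normed_vector \<Rightarrow> real"
  shows "smooth_on f S \<Longrightarrow> open S \<Longrightarrow> (\<And>x. x \<in> S \<Longrightarrow> f x \<noteq> 0) \<Longrightarrow> smooth_on (\<lambda>x. inverse (f x)) S"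
  by (rule smooth_on_compose[where T = "- {0}"]) (auto simp: smooth_on_def Ck_on_inverse)

lemma smooth_on_divide [smooth_intros]:
  fixes f :: "'a::real_normed_vector \<Rightarrow> real"
  shows "smooth_on f S \<Longrightarrow> smooth_on g S \<Longrightarrow> open S \<Longrightarrow> (\<And>x. x \<in> S \<Longrightarrow> g x \<noteq> 0) \<Longrightarrow>
    smooth_on (\<lambda>x. f x / g x) S"
  unfolding divide_inverse by (intro smooth_intros)

lemma smooth_on_sqrt [smooth_intros]:
  fixes f :: "'a::real_normed_vector \<Rightarrow> real"
  shows "smooth_on f S \<Longrightarrow> open S \<Longrightarrow> (\<And>x. x \<in> S \<Longrightarrow> f x > 0) \<Longrightarrow> smooth_on (\<lambda>x. sqrt (f x)) S"
  by (rule smooth_on_compose[where T = "{0<..}"]) (auto simp: smooth_on_def Ck_on_sqrt)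

lemma smooth_on_euclidean:
  fixes f :: "'a::real_normed_vector \<Rightarrow> 'b::euclidean_space"
  assumes "\<And>b. b \<in> Basis \<Longrightarrow> smooth_on (\<lambda>x. f x \<bullet> b) S" "open S"
  shows "smooth_on f S"
proof -
  have "smooth_on (\<lambda>x. \<Sum>b\<in>Basis. (f x \<bullet> b) *\<^sub>R b) S"
    by (intro smooth_intros assms)
  then show ?thesis by (simp add: euclidean_representation)
qed

lemma smooth_on_vec:
  fixes f :: "'a::real_normed_vector \<Rightarrow> real ^ 'n"
  assumes "\<And>i. smooth_on (\<lambda>x. f x $ i) S" "open S"
  shows "smooth_on f S"
  by (rule smooth_on_euclidean) (use assms in \<open>auto simp: Basis_vec_def inner_axis\<close>)

lemma smooth_on_deriv: "smooth_on f S \<Longrightarrow> smooth_on (\<lambda>x. deriv_along f x v) S"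
  unfolding smooth_on_def by (intro allI, drule_tac x = "Suc k" in spec) simp

lemma smooth_on_deriv_field [smooth_intros]:
  fixes f :: "'a::euclidean_space \<Rightarrow> 'b::real_normed_vector"
  assumes "smooth_on f S" "smooth_on v S" "open S"
  shows "smooth_on (\<lambda>x. deriv_along f x (v x)) S"
proof -
  have "smooth_on (\<lambda>x. \<Sum>b\<in>Basis. (v x \<bullet> b) *\<^sub>R deriv_along f x b) S"
    by (intro smooth_intros assms smooth_on_deriv)
  then show ?thesis
    by (rule smooth_on_cong[OF assms(3)])
      (rule linear_Basis_expand[OF linear_deriv_along, symmetric], rule smooth_on_differentiable[OF assms(1)])
qed

text \<open>Serves maps known only through their differential, such as the potentials of closed
  forms. One order is gained and given up again by \<open>Ck_on_SucD\<close>, so order 0 is no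
  separate case.\<close>

lemma smooth_on_I:
  assumes "\<And>x. x \<in> S \<Longrightarrow> f differentiable (at x)" "\<And>v. smooth_on (\<lambda>x. deriv_along f x v) S"
  shows "smooth_on f S"
proof -
  have "Ck_on (Suc k) f S" for k using assms by (simp add: smooth_on_def)
  then show ?thesis unfolding smooth_on_def by (intro allI) (rule Ck_on_SucD)
qed

section \<open>Symmetry of second derivatives\<close>

abbreviation deriv2_along ::
  "('a::real_normed_vector \<Rightarrow> 'b::real_normed_vector) \<Rightarrow> 'a \<Rightarrow> 'a \<Rightarrow> 'a \<Rightarrow> 'b" where
  "deriv2_along f x u v \<equiv> deriv_along (\<lambda>y. deriv_along f y v) x u"

lemma has_real_derivative_along_line:
  assumes "f differentiable (at (p + a *\<^sub>R u))"
  shows "((\<lambda>a. f (p + a *\<^sub>R u)) has_real_derivative deriv_along f (p + a *\<^sub>R u) u) (at a)"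
proof -
  have "((\<lambda>a. f (p + a *\<^sub>R u)) has_derivative (\<lambda>h. deriv_along f (p + a *\<^sub>R u) (h *\<^sub>R u))) (at a)"
    by (rule has_derivative_compose[of "\<lambda>a. p + a *\<^sub>R u" "\<lambda>h. h *\<^sub>R u" a UNIV f])
      (auto intro!: derivative_eq_intros has_derivative_deriv_along assms)
  moreover have "(\<lambda>h. deriv_along f (p + a *\<^sub>R u) (h *\<^sub>R u)) = (*) (deriv_along f (p + a *\<^sub>R u) u)"
    using linear_scale[OF linear_deriv_along[OF assms]] by auto
  ultimately show ?thesis by (simp add: has_field_derivative_def)
qed

text \<open>The mean value theorem is applied twice: along \<open>u\<close> to the increment in
  direction \<open>v\<close>, then along \<open>v\<close> to the derivative in direction
  \<open>u\<close>. The second difference is symmetric in \<open>u\<close> and \<open>v\<close>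
  while the right side distinguishes them, which is the source of the symmetry below.\<close>

lemma second_difference_mean_value:
  fixes f :: "'a::real_normed_vector \<Rightarrow> real"
  assumes "smooth_on f (ball x d)" "r > 0" "r * (norm u + norm v) < d"
  shows "\<exists>y\<in>ball x d. f (x + r *\<^sub>R u + r *\<^sub>R v) - f (x + r *\<^sub>R u) - (f (x + r *\<^sub>R v) - f x)
    = r\<^sup>2 * deriv2_along f y v u"
proof -
  have mem: "x + a *\<^sub>R u + b *\<^sub>R v \<in> ball x d" if "0 \<le> a" "a \<le> r" "0 \<le> b" "b \<le> r" for a b
  proof -
    have "norm (a *\<^sub>R u + b *\<^sub>R v) \<le> a * norm u + b * norm v"
      using that norm_triangle_ineq[of "a *\<^sub>R u" "b *\<^sub>R v"] by simp
    also have "\<dots> \<le> r * norm u + r * norm v"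
      using that by (intro add_mono mult_right_mono) auto
    also have "\<dots> < d" using assms(3) by (simp add: distrib_left)
    finally show ?thesis
      using norm_minus_commute[of x "x + (a *\<^sub>R u + b *\<^sub>R v)"] by (simp add: dist_norm add.assoc)
  qed
  have df: "f differentiable (at y)" if "y \<in> ball x d" for y
    using smooth_on_differentiable[OF assms(1) that] .
  have ddf: "(\<lambda>y. deriv_along f y u) differentiable (at y)" if "y \<in> ball x d" for y
    using smooth_on_differentiable[OF smooth_on_deriv[OF assms(1)] that] .
  define \<phi> where "\<phi> a = f (x + r *\<^sub>R v + a *\<^sub>R u) - f (x + a *\<^sub>R u)" for a
  have "(\<phi> has_real_derivative
      deriv_along f (x + r *\<^sub>R v + a *\<^sub>R u) u - deriv_along f (x + a *\<^sub>R u) u) (at a)"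
    if "0 \<le> a" "a \<le> r" for a
    unfolding \<phi>_def using that mem[of a r] mem[of a 0] assms(2)
    by (intro DERIV_diff has_real_derivative_along_line df) (auto simp: algebra_simps)
  from MVT2[OF assms(2) this] obtain a where a: "0 < a" "a < r" "\<phi> r - \<phi> 0
      = r * (deriv_along f (x + r *\<^sub>R v + a *\<^sub>R u) u - deriv_along f (x + a *\<^sub>R u) u)"
    by auto
  have "((\<lambda>b. deriv_along f (x + a *\<^sub>R u + b *\<^sub>R v) u) has_real_derivative
      deriv2_along f (x + a *\<^sub>R u + b *\<^sub>R v) v u) (at b)" if "0 \<le> b" "b \<le> r" for b
    using that mem[of a b] a(1,2) by (intro has_real_derivative_along_line ddf) auto
  from MVT2[OF assms(2) this] obtain b where b: "0 < b" "b < r"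
      "deriv_along f (x + a *\<^sub>R u + r *\<^sub>R v) u - deriv_along f (x + a *\<^sub>R u + 0 *\<^sub>R v) u
        = r * deriv2_along f (x + a *\<^sub>R u + b *\<^sub>R v) v u"
    by auto
  have e: "x + r *\<^sub>R v + c *\<^sub>R u = x + c *\<^sub>R u + r *\<^sub>R v" for c
    by simp
  have "f (x + r *\<^sub>R u + r *\<^sub>R v) - f (x + r *\<^sub>R u) - (f (x + r *\<^sub>R v) - f x)
      = r\<^sup>2 * deriv2_along f (x + a *\<^sub>R u + b *\<^sub>R v) v u"
    using a(3)[unfolded \<phi>_def e] b(3) by (simp add: power2_eq_square)
  then show ?thesis using mem[of a b] a b by auto
qed

text \<open>One and the same second difference is r^2 times either mixed derivative, taken at two
  points near \<open>x\<close>. By continuity both are close to their values at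
  \<open>x\<close>.\<close>

lemma deriv2_along_commute_real:
  fixes f :: "'a::real_normed_vector \<Rightarrow> real"
  assumes "smooth_on f S" "open S" "x \<in> S"
  shows "deriv2_along f x u v = deriv2_along f x v u"
proof (rule ccontr)
  assume ne: "\<not> ?thesis"
  \<comment> \<open>Half the gap: numbers within \<open>e\<close> of the two mixed derivatives
    cannot coincide.\<close>
  define e where "e = \<bar>deriv2_along f x u v - deriv2_along f x v u\<bar> / 2"
  have e: "e > 0" using ne by (simp add: e_def)
  have c: "\<forall>\<^sub>F y in nhds x. dist (deriv2_along f y a b) (deriv2_along f x a b) < e" for a b
  proof -
    have "isCont (\<lambda>y. deriv2_along f y a b) x"
      using smooth_on_imp_continuous_on[OF smooth_on_deriv[OF smooth_on_deriv[OF assms(1)]]] assms(2,3)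
      by (auto simp: continuous_on_eq_continuous_at)
    then have "((\<lambda>y. deriv2_along f y a b) \<longlongrightarrow> deriv2_along f x a b) (nhds x)"
      unfolding isCont_def
      by (rule iffD1[OF tendsto_at_iff_tendsto_nhds[where g = "\<lambda>y. deriv2_along f y a b"]])
    then show ?thesis
      using e by (rule tendstoD)
  qed
  have "\<forall>\<^sub>F y in nhds x. y \<in> S" using assms(2,3) by (rule eventually_nhds_in_open)
  with c[of u v] c[of v u] have "\<forall>\<^sub>F y in nhds x. y \<in> S \<and>
      dist (deriv2_along f y u v) (deriv2_along f x u v) < e \<and>
      dist (deriv2_along f y v u) (deriv2_along f x v u) < e"
    by eventually_elim simp
  then obtain d where d: "d > 0" "\<And>y. dist y x < d \<Longrightarrow> y \<in> S"
      "\<And>y. dist y x < d \<Longrightarrow> dist (deriv2_along f y u v) (deriv2_along f x u v) < e"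
      "\<And>y. dist y x < d \<Longrightarrow> dist (deriv2_along f y v u) (deriv2_along f x v u) < e"
    unfolding eventually_nhds_metric by auto
  have sm: "smooth_on f (ball x d)"
    by (rule smooth_on_subset[OF assms(1)]) (use d(2) in \<open>auto simp: dist_commute\<close>)
  \<comment> \<open>The summand 1 keeps the denominator positive and the bound on
    \<open>r * (norm u + norm v)\<close> strict.\<close>
  define r where "r = d / (norm u + norm v + 1)"
  have r: "r > 0" "r * (norm u + norm v) < d"
    using d(1) by (auto simp: r_def field_simps add_pos_nonneg intro!: add_nonneg_pos)
  obtain y where y: "y \<in> ball x d"
      "f (x + r *\<^sub>R u + r *\<^sub>R v) - f (x + r *\<^sub>R u) - (f (x + r *\<^sub>R v) - f x) = r\<^sup>2 * deriv2_along f y v u"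
    using second_difference_mean_value[OF sm r] by blast
  obtain z where z: "z \<in> ball x d"
      "f (x + r *\<^sub>R v + r *\<^sub>R u) - f (x + r *\<^sub>R v) - (f (x + r *\<^sub>R u) - f x) = r\<^sup>2 * deriv2_along f z u v"
    using second_difference_mean_value[OF sm r(1), of v u] r(2) by (auto simp: add.commute)
  have e: "x + r *\<^sub>R v + r *\<^sub>R u = x + r *\<^sub>R u + r *\<^sub>R v" by simp
  have "r\<^sup>2 * deriv2_along f y v u = r\<^sup>2 * deriv2_along f z u v"
    using y(2) z(2)[unfolded e] by linarith
  then have "deriv2_along f y v u = deriv2_along f z u v" using r(1) by simp
  moreover have "dist (deriv2_along f z u v) (deriv2_along f x u v) < e"
    using d(3)[of z] z(1) by (simp add: dist_commute)
  moreover have "dist (deriv2_along f y v u) (deriv2_along f x v u) < e"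
    using d(4)[of y] y(1) by (simp add: dist_commute)
  ultimately show False unfolding e_def dist_real_def by (auto simp: abs_if split: if_splits)
qed

lemma deriv_along_linear_compose:
  assumes "bounded_linear L" "f differentiable (at x)"
  shows "deriv_along (\<lambda>y. L (f y)) x v = L (deriv_along f x v)"
  by (rule deriv_along_eq[OF bounded_linear.has_derivative[OF assms(1)
      has_derivative_deriv_along[OF assms(2)]]])

lemma deriv2_along_linear_compose:
  assumes "bounded_linear L" "smooth_on f S" "open S" "x \<in> S"
  shows "deriv2_along (\<lambda>y. L (f y)) x u v = L (deriv2_along f x u v)"
proof -
  have "deriv2_along (\<lambda>y. L (f y)) x u v = deriv_along (\<lambda>y. L (deriv_along f y v)) x u"
    by (rule deriv_along_cong[OF assms(3,4)])
      (rule deriv_along_linear_compose[OF assms(1) smooth_on_differentiable[OF assms(2)]])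
  also have "\<dots> = L (deriv2_along f x u v)"
    by (rule deriv_along_linear_compose[OF assms(1)
          smooth_on_differentiable[OF smooth_on_deriv[OF assms(2)] assms(4)]])
  finally show ?thesis .
qed

lemma deriv2_along_commute:
  fixes f :: "'a::real_normed_vector \<Rightarrow> 'b::euclidean_space"
  assumes "smooth_on f S" "open S" "x \<in> S"
  shows "deriv2_along f x u v = deriv2_along f x v u"
proof (rule euclidean_eqI)
  fix b :: 'b assume "b \<in> Basis"
  have "smooth_on (\<lambda>y. f y \<bullet> b) S" using assms by (intro smooth_intros)
  from deriv2_along_commute_real[OF this assms(2,3), of u v]
  show "deriv2_along f x u v \<bullet> b = deriv2_along f x v u \<bullet> b"
    using deriv2_along_linear_compose[OF bounded_linear_inner_left assms, of b] by simp
qed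

section \<open>Product and chain rules for varying linear and bilinear maps\<close>

lemma deriv_along_add:
  "f differentiable (at x) \<Longrightarrow> g differentiable (at x) \<Longrightarrow>
    deriv_along (\<lambda>y. f y + g y) x v = deriv_along f x v + deriv_along g x v"
  by (rule deriv_along_eq[OF has_derivative_add]) (auto intro: has_derivative_deriv_along)

lemma linear_deriv_along_param:
  assumes "open S" "x \<in> S" "\<And>y. y \<in> S \<Longrightarrow> linear (L y)" "\<And>v. (\<lambda>y. L y v) differentiable (at x)"
  shows "linear (\<lambda>v. deriv_along (\<lambda>y. L y v) x u)"
proof (rule linearI)
  fix v w and c :: real
  have "deriv_along (\<lambda>y. L y (v + w)) x u = deriv_along (\<lambda>y. L y v + L y w) x u"
    by (rule deriv_along_cong[OF assms(1,2)]) (rule linear_add[OF assms(3)])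
  then show "deriv_along (\<lambda>y. L y (v + w)) x u = deriv_along (\<lambda>y. L y v) x u + deriv_along (\<lambda>y. L y w) x u"
    by (simp add: deriv_along_add assms(4))
  have "deriv_along (\<lambda>y. L y (c *\<^sub>R v)) x u = deriv_along (\<lambda>y. c *\<^sub>R L y v) x u"
    by (rule deriv_along_cong[OF assms(1,2)]) (rule linear_scale[OF assms(3)])
  also have "\<dots> = c *\<^sub>R deriv_along (\<lambda>y. L y v) x u"
    by (rule deriv_along_linear_compose[OF bounded_linear_scaleR_right assms(4)])
  finally show "deriv_along (\<lambda>y. L y (c *\<^sub>R v)) x u = c *\<^sub>R deriv_along (\<lambda>y. L y v) x u" .
qed

lemma linear_deriv2_along_right:
  assumes "smooth_on f S" "open S" "x \<in> S"
  shows "linear (\<lambda>v. deriv2_along f x u v)"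
proof (rule linear_deriv_along_param[OF assms(2,3)])
  show "linear (deriv_along f y)" if "y \<in> S" for y
    by (rule linear_deriv_along[OF smooth_on_differentiable[OF assms(1) that]])
  show "(\<lambda>y. deriv_along f y v) differentiable (at x)" for v
    by (rule smooth_on_differentiable[OF smooth_on_deriv[OF assms(1)] assms(3)])
qed

lemma linear_deriv2_along_left:
  assumes "smooth_on f S" "x \<in> S"
  shows "linear (\<lambda>u. deriv2_along f x u v)"
  using linear_deriv_along[OF smooth_on_differentiable[OF smooth_on_deriv[OF assms(1)] assms(2)]] .

text \<open>Product rule when operator and argument both vary. Only \<open>L y v\<close> with fixed
  \<open>v\<close> is known to be differentiable, so the argument is expanded over
  \<open>Basis\<close>; the first summand of the result keeps it frozen at
  \<open>a x\<close>.\<close>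

lemma has_derivative_linear_field:
  fixes L :: "'a::real_normed_vector \<Rightarrow> 'b::euclidean_space \<Rightarrow> 'c::real_normed_vector"
  assumes "open S" "x \<in> S" "\<And>y. y \<in> S \<Longrightarrow> linear (L y)"
    "\<And>v. (\<lambda>y. L y v) differentiable (at x)" "a differentiable (at x)"
  shows "((\<lambda>y. L y (a y)) has_derivative
    (\<lambda>u. deriv_along (\<lambda>y. L y (a x)) x u + L x (deriv_along a x u))) (at x)"
proof -
  have ex: "L y w = (\<Sum>b\<in>Basis. (w \<bullet> b) *\<^sub>R L y b)" if "y \<in> S" for y w
    by (rule linear_Basis_expand[OF assms(3)[OF that]])
  have dsum: "((\<lambda>y. \<Sum>b\<in>Basis. (w y \<bullet> b) *\<^sub>R L y b) has_derivative
      (\<lambda>u. \<Sum>b\<in>Basis. (w x \<bullet> b) *\<^sub>R deriv_along (\<lambda>y. L y b) x u + (deriv_along w x u \<bullet> b) *\<^sub>R L x b)) (at x)"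
    if "w differentiable (at x)" for w
    by (intro has_derivative_sum has_derivative_scaleR has_derivative_inner_left
        has_derivative_deriv_along assms(4) that)
  have 1: "((\<lambda>y. L y (a y)) has_derivative (\<lambda>u. (\<Sum>b\<in>Basis. (a x \<bullet> b) *\<^sub>R deriv_along (\<lambda>y. L y b) x u
      + (deriv_along a x u \<bullet> b) *\<^sub>R L x b))) (at x)"
    by (rule has_derivative_transform_within_open[OF dsum[OF assms(5)] assms(1,2)])
      (rule ex[symmetric])
  \<comment> \<open>The same formula for the constant argument \<open>a x\<close> identifies the
    first half of the sum.\<close>
  have 2: "((\<lambda>y. L y (a x)) has_derivative (\<lambda>u. (\<Sum>b\<in>Basis. (a x \<bullet> b) *\<^sub>R deriv_along (\<lambda>y. L y b) x u))) (at x)"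
    by (rule has_derivative_transform_within_open[OF has_derivative_eq_rhs[OF dsum[of "\<lambda>_. a x"]] assms(1,2)])
      (auto intro!: ex[symmetric])
  have 3: "(\<Sum>b\<in>Basis. (a x \<bullet> b) *\<^sub>R deriv_along (\<lambda>y. L y b) x u + (deriv_along a x u \<bullet> b) *\<^sub>R L x b)
      = deriv_along (\<lambda>y. L y (a x)) x u + L x (deriv_along a x u)" for u
    unfolding deriv_along_eq[OF 2] sum.distrib ex[OF assms(2), symmetric] ..
  show ?thesis
    by (rule has_derivative_eq_rhs[OF 1]) (simp add: 3)
qed

lemma deriv_along_compose_smooth:
  fixes f :: "'b::euclidean_space \<Rightarrow> 'c::real_normed_vector" and g :: "'a::real_normed_vector \<Rightarrow> 'b"
  assumes "smooth_on f T" "smooth_on g S" "g ` S \<subseteq> T" "x \<in> S"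
  shows "deriv_along (\<lambda>x. f (g x)) x v = deriv_along f (g x) (deriv_along g x v)"
  by (rule deriv_along_compose) (use assms smooth_on_differentiable in blast)+

lemma deriv2_along_compose:
  fixes f :: "'b::euclidean_space \<Rightarrow> 'c::real_normed_vector" and g :: "'a::euclidean_space \<Rightarrow> 'b"
  assumes f: "smooth_on f T" "open T" and g: "smooth_on g S" "open S" "g ` S \<subseteq> T" and x: "x \<in> S"
  shows "deriv2_along (\<lambda>x. f (g x)) x u v
    = deriv2_along f (g x) (deriv_along g x u) (deriv_along g x v)
      + deriv_along f (g x) (deriv2_along g x u v)"
proof -
  have gx: "g x \<in> T" using g(3) x by auto
  have "deriv2_along (\<lambda>x. f (g x)) x u v = deriv_along (\<lambda>y. deriv_along f (g y) (deriv_along g y v)) x u"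
    by (rule deriv_along_cong[OF g(2) x]) (rule deriv_along_compose_smooth[OF f(1) g(1) g(3)])
  also have "\<dots> = deriv_along (\<lambda>y. deriv_along f (g y) (deriv_along g x v)) x u
      + deriv_along f (g x) (deriv2_along g x u v)"
  proof (rule deriv_along_eq[OF has_derivative_linear_field[OF g(2) x]])
    show "linear (deriv_along f (g y))" if "y \<in> S" for y
      using linear_deriv_along[OF smooth_on_differentiable[OF f(1)]] that g(3) by blast
    show "(\<lambda>y. deriv_along f (g y) v) differentiable at x" for v
      using smooth_on_compose[OF smooth_on_deriv[OF f(1)] g(1,2,3)] smooth_on_differentiable x by blast
    show "(\<lambda>y. deriv_along g y v) differentiable at x"
      using smooth_on_deriv[OF g(1)] smooth_on_differentiable x by blast
  qed
  also have "deriv_along (\<lambda>y. deriv_along f (g y) (deriv_along g x v)) x u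
      = deriv2_along f (g x) (deriv_along g x u) (deriv_along g x v)"
    by (rule deriv_along_compose_smooth[OF smooth_on_deriv[OF f(1)] g(1,3) x])
  finally show ?thesis .
qed

lemma has_derivative_bilinear_field:
  fixes h :: "'a::real_normed_vector \<Rightarrow> 'b::euclidean_space \<Rightarrow> 'c::euclidean_space \<Rightarrow> 'd::real_normed_vector"
  assumes "open S" "x \<in> S" "\<And>y. y \<in> S \<Longrightarrow> bilinear (h y)"
    "\<And>v w. (\<lambda>y. h y v w) differentiable (at x)" "a differentiable (at x)" "b differentiable (at x)"
  shows "((\<lambda>y. h y (a y) (b y)) has_derivative
    (\<lambda>u. deriv_along (\<lambda>y. h y (a x) (b x)) x u + h x (deriv_along a x u) (b x)
       + h x (a x) (deriv_along b x u))) (at x)"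
proof -
  have l: "linear (h y v)" "linear (\<lambda>v. h y v w)" if "y \<in> S" for y v w
    using assms(3)[OF that] by (auto simp: bilinear_def)
  have 1: "((\<lambda>y. h y (a y) w) has_derivative
      (\<lambda>u. deriv_along (\<lambda>y. h y (a x) w) x u + h x (deriv_along a x u) w)) (at x)" for w
    by (rule has_derivative_linear_field[OF assms(1,2)]) (auto intro!: l assms)
  have 2: "(\<lambda>y. h y (a y) w) differentiable (at x)" for w
    using 1 unfolding differentiable_def by blast
  have "((\<lambda>y. h y (a y) (b y)) has_derivative
      (\<lambda>u. deriv_along (\<lambda>y. h y (a y) (b x)) x u + h x (a x) (deriv_along b x u))) (at x)"
    by (rule has_derivative_linear_field[OF assms(1,2)]) (auto intro!: l assms 2)
  then show ?thesis by (simp add: deriv_along_eq[OF 1])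
qed

lemma smooth_on_linear_field:
  fixes L :: "'a::real_normed_vector \<Rightarrow> 'b::euclidean_space \<Rightarrow> 'c::real_normed_vector"
  assumes "open S" "\<And>x. x \<in> S \<Longrightarrow> linear (L x)" "\<And>v. smooth_on (\<lambda>x. L x v) S" "smooth_on a S"
  shows "smooth_on (\<lambda>x. L x (a x)) S"
proof -
  have "smooth_on (\<lambda>x. \<Sum>b\<in>Basis. (a x \<bullet> b) *\<^sub>R L x b) S"
    by (intro smooth_intros assms)
  then show ?thesis
    by (rule smooth_on_cong[OF assms(1)]) (rule linear_Basis_expand[OF assms(2), symmetric])
qed

lemma smooth_on_bilinear_field:
  fixes h :: "'a::real_normed_vector \<Rightarrow> 'b::euclidean_space \<Rightarrow> 'c::euclidean_space \<Rightarrow> 'd::real_normed_vector"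
  assumes "open S" "\<And>x. x \<in> S \<Longrightarrow> bilinear (h x)" "\<And>v w. smooth_on (\<lambda>x. h x v w) S"
    "smooth_on a S" "smooth_on b S"
  shows "smooth_on (\<lambda>x. h x (a x) (b x)) S"
proof (rule smooth_on_linear_field[OF assms(1) _ _ assms(5)])
  show "linear (h x (a x))" if "x \<in> S" for x
    using assms(2)[OF that] by (simp add: bilinear_def)
  show "smooth_on (\<lambda>x. h x (a x) v) S" for v
    by (rule smooth_on_linear_field[OF assms(1) _ assms(3) assms(4)])
      (use assms(2) in \<open>simp add: bilinear_def\<close>)
qed

section \<open>Riemannian metrics in a coordinate domain\<close>

lemma linear_axis_expand:
  fixes L :: "real ^ 'n \<Rightarrow> 'b::real_vector"
  assumes "linear L"
  shows "L v = (\<Sum>i\<in>UNIV. (v $ i) *\<^sub>R L (axis i 1))"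
proof -
  have "L v = L (\<Sum>i\<in>UNIV. (v $ i) *\<^sub>R axis i 1)"
    using basis_expansion[of v] by (simp add: scalar_mult_eq_scaleR)
  then show ?thesis
    by (simp add: linear_sum[OF assms] linear_scale[OF assms])
qed

lemma linear_eq_axisI:
  fixes L :: "real ^ 'n \<Rightarrow> 'b::real_vector"
  assumes "linear L" "linear L'" "\<And>i. L (axis i 1) = L' (axis i 1)"
  shows "L v = L' v"
  using linear_axis_expand[OF assms(1), of v] linear_axis_expand[OF assms(2), of v] assms(3) by simp

lemma bilinear_linear:
  assumes "bilinear h"
  shows "linear (h u)" "linear (\<lambda>u. h u v)"
  using assms by (auto simp: bilinear_def)

lemma smooth_on_det [smooth_intros]:
  fixes A :: "'a::real_normed_vector \<Rightarrow> real ^ 'n ^ 'n"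
  assumes "\<And>i j. smooth_on (\<lambda>x. A x $ i $ j) S" "open S"
  shows "smooth_on (\<lambda>x. det (A x)) S"
  unfolding det_def by (intro smooth_intros assms)

text \<open>\<open>second_ff\<close> freed from manifolds and charts, for any map between coordinate
  domains: the covariant Hessian of the map. It is also applied to chart transitions, where it
  vanishes.\<close>

definition sff ::
  "(real ^ 'm::finite \<Rightarrow> real ^ 'm \<Rightarrow> real ^ 'm \<Rightarrow> real) \<Rightarrow> (real ^ 'n::finite \<Rightarrow> real ^ 'n \<Rightarrow> real ^ 'n \<Rightarrow> real) \<Rightarrow>
    (real ^ 'm \<Rightarrow> real ^ 'n) \<Rightarrow> real ^ 'm \<Rightarrow> real ^ 'm \<Rightarrow> real ^ 'm \<Rightarrow> real ^ 'n" where
  "sff g h F x u v = deriv2_along F x u v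
     + christoffel h (F x) (deriv_along F x u) (deriv_along F x v)
     - deriv_along F x (christoffel g x u v)"

locale local_metric =
  fixes g :: "real ^ 'n::finite \<Rightarrow> real ^ 'n \<Rightarrow> real ^ 'n \<Rightarrow> real" and S :: "(real ^ 'n) set"
  assumes open_dom: "open S"
    and bilin: "x \<in> S \<Longrightarrow> bilinear (g x)"
    and sym: "x \<in> S \<Longrightarrow> g x u v = g x v u"
    and pos: "x \<in> S \<Longrightarrow> u \<noteq> 0 \<Longrightarrow> g x u u > 0"
    and smooth: "smooth_on (\<lambda>x. g x u v) S"
begin

lemma metric_linear: "x \<in> S \<Longrightarrow> linear (g x u)" "x \<in> S \<Longrightarrow> linear (\<lambda>u. g x u v)"
  using bilinear_linear[OF bilin] by auto

lemmas metric_simps =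
  linear_add[OF metric_linear(1)] linear_add[OF metric_linear(2)]
  linear_diff[OF metric_linear(1)] linear_diff[OF metric_linear(2)]
  linear_scale[OF metric_linear(1)] linear_scale[OF metric_linear(2)]
  linear_neg[OF metric_linear(1)] linear_neg[OF metric_linear(2)]
  linear_0[OF metric_linear(1)] linear_0[OF metric_linear(2)]

lemma nondegenerate:
  assumes "x \<in> S" "\<And>w. g x z w = g x z' w"
  shows "z = z'"
proof (rule ccontr)
  assume "z \<noteq> z'"
  then have "g x (z - z') (z - z') > 0" using pos[OF assms(1)] by simp
  then show False using assms(2) by (simp add: metric_simps[OF assms(1)])
qed

section \<open>Metric duals of linear forms\<close>

definition gram :: "real ^ 'n \<Rightarrow> real ^ 'n ^ 'n" where
  "gram x = (\<chi> i j. g x (axis j 1) (axis i 1))"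

lemma gram_mult: "x \<in> S \<Longrightarrow> (gram x *v z) $ i = g x z (axis i 1)"
  using linear_axis_expand[OF metric_linear(2), of x z "axis i 1"]
  by (simp add: gram_def matrix_vector_mult_def mult.commute)

lemma det_gram: assumes "x \<in> S" shows "det (gram x) \<noteq> 0"
proof -
  have "z = 0" if "gram x *v z = 0" for z
  proof (rule nondegenerate[OF assms])
    have "g x z (axis i 1) = 0" for i using gram_mult[OF assms, of z i] that by simp
    then show "g x z w = g x 0 w" for w
      using linear_axis_expand[OF metric_linear(1)[OF assms], of z w] by (simp add: metric_simps[OF assms])
  qed
  then show ?thesis
    by (metis invertible_det_nz invertible_left_inverse matrix_left_invertible_ker)
qed

text \<open>The vector that represents a linear form. Christoffel symbols and shape operators are
  both defined by such a \<open>THE\<close>, so this one notion settles their existence and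
  smoothness.\<close>

definition dual :: "real ^ 'n \<Rightarrow> (real ^ 'n \<Rightarrow> real) \<Rightarrow> real ^ 'n" where
  "dual x l = (THE z. \<forall>w. g x z w = l w)"

text \<open>Cramer's rule yields existence and uniqueness at once, and a quotient of determinants
  from which smoothness in \<open>x\<close> can be read off.\<close>

lemma dual_cramer:
  assumes "x \<in> S" "linear l"
  shows "(\<forall>w. g x z w = l w) \<longleftrightarrow>
    z = (\<chi> k. det (\<chi> i j. if j = k then l (axis i 1) else gram x $ i $ j) / det (gram x))"
proof -
  have "(\<forall>w. g x z w = l w) \<longleftrightarrow> gram x *v z = (\<chi> i. l (axis i 1))"
  proof
    assume "\<forall>w. g x z w = l w"
    then show "gram x *v z = (\<chi> i. l (axis i 1))"
      by (simp add: vec_eq_iff gram_mult[OF assms(1)])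
  next
    assume *: "gram x *v z = (\<chi> i. l (axis i 1))"
    have "g x z (axis i 1) = l (axis i 1)" for i
      using gram_mult[OF assms(1), of z i] * by simp
    then show "\<forall>w. g x z w = l w"
      using linear_eq_axisI[OF metric_linear(1)[OF assms(1)] assms(2)] by blast
  qed
  then show ?thesis
    unfolding cramer[OF det_gram[OF assms(1)], of z "\<chi> i. l (axis i 1)", unfolded vec_lambda_beta] .
qed

lemma dual_unique: "x \<in> S \<Longrightarrow> (\<And>w. g x z w = l w) \<Longrightarrow> dual x l = z"
  unfolding dual_def by (rule the_equality) (auto intro: nondegenerate)

lemma dual_eq:
  assumes "x \<in> S" "linear l"
  shows "g x (dual x l) w = l w"
proof -
  obtain z where z: "\<forall>w. g x z w = l w" using dual_cramer[OF assms] by blast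
  then show ?thesis using dual_unique[OF assms(1), of z l] by simp
qed

lemma smooth_dual:
  assumes "open T" "T \<subseteq> S" "\<And>x. x \<in> T \<Longrightarrow> linear (l x)" "\<And>w. smooth_on (\<lambda>x. l x w) T"
  shows "smooth_on (\<lambda>x. dual x (l x)) T"
proof -
  have sg: "smooth_on (\<lambda>x. gram x $ i $ j) T" for i j
    unfolding gram_def by (simp add: smooth_on_subset[OF smooth assms(2)])
  have "smooth_on (\<lambda>x. (\<chi> k. det (\<chi> i j. if j = k then l x (axis i 1) else gram x $ i $ j) / det (gram x))) T"
  proof (rule smooth_on_vec[OF _ assms(1)])
    fix k
    have "smooth_on (\<lambda>x. if j = k then l x (axis i 1) else gram x $ i $ j) T" for i j
      using assms(4) sg by (cases "j = k") auto
    then have "smooth_on (\<lambda>x. det (\<chi> i j. if j = k then l x (axis i 1) else gram x $ i $ j) / det (gram x)) T"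
      using det_gram assms(2) by (intro smooth_on_divide smooth_on_det assms(1) sg) auto
    then show "smooth_on (\<lambda>x. (\<chi> k. det (\<chi> i j. if j = k then l x (axis i 1) else gram x $ i $ j) / det (gram x)) $ k) T"
      by simp
  qed
  then show ?thesis
  proof (rule smooth_on_cong[OF assms(1)])
    fix x assume x: "x \<in> T"
    then have xS: "x \<in> S" using assms(2) by auto
    show "(\<chi> k. det (\<chi> i j. if j = k then l x (axis i 1) else gram x $ i $ j) / det (gram x)) = dual x (l x)"
      using dual_cramer[OF xS assms(3)[OF x], of "dual x (l x)"] dual_eq[OF xS assms(3)[OF x]] by simp
  qed
qed

section \<open>The Levi-Civita connection in coordinates\<close>

lemma metric_differentiable: "x \<in> S \<Longrightarrow> (\<lambda>y. g y u v) differentiable (at x)"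
  by (rule smooth_on_differentiable[OF smooth])

lemma linear_deriv_metric:
  assumes "x \<in> S"
  shows "linear (\<lambda>v. deriv_along (\<lambda>y. g y v w) x u)" "linear (\<lambda>w. deriv_along (\<lambda>y. g y v w) x u)"
    "linear (\<lambda>u. deriv_along (\<lambda>y. g y v w) x u)"
  using linear_deriv_along_param[OF open_dom assms, of "\<lambda>y v. g y v w" u]
    linear_deriv_along_param[OF open_dom assms, of "\<lambda>y w. g y v w" u]
    linear_deriv_along[OF metric_differentiable[OF assms]]
    metric_linear metric_differentiable[OF assms] by auto

definition koszul :: "real ^ 'n \<Rightarrow> real ^ 'n \<Rightarrow> real ^ 'n \<Rightarrow> real ^ 'n \<Rightarrow> real" where
  "koszul x u v w = (deriv_along (\<lambda>y. g y v w) x u + deriv_along (\<lambda>y. g y u w) x v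
        - deriv_along (\<lambda>y. g y u v) x w) / 2"

lemma linear_koszul: "x \<in> S \<Longrightarrow> linear (koszul x u v)"
  unfolding koszul_def
  by (intro linearI) (simp_all add: linear_add[OF linear_deriv_metric(2)] linear_scale[OF linear_deriv_metric(2)]
      linear_add[OF linear_deriv_metric(3)] linear_scale[OF linear_deriv_metric(3)] field_simps)

lemma christoffel_dual: "christoffel g x u v = dual x (koszul x u v)"
  unfolding christoffel_def dual_def koszul_def ..

lemma christoffel_eq: "x \<in> S \<Longrightarrow> g x (christoffel g x u v) w = koszul x u v w"
  unfolding christoffel_dual by (rule dual_eq[OF _ linear_koszul])

lemma christoffel_unique: "x \<in> S \<Longrightarrow> (\<And>w. g x z w = koszul x u v w) \<Longrightarrow> christoffel g x u v = z"
  unfolding christoffel_dual by (rule dual_unique)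

lemma koszul_sym: "x \<in> S \<Longrightarrow> koszul x u v w = koszul x v u w"
  unfolding koszul_def using deriv_along_cong[OF open_dom _ sym, of x "\<lambda>y. y" "\<lambda>_. u" "\<lambda>_. v" w] by simp

lemma christoffel_sym: "x \<in> S \<Longrightarrow> christoffel g x u v = christoffel g x v u"
  by (rule christoffel_unique) (simp_all add: christoffel_eq koszul_sym)

text \<open>In the sum of the Koszul expressions for (u, v, w) and (u, w, v) everything cancels
  except the derivative along \<open>u\<close>, by the symmetry of \<open>g\<close>.\<close>

lemma metric_compatible:
  assumes "x \<in> S"
  shows "deriv_along (\<lambda>y. g y v w) x u = g x (christoffel g x u v) w + g x v (christoffel g x u w)"
proof -
  have s: "deriv_along (\<lambda>y. g y a b) x c = deriv_along (\<lambda>y. g y b a) x c" for a b c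
    by (rule deriv_along_cong[OF open_dom assms]) (rule sym)
  show ?thesis
    unfolding sym[OF assms, of v] christoffel_eq[OF assms] koszul_def
    using s[of u v] s[of w v] s[of w u] by (simp add: field_simps)
qed

lemma bilinear_christoffel: assumes "x \<in> S" shows "bilinear (christoffel g x)"
proof -
  have l: "linear (christoffel g x u)" for u
  proof (rule linearI)
    fix v w and c :: real
    have k: "koszul x u (v + w) a = koszul x u v a + koszul x u w a"
      "koszul x u (c *\<^sub>R v) a = c * koszul x u v a" for a
      unfolding koszul_def
      by (simp_all add: linear_add[OF linear_deriv_metric(1)[OF assms]] linear_scale[OF linear_deriv_metric(1)[OF assms]]
        linear_add[OF linear_deriv_metric(2)[OF assms]] linear_scale[OF linear_deriv_metric(2)[OF assms]]
      linear_add[OF linear_deriv_metric(3)[OF assms]] linear_scale[OF linear_deriv_metric(3)[OF assms]] field_simps)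
    show "christoffel g x u (v + w) = christoffel g x u v + christoffel g x u w"
      by (rule christoffel_unique[OF assms]) (simp add: metric_simps[OF assms] christoffel_eq[OF assms] k)
    show "christoffel g x u (c *\<^sub>R v) = c *\<^sub>R christoffel g x u v"
      by (rule christoffel_unique[OF assms]) (simp add: metric_simps[OF assms] christoffel_eq[OF assms] k)
  qed
  have "(\<lambda>u. christoffel g x u v) = christoffel g x v" for v
    using christoffel_sym[OF assms] by auto
  then show ?thesis unfolding bilinear_def using l by simp
qed

lemma smooth_christoffel: "smooth_on (\<lambda>x. christoffel g x u v) S"
  unfolding christoffel_dual
proof (rule smooth_dual[OF open_dom order_refl linear_koszul])
  fix w
  show "smooth_on (\<lambda>x. koszul x u v w) S"
    unfolding koszul_def by (intro smooth_intros smooth_on_deriv smooth open_dom) simp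
qed

lemma smooth_metric_field:
  assumes "open T" "T \<subseteq> S" "smooth_on a T" "smooth_on b T"
  shows "smooth_on (\<lambda>x. g x (a x) (b x)) T"
  by (rule smooth_on_bilinear_field[OF assms(1) bilin smooth_on_subset[OF smooth assms(2)] assms(3,4)])
    (use assms(2) in blast)

lemma deriv_metric_field:
  assumes "x \<in> S" "a differentiable (at x)" "b differentiable (at x)"
  shows "deriv_along (\<lambda>y. g y (a y) (b y)) x u
    = g x (deriv_along a x u + christoffel g x u (a x)) (b x)
      + g x (a x) (deriv_along b x u + christoffel g x u (b x))"
  using deriv_along_eq[OF has_derivative_bilinear_field[OF open_dom assms(1) bilin
        metric_differentiable[OF assms(1)] assms(2,3)]]
  by (simp add: metric_compatible[OF assms(1)] metric_simps[OF assms(1)])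

subsection \<open>Orthonormal bases and traces\<close>

text \<open>The combination map \<open>L\<close> is injective, since pairing with \<open>e j\<close>
  recovers its coefficients. An injective endomorphism of a finite-dimensional space is onto, so
  every \<open>u\<close> is a combination of the \<open>e i\<close>.\<close>

lemma orthonormal_expand:
  assumes "x \<in> S" "orthonormal_basis_at g x e"
  shows "(\<Sum>i\<in>UNIV. g x u (e i) *\<^sub>R e i) = u"
proof -
  define L where "L c = (\<Sum>i\<in>UNIV. (c $ i) *\<^sub>R e i)" for c :: "real ^ 'n"
  have lin: "linear L"
    unfolding L_def by (intro linearI) (simp_all add: algebra_simps sum.distrib scaleR_sum_right)
  have gL: "g x (L c) (e j) = c $ j" for c j
  proof -
    have "g x (L c) (e j) = (\<Sum>i\<in>UNIV. c $ i * g x (e i) (e j))"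
      unfolding L_def by (simp add: linear_sum[OF metric_linear(2)[OF assms(1)]] metric_simps[OF assms(1)])
    also have "\<dots> = (\<Sum>i\<in>UNIV. if i = j then c $ i else 0)"
      using assms(2) by (intro sum.cong) (auto simp: orthonormal_basis_at_def)
    finally show ?thesis by simp
  qed
  have "inj L" by (rule injI) (metis gL vec_eq_iff)
  then obtain c where c: "u = L c"
    using linear_injective_imp_surjective[OF lin] by (metis surjD)
  show ?thesis unfolding c gL by (simp add: L_def)
qed

text \<open>Expand one copy of \<open>e i\<close> over \<open>e'\<close>, interchange the sums, and
  collect the other copy into \<open>e' j\<close>; the coefficients match by symmetry of the
  metric.\<close>

lemma trace_independent:
  fixes \<beta> :: "real ^ 'n \<Rightarrow> real ^ 'n \<Rightarrow> 'b::real_vector"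
  assumes "x \<in> S" "bilinear \<beta>" "orthonormal_basis_at g x e" "orthonormal_basis_at g x e'"
  shows "(\<Sum>i\<in>UNIV. \<beta> (e i) (e i)) = (\<Sum>i\<in>UNIV. \<beta> (e' i) (e' i))"
proof -
  note l = bilinear_linear[OF assms(2)]
  have "(\<Sum>i\<in>UNIV. \<beta> (e i) (e i)) = (\<Sum>i\<in>UNIV. \<beta> (e i) (\<Sum>j\<in>UNIV. g x (e i) (e' j) *\<^sub>R e' j))"
    by (simp add: orthonormal_expand[OF assms(1,4)])
  also have "\<dots> = (\<Sum>i\<in>UNIV. \<Sum>j\<in>UNIV. g x (e i) (e' j) *\<^sub>R \<beta> (e i) (e' j))"
    by (simp add: linear_sum[OF l(1)] linear_scale[OF l(1)])
  also have "\<dots> = (\<Sum>j\<in>UNIV. \<Sum>i\<in>UNIV. g x (e' j) (e i) *\<^sub>R \<beta> (e i) (e' j))"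
    by (subst sum.swap) (simp add: sym[OF assms(1)])
  also have "\<dots> = (\<Sum>j\<in>UNIV. \<beta> (\<Sum>i\<in>UNIV. g x (e' j) (e i) *\<^sub>R e i) (e' j))"
    by (simp add: linear_sum[OF l(2)] linear_scale[OF l(2)])
  also have "\<dots> = (\<Sum>i\<in>UNIV. \<beta> (e' i) (e' i))"
    by (simp add: orthonormal_expand[OF assms(1,3)])
  finally show ?thesis .
qed

lemma metric_trace_eq:
  assumes "x \<in> S" "bilinear \<beta>" "orthonormal_basis_at g x e"
  shows "metric_trace g x \<beta> = (\<Sum>i\<in>UNIV. \<beta> (e i) (e i))"
  unfolding metric_trace_def Let_def
  \<comment> \<open>The given \<open>e\<close> shows that the Hilbert choice in
    \<open>metric_trace\<close> does pick an orthonormal basis.\<close>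
  by (rule trace_independent[OF assms(1,2) _ assms(3)]) (rule someI[of "orthonormal_basis_at g x", OF assms(3)])

end

subsection \<open>Maps between coordinate domains and their second fundamental form\<close>

text \<open>\<open>W\<close> may be smaller than the coordinate domain \<open>S\<close>:
  representatives of maps and chart transitions make sense only over the points that both charts
  cover.\<close>

locale local_map =
  dom: local_metric g S + cod: local_metric h T
  for g :: "real ^ 'm::finite \<Rightarrow> real ^ 'm \<Rightarrow> real ^ 'm \<Rightarrow> real" and S
    and h :: "real ^ 'n::finite \<Rightarrow> real ^ 'n \<Rightarrow> real ^ 'n \<Rightarrow> real" and T +
  fixes F :: "real ^ 'm \<Rightarrow> real ^ 'n" and W :: "(real ^ 'm) set"
  assumes open_W: "open W" and W_subset: "W \<subseteq> S" and F_image: "F ` W \<subseteq> T"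
    and smooth_F: "smooth_on F W"
begin

lemma in_dom: "x \<in> W \<Longrightarrow> x \<in> S" and in_cod: "x \<in> W \<Longrightarrow> F x \<in> T"
  using W_subset F_image by auto

lemma differentiable_F: "x \<in> W \<Longrightarrow> F differentiable (at x)"
  by (rule smooth_on_differentiable[OF smooth_F])

lemma linear_DF: "x \<in> W \<Longrightarrow> linear (deriv_along F x)"
  by (rule linear_deriv_along[OF differentiable_F])

lemma differentiable_DF: "x \<in> W \<Longrightarrow> (\<lambda>y. deriv_along F y v) differentiable (at x)"
  by (rule smooth_on_differentiable[OF smooth_on_deriv[OF smooth_F]])

lemma smooth_pullback:
  assumes "smooth_on a W" "smooth_on b W"
  shows "smooth_on (\<lambda>x. h (F x) (a x) (b x)) W"
  by (rule smooth_on_bilinear_field[OF open_W])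
    (use in_cod cod.bilin smooth_on_compose[OF cod.smooth smooth_F open_W F_image] assms in auto)

lemma deriv_pullback:
  assumes "x \<in> W" "a differentiable (at x)" "b differentiable (at x)"
  shows "deriv_along (\<lambda>y. h (F y) (a y) (b y)) x u
    = h (F x) (deriv_along a x u + christoffel h (F x) (deriv_along F x u) (a x)) (b x)
      + h (F x) (a x) (deriv_along b x u + christoffel h (F x) (deriv_along F x u) (b x))"
proof -
  note Fx = in_cod[OF assms(1)]
  have 1: "deriv_along (\<lambda>y. h (F y) v w) x u = deriv_along (\<lambda>z. h z v w) (F x) (deriv_along F x u)" for v w
    by (rule deriv_along_compose_smooth[OF cod.smooth smooth_F F_image assms(1)])
  have 2: "(\<lambda>y. h (F y) v w) differentiable (at x)" for v w
    by (rule smooth_on_differentiable[OF smooth_on_compose[OF cod.smooth smooth_F open_W F_image] assms(1)])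
  have "deriv_along (\<lambda>y. h (F y) (a y) (b y)) x u
      = deriv_along (\<lambda>y. h (F y) (a x) (b x)) x u + h (F x) (deriv_along a x u) (b x)
       + h (F x) (a x) (deriv_along b x u)"
    by (rule deriv_along_eq[OF has_derivative_bilinear_field[OF open_W assms(1) _ 2 assms(2,3)]])
      (use in_cod cod.bilin in auto)
  then show ?thesis
    by (simp add: 1 cod.metric_compatible[OF Fx] cod.metric_simps[OF Fx])
qed

lemma bilinear_sff:
  assumes "x \<in> W" shows "bilinear (sff g h F x)"
proof -
  note c = bilinear_linear[OF cod.bilinear_christoffel[OF in_cod[OF assms]]]
  note d = bilinear_linear[OF dom.bilinear_christoffel[OF in_dom[OF assms]]]
  note D = linear_DF[OF assms]
  note r = linear_deriv2_along_right[OF smooth_F open_W assms]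
  note l = linear_deriv2_along_left[OF smooth_F assms]
  show ?thesis
    unfolding bilinear_def sff_def
    by (intro conjI allI linearI)
      (simp_all add: linear_add[OF r] linear_scale[OF r] linear_add[OF l] linear_scale[OF l]
        linear_add[OF c(1)] linear_add[OF c(2)] linear_scale[OF c(1)] linear_scale[OF c(2)]
        linear_add[OF d(1)] linear_add[OF d(2)] linear_scale[OF d(1)] linear_scale[OF d(2)]
        linear_add[OF D] linear_scale[OF D] algebra_simps)
qed

lemma sff_sym:
  assumes "x \<in> W" shows "sff g h F x u v = sff g h F x v u"
  unfolding sff_def
  using deriv2_along_commute[OF smooth_F open_W assms, of u v]
    cod.christoffel_sym[OF in_cod[OF assms]] dom.christoffel_sym[OF in_dom[OF assms]] by simp

lemma smooth_sff: "smooth_on (\<lambda>x. sff g h F x u v) W"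
proof -
  have "smooth_on (\<lambda>x. christoffel h (F x) (deriv_along F x u) (deriv_along F x v)) W"
    by (intro smooth_on_bilinear_field[OF open_W cod.bilinear_christoffel[OF in_cod]
          smooth_on_compose[OF cod.smooth_christoffel smooth_F open_W F_image]] smooth_on_deriv smooth_F)
  then show ?thesis
    unfolding sff_def
    by (intro smooth_on_diff smooth_on_add smooth_on_deriv_field smooth_on_deriv smooth_F open_W
        smooth_on_subset[OF dom.smooth_christoffel W_subset])
qed

text \<open>This is the uniqueness of the Levi-Civita connection. \<open>N\<close> is symmetric and
  differentiates the pulled-back metric by the product rule, so in the Koszul combination only the
  pairing of \<open>N u v\<close> with \<open>deriv_along F x w\<close> survives.\<close>

lemma christoffel_pullback:
  assumes "x \<in> W"
    and isom: "\<And>y u v. y \<in> W \<Longrightarrow> h (F y) (deriv_along F y u) (deriv_along F y v) = g y u v"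
  shows "h (F x) (deriv2_along F x u v + christoffel h (F x) (deriv_along F x u) (deriv_along F x v)) (deriv_along F x w)
    = g x (christoffel g x u v) w"
proof -
  note Fx = in_cod[OF assms(1)]
  define N where "N u v = deriv2_along F x u v + christoffel h (F x) (deriv_along F x u) (deriv_along F x v)" for u v
  have N: "N u v = N v u" for u v
    unfolding N_def using deriv2_along_commute[OF smooth_F open_W assms(1), of u v]
      cod.christoffel_sym[OF Fx] by simp
  have D: "deriv_along (\<lambda>y. g y v w) x u
      = h (F x) (N u v) (deriv_along F x w) + h (F x) (deriv_along F x v) (N u w)" for u v w
  proof -
    have "deriv_along (\<lambda>y. g y v w) x u
        = deriv_along (\<lambda>y. h (F y) (deriv_along F y v) (deriv_along F y w)) x u"
      by (rule deriv_along_cong[OF open_W assms(1)]) (simp add: isom)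
    then show ?thesis
      unfolding N_def using deriv_pullback[OF assms(1) differentiable_DF[OF assms(1)] differentiable_DF[OF assms(1)]]
      by simp
  qed
  have "g x (christoffel g x u v) w = h (F x) (N u v) (deriv_along F x w)"
    unfolding dom.christoffel_eq[OF in_dom[OF assms(1)]] dom.koszul_def D
    using N[of v u] N[of w u] N[of w v] cod.sym[OF Fx] by (simp add: field_simps)
  then show ?thesis by (simp add: N_def)
qed

lemma sff_normal:
  assumes "x \<in> W"
    and isom: "\<And>y u v. y \<in> W \<Longrightarrow> h (F y) (deriv_along F y u) (deriv_along F y v) = g y u v"
  shows "h (F x) (sff g h F x u v) (deriv_along F x w) = 0"
  unfolding sff_def cod.metric_simps[OF in_cod[OF assms(1)]]
  using christoffel_pullback[OF assms] isom[OF assms(1)]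
  by (simp add: cod.metric_simps[OF in_cod[OF assms(1)]])

text \<open>The form takes values normal to the image of the differential; when that image is
  everything, only 0 remains.\<close>

lemma sff_eq_0:
  assumes "x \<in> W"
    and isom: "\<And>y u v. y \<in> W \<Longrightarrow> h (F y) (deriv_along F y u) (deriv_along F y v) = g y u v"
    and "surj (deriv_along F x)"
  shows "sff g h F x u v = 0"
proof (rule cod.nondegenerate[OF in_cod[OF assms(1)]])
  fix w
  obtain w' where "w = deriv_along F x w'" using assms(3) by (metis surjD)
  then show "h (F x) (sff g h F x u v) w = h (F x) 0 w"
    using sff_normal[OF assms(1) isom] by (simp add: cod.metric_simps[OF in_cod[OF assms(1)]])
qed

end

text \<open>The Christoffel term of the middle metric occurs in the form of \<open>F\<close>, pushed
  forward by the derivative of \<open>G\<close>, and with opposite sign in the form of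
  \<open>G\<close>, so it drops out. The rule serves both for changes of charts and for computing
  the constructed immersion.\<close>

lemma sff_compose:
  assumes "local_map g S h T F W" "local_map h T k U G W'" "x \<in> W" "F ` W \<subseteq> W'"
  shows "sff g k (\<lambda>x. G (F x)) x u v
    = sff h k G (F x) (deriv_along F x u) (deriv_along F x v) + deriv_along G (F x) (sff g h F x u v)"
proof -
  interpret F: local_map g S h T F W by fact
  interpret G: local_map h T k U G W' by fact
  have Fx: "F x \<in> W'" using assms by auto
  note D = G.linear_DF[OF Fx]
  show ?thesis
    unfolding sff_def
      deriv2_along_compose[OF G.smooth_F G.open_W F.smooth_F F.open_W assms(4,3)]
      deriv_along_compose_smooth[OF G.smooth_F F.smooth_F assms(4,3)]
    by (simp add: linear_add[OF D] linear_diff[OF D])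
qed

lemma sff_cong:
  assumes "open W" "x \<in> W" "\<And>y. y \<in> W \<Longrightarrow> F y = G y"
  shows "sff g h F x u v = sff g h G x u v"
proof -
  have 1: "deriv_along F y v = deriv_along G y v" if "y \<in> W" for y v
    by (rule deriv_along_cong[OF assms(1) that assms(3)])
  have "deriv2_along F x u v = deriv2_along G x u v"
    by (rule deriv_along_cong[OF assms(1,2)]) (rule 1)
  then show ?thesis unfolding sff_def using 1[OF assms(2)] assms(2,3) by simp
qed

subsection \<open>Metrics on planar domains\<close>

locale local_metric2 = local_metric g S
  for g :: "real ^ 2 \<Rightarrow> real ^ 2 \<Rightarrow> real ^ 2 \<Rightarrow> real" and S
begin

text \<open>Gram-Schmidt applied to the coordinate fields. The basis in \<open>metric_trace\<close>
  is an unrelated choice at each point; smoothness of traces needs a frame that varies smoothly with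
  \<open>x\<close>.\<close>

definition frame1 :: "real ^ 2 \<Rightarrow> real ^ 2" where
  "frame1 x = (1 / sqrt (g x (axis 1 1) (axis 1 1))) *\<^sub>R axis 1 1"

definition frame2_dir :: "real ^ 2 \<Rightarrow> real ^ 2" where
  "frame2_dir x = axis 2 1 - g x (axis 2 1) (frame1 x) *\<^sub>R frame1 x"

definition frame2 :: "real ^ 2 \<Rightarrow> real ^ 2" where
  "frame2 x = (1 / sqrt (g x (frame2_dir x) (frame2_dir x))) *\<^sub>R frame2_dir x"

lemma axis1_pos: "x \<in> S \<Longrightarrow> g x (axis 1 1) (axis 1 1) > 0"
  by (rule pos) (auto simp: axis_eq_0_iff)

lemma frame2_dir_pos: "x \<in> S \<Longrightarrow> g x (frame2_dir x) (frame2_dir x) > 0"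
proof (rule pos)
  have "frame2_dir x $ 2 = 1" by (simp add: frame2_dir_def frame1_def axis_def)
  then show "frame2_dir x \<noteq> 0" by auto
qed

lemma normalize:
  assumes "x \<in> S" "g x v v > 0"
  shows "g x ((1 / sqrt (g x v v)) *\<^sub>R v) ((1 / sqrt (g x v v)) *\<^sub>R v) = 1"
proof -
  have "sqrt (g x v v) * sqrt (g x v v) = g x v v" using assms(2) by simp
  then show ?thesis using assms(2) by (simp add: metric_simps[OF assms(1)] field_simps)
qed

lemma orthonormal_pair:
  assumes "x \<in> S" "g x a a = 1" "g x b b = 1" "g x a b = 0"
  shows "orthonormal_basis_at g x (\<lambda>i. if i = 1 then a else b)"
  unfolding orthonormal_basis_at_def forall_2 using assms sym[OF assms(1)] by simp

lemma orthonormal_frame: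
  assumes "x \<in> S"
  shows "orthonormal_basis_at g x (\<lambda>i. if i = 1 then frame1 x else frame2 x)"
proof (rule orthonormal_pair[OF assms])
  show 1: "g x (frame1 x) (frame1 x) = 1"
    unfolding frame1_def by (rule normalize[OF assms axis1_pos[OF assms]])
  show "g x (frame2 x) (frame2 x) = 1"
    unfolding frame2_def by (rule normalize[OF assms frame2_dir_pos[OF assms]])
  have "g x (frame1 x) (frame2_dir x) = 0"
    unfolding frame2_dir_def by (simp add: metric_simps[OF assms] 1 sym[OF assms, of "axis 2 1" "frame1 x"])
  then show "g x (frame1 x) (frame2 x) = 0"
    unfolding frame2_def by (simp add: metric_simps[OF assms])
qed

lemma metric_trace_frame:
  assumes "x \<in> S" "bilinear \<beta>"
  shows "metric_trace g x \<beta> = \<beta> (frame1 x) (frame1 x) + \<beta> (frame2 x) (frame2 x)"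
  unfolding metric_trace_eq[OF assms orthonormal_frame[OF assms(1)]] by (simp add: sum_2)

lemma smooth_frame: "smooth_on frame1 S" "smooth_on frame2 S"
proof -
  show 1: "smooth_on frame1 S"
    unfolding frame1_def using axis1_pos
    by (intro smooth_on_scaleR smooth_on_divide smooth_on_const smooth_on_sqrt smooth open_dom)
      (auto intro!: less_imp_neq[THEN not_sym])
  have 2: "smooth_on frame2_dir S"
    unfolding frame2_dir_def
    by (intro smooth_on_scaleR smooth_on_diff smooth_on_const smooth_metric_field 1 open_dom order_refl)
  show "smooth_on frame2 S"
    unfolding frame2_def using frame2_dir_pos
    by (intro smooth_on_scaleR smooth_on_divide smooth_on_const smooth_on_sqrt smooth_metric_field 2 open_dom)
      (auto intro!: less_imp_neq[THEN not_sym])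
qed

lemma smooth_metric_trace:
  fixes \<beta> :: "real ^ 2 \<Rightarrow> real ^ 2 \<Rightarrow> real ^ 2 \<Rightarrow> 'b::real_normed_vector"
  assumes "open W" "W \<subseteq> S" "\<And>x. x \<in> W \<Longrightarrow> bilinear (\<beta> x)" "\<And>u v. smooth_on (\<lambda>x. \<beta> x u v) W"
  shows "smooth_on (\<lambda>x. metric_trace g x (\<beta> x)) W"
proof -
  note f = smooth_frame[THEN smooth_on_subset, OF assms(2)]
  have "smooth_on (\<lambda>x. \<beta> x (frame1 x) (frame1 x) + \<beta> x (frame2 x) (frame2 x)) W"
    by (rule smooth_on_add[OF smooth_on_bilinear_field[OF assms(1,3,4) f(1) f(1)]
          smooth_on_bilinear_field[OF assms(1,3,4) f(2) f(2)] assms(1)])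
  then show ?thesis
    by (rule smooth_on_cong[OF assms(1)]) (use assms(2) in \<open>simp add: metric_trace_frame[OF _ assms(3)] subset_iff\<close>)
qed

text \<open>The hypothesis on the eigenvalues already provides eigenvectors for both values. For a
  self-adjoint operator they are orthogonal, since the values differ, and normalising gives the
  basis.\<close>

lemma eigenbasis:
  assumes x: "x \<in> S" and A: "linear A" "\<And>u v. g x (A u) v = g x u (A v)"
    and ev: "eigenvalues A = {a, b}" "a \<noteq> b"
  obtains e1 e2 where "orthonormal_basis_at g x (\<lambda>i. if i = 1 then e1 else e2)"
    "A e1 = a *\<^sub>R e1" "A e2 = b *\<^sub>R e2"
proof -
  have "a \<in> eigenvalues A" "b \<in> eigenvalues A" using ev by auto
  then obtain v w where v: "v \<noteq> 0" "A v = a *\<^sub>R v" and w: "w \<noteq> 0" "A w = b *\<^sub>R w"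
    unfolding eigenvalues_def by auto
  have "a * g x v w = b * g x v w"
    using A(2)[of v w] v(2) w(2) by (simp add: metric_simps[OF x])
  then have vw: "g x v w = 0" using ev(2) by simp
  define e1 where "e1 = (1 / sqrt (g x v v)) *\<^sub>R v"
  define e2 where "e2 = (1 / sqrt (g x w w)) *\<^sub>R w"
  show ?thesis
  proof (rule that)
    show "orthonormal_basis_at g x (\<lambda>i. if i = 1 then e1 else e2)"
    proof (rule orthonormal_pair[OF x])
      show "g x e1 e1 = 1" "g x e2 e2 = 1"
        unfolding e1_def e2_def by (rule normalize[OF x pos[OF x]], rule v w)+
      show "g x e1 e2 = 0" unfolding e1_def e2_def using vw by (simp add: metric_simps[OF x])
    qed
    show "A e1 = a *\<^sub>R e1" "A e2 = b *\<^sub>R e2"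
      unfolding e1_def e2_def by (simp_all add: linear_scale[OF A(1)] v w)
  qed
qed

lemma orthonormal_expand2:
  assumes "x \<in> S" "orthonormal_basis_at g x (\<lambda>i. if i = 1 then e1 else e2)"
  shows "u = g x u e1 *\<^sub>R e1 + g x u e2 *\<^sub>R e2"
  using orthonormal_expand[OF assms, of u] by (simp add: sum_2)

end

section \<open>Flat coordinates from a parallel symmetric tensor\<close>

text \<open>The Poincare lemma on a convex set: \<open>s\<close> integrates the form along the
  segment from \<open>x0\<close>. After differentiation under the integral, closedness makes the
  integrand the \<open>t\<close>-derivative of \<open>t * \<theta> (z x t) w\<close>, whose integral
  over the unit interval is \<open>\<theta> x w\<close>.\<close>

lemma closed_form_has_potential:
  fixes \<theta> :: "'a::euclidean_space \<Rightarrow> 'a \<Rightarrow> real"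
  assumes U: "open U" "convex U" "x0 \<in> U"
    and lin: "\<And>x. x \<in> U \<Longrightarrow> linear (\<theta> x)"
    and sm: "\<And>v. smooth_on (\<lambda>x. \<theta> x v) U"
    and closed: "\<And>x u v. x \<in> U \<Longrightarrow> deriv_along (\<lambda>y. \<theta> y v) x u = deriv_along (\<lambda>y. \<theta> y u) x v"
  obtains s where "\<And>x. x \<in> U \<Longrightarrow> (s has_derivative \<theta> x) (at x)"
proof
  define z where "z x t = x0 + t *\<^sub>R (x - x0)" for x and t :: real
  have zU: "z x t \<in> U" if "x \<in> U" "t \<in> {0..1}" for x t
  proof -
    have "(1 - t) *\<^sub>R x0 + t *\<^sub>R x \<in> U"
      using U(2,3) that unfolding convex_alt by auto
    then show ?thesis by (simp add: z_def algebra_simps)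
  qed
  have diff: "(\<lambda>y. \<theta> y v) differentiable (at x)" if "x \<in> U" for x v
    by (rule smooth_on_differentiable[OF sm that])
  have cont: "continuous_on U (\<lambda>y. \<theta> y v)" "continuous_on U (\<lambda>y. deriv_along (\<lambda>p. \<theta> p v) y u)" for v u
    by (rule smooth_on_imp_continuous_on[OF sm], rule smooth_on_imp_continuous_on[OF smooth_on_deriv[OF sm]])
  \<comment> \<open>The derivative of the integrand in direction \<open>b\<close>, written with the
    fixed directions \<open>b'\<close> so that joint continuity in \<open>(x, t)\<close> is
    visible.\<close>
  define c where "c b x t = t * (\<Sum>b'\<in>Basis. ((x - x0) \<bullet> b') * deriv_along (\<lambda>p. \<theta> p b') (z x t) b) + \<theta> (z x t) b"
    for b x t
  \<comment> \<open>\<open>leibniz_rule\<close> expects the derivative as a continuous family of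
    bounded linear functions.\<close>
  define fx where "fx x t = (\<Sum>b\<in>Basis. c b x t *\<^sub>R blinfun_inner_right b)" for x t
  have fx_apply: "blinfun_apply (fx x t) w = t * deriv_along (\<lambda>p. \<theta> p (x - x0)) (z x t) w + \<theta> (z x t) w"
    if "x \<in> U" "t \<in> {0..1}" for x t w
  proof -
    note zz = zU[OF that]
    have c: "c b x t = t * deriv_along (\<lambda>p. \<theta> p (x - x0)) (z x t) b + \<theta> (z x t) b" for b
    proof -
      have "linear (\<lambda>v. deriv_along (\<lambda>p. \<theta> p v) (z x t) b)"
        by (rule linear_deriv_along_param[OF U(1) zz lin diff[OF zz]])
      from linear_Basis_expand[OF this, of "x - x0"] show ?thesis unfolding c_def by simp
    qed
    have "linear (\<lambda>w. t * deriv_along (\<lambda>p. \<theta> p (x - x0)) (z x t) w + \<theta> (z x t) w)"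
      using linear_deriv_along[OF diff[OF zz], of "x - x0"] lin[OF zz]
      by (intro linearI) (simp_all add: linear_add linear_scale algebra_simps)
    from linear_Basis_expand[OF this, of w] show ?thesis
      unfolding fx_def c by (simp add: blinfun.sum_left blinfun.scaleR_left inner_commute mult.commute)
  qed
  have der: "((\<lambda>x. \<theta> (z x t) (x - x0)) has_derivative blinfun_apply (fx x t)) (at x within U)"
    if xt: "x \<in> U" "t \<in> cbox 0 1" for x t
  proof (rule has_derivative_at_withinI)
    have t: "t \<in> {0..1}" using xt by auto
    have zd: "((\<lambda>y. z y t) has_derivative (\<lambda>w. t *\<^sub>R w)) (at x)"
      unfolding z_def by (auto intro!: derivative_eq_intros)
    have ch: "((\<lambda>y. \<theta> (z y t) v) has_derivative (\<lambda>w. t * deriv_along (\<lambda>p. \<theta> p v) (z x t) w)) (at x)" for v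
      using has_derivative_compose[OF zd has_derivative_deriv_along[OF diff[OF zU[OF xt(1) t]]], of v]
      by (simp add: linear_scale[OF linear_deriv_along[OF diff[OF zU[OF xt(1) t]]]])
    have chd: "(\<lambda>y. \<theta> (z y t) v) differentiable (at x)" for v
      using ch unfolding differentiable_def by blast
    have ad: "(\<lambda>y. y - x0) differentiable (at x)"
      by (simp add: differentiable_diff)
    have "((\<lambda>y. \<theta> (z y t) (y - x0)) has_derivative
        (\<lambda>w. deriv_along (\<lambda>y. \<theta> (z y t) (x - x0)) x w + \<theta> (z x t) (deriv_along (\<lambda>y. y - x0) x w))) (at x)"
      by (rule has_derivative_linear_field[OF U(1) xt(1), of "\<lambda>y. \<theta> (z y t)"])
        (use lin zU t chd ad in auto)
    moreover have "deriv_along (\<lambda>y. y - x0) x w = w" for w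
      by (rule deriv_along_eq) (auto intro!: derivative_eq_intros)
    moreover have "blinfun_apply (fx x t)
        = (\<lambda>w. t * deriv_along (\<lambda>p. \<theta> p (x - x0)) (z x t) w + \<theta> (z x t) w)"
      by (rule ext) (rule fx_apply[OF xt(1) t])
    ultimately show "((\<lambda>x. \<theta> (z x t) (x - x0)) has_derivative blinfun_apply (fx x t)) (at x)"
      by (simp add: deriv_along_eq[OF ch])
  qed
  have zc: "continuous_on (U \<times> {0..1}) (\<lambda>p. z (fst p) (snd p))"
    unfolding z_def by (intro continuous_intros)
  have zsub: "(\<lambda>p. z (fst p) (snd p)) ` (U \<times> {0..1}) \<subseteq> U" using zU by auto
  have fxc: "continuous_on (U \<times> cbox 0 1) (\<lambda>(x, t). fx x t)"
    unfolding fx_def c_def split_def box_real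
    by (intro continuous_intros continuous_on_compose2[OF cont(1) zc zsub] continuous_on_compose2[OF cont(2) zc zsub])
  have fxc1: "continuous_on (cbox 0 1) (fx x)" if "x \<in> U" for x
  proof -
    have "continuous_on (cbox 0 1) (\<lambda>t::real. (x, t))" by (intro continuous_intros)
    from continuous_on_compose2[OF fxc this] show ?thesis using that by auto
  qed
  have f_cont: "continuous_on (cbox 0 1) (\<lambda>t. \<theta> (z x t) (x - x0))" if "x \<in> U" for x
    unfolding box_real
    by (rule continuous_on_compose2[OF cont(1)]) (use zU that in \<open>auto simp: z_def intro!: continuous_intros\<close>)
  define s where "s x = integral (cbox 0 1) (\<lambda>t. \<theta> (z x t) (x - x0))" for x
  fix x assume x: "x \<in> U"
  have "(s has_derivative blinfun_apply (integral (cbox 0 1) (fx x))) (at x within U)"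
    unfolding s_def
    by (rule leibniz_rule[OF der integrable_continuous[OF f_cont] fxc x U(2)]) auto
  then have "(s has_derivative blinfun_apply (integral (cbox 0 1) (fx x))) (at x)"
    using at_within_open[OF x U(1)] by simp
  moreover have "blinfun_apply (integral (cbox 0 1) (fx x)) w = \<theta> x w" for w
  proof -
    have "((\<lambda>t. blinfun_apply (fx x t) w) has_integral (1 * \<theta> (z x 1) w - 0 * \<theta> (z x 0) w)) {0..1}"
    proof (rule fundamental_theorem_of_calculus)
      fix t :: real assume t: "t \<in> {0..1}"
      have zd: "((\<lambda>t. z x t) has_derivative (\<lambda>h. h *\<^sub>R (x - x0))) (at t)"
        unfolding z_def by (auto intro!: derivative_eq_intros)
      have "((\<lambda>t. \<theta> (z x t) w) has_derivative (\<lambda>h. h * deriv_along (\<lambda>p. \<theta> p w) (z x t) (x - x0))) (at t)"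
        using has_derivative_compose[OF zd has_derivative_deriv_along[OF diff[OF zU[OF x t]]], of w]
        by (simp add: linear_scale[OF linear_deriv_along[OF diff[OF zU[OF x t]]]])
      then have "((\<lambda>t. \<theta> (z x t) w) has_real_derivative deriv_along (\<lambda>p. \<theta> p w) (z x t) (x - x0)) (at t)"
        by (rule has_derivative_imp_has_field_derivative) simp
      then have "((\<lambda>t. t * \<theta> (z x t) w) has_real_derivative
          1 * \<theta> (z x t) w + deriv_along (\<lambda>p. \<theta> p w) (z x t) (x - x0) * t) (at t)"
        by (intro DERIV_mult DERIV_ident)
      \<comment> \<open>Closedness exchanges the directions \<open>w\<close> and
        \<open>x - x0\<close>, which turns the integrand into a derivative in
        \<open>t\<close>.\<close>
      then have "((\<lambda>t. t * \<theta> (z x t) w) has_real_derivative blinfun_apply (fx x t) w) (at t)"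
        using fx_apply[OF x t, of w] closed[OF zU[OF x t], of w "x - x0"] by (simp add: algebra_simps)
      then show "((\<lambda>t. t * \<theta> (z x t) w) has_vector_derivative blinfun_apply (fx x t) w) (at t within {0..1})"
        using has_real_derivative_iff_has_vector_derivative has_vector_derivative_at_within by blast
    qed simp
    then have "integral (cbox 0 1) (\<lambda>t. blinfun_apply (fx x t) w) = \<theta> x w"
      by (simp add: z_def integral_unique)
    then show ?thesis
      by (subst blinfun_apply_integral[OF integrable_continuous[OF fxc1[OF x]]])
  qed
  then have "blinfun_apply (integral (cbox 0 1) (fx x)) = \<theta> x" by auto
  ultimately show "(s has_derivative \<theta> x) (at x)" by simp
qed

section \<open>Parallelism of a divergence-free operator with two constant eigenvalues\<close>

context local_metric2
begin

context
  fixes T :: "real ^ 2 \<Rightarrow> real ^ 2 \<Rightarrow> real ^ 2" and a b :: real and W :: "(real ^ 2) set"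
  assumes W: "open W" "W \<subseteq> S"
    and lin: "\<And>x. x \<in> W \<Longrightarrow> linear (T x)"
    and adj: "\<And>x u v. x \<in> W \<Longrightarrow> g x (T x u) v = g x u (T x v)"
    and ev: "\<And>x. x \<in> W \<Longrightarrow> eigenvalues (T x) = {a, b}" and ne: "a \<noteq> b"
    and smT: "\<And>v. smooth_on (\<lambda>x. T x v) W"
begin

text \<open>Cayley-Hamilton, checked on an eigenbasis at the point. The resulting identity no longer
  mentions eigenvectors, so it can be differentiated although the chosen basis need not vary
  smoothly.\<close>

lemma endo_square:
  assumes "x \<in> W" shows "T x (T x v) = (a + b) *\<^sub>R T x v - (a * b) *\<^sub>R v"
proof -
  have x: "x \<in> S" using assms W by auto
  obtain e1 e2 where e: "orthonormal_basis_at g x (\<lambda>i. if i = 1 then e1 else e2)"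
    "T x e1 = a *\<^sub>R e1" "T x e2 = b *\<^sub>R e2"
    using eigenbasis[OF x lin[OF assms] adj[OF assms] ev[OF assms] ne] by blast
  note l = lin[OF assms]
  obtain p q where v: "v = p *\<^sub>R e1 + q *\<^sub>R e2"
    using orthonormal_expand2[OF x e(1), of v] by blast
  show ?thesis
    unfolding v by (simp add: linear_add[OF l] linear_scale[OF l] e algebra_simps)
qed

lemma deriv_endo_field:
  assumes "x \<in> W" "E differentiable (at x)"
  shows "deriv_along (\<lambda>y. T y (E y)) x u = deriv_along (\<lambda>y. T y (E x)) x u + T x (deriv_along E x u)"
  by (rule deriv_along_eq[OF has_derivative_linear_field[OF W(1) assms(1) _ _ assms(2)]])
    (erule lin, rule smooth_on_differentiable[OF smT assms(1)])

lemma differentiable_endo: "x \<in> W \<Longrightarrow> (\<lambda>y. T y v) differentiable (at x)"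
  by (rule smooth_on_differentiable[OF smT])

lemma bilinear_cov_deriv_endo:
  assumes "x \<in> W" shows "bilinear (cov_deriv_endo g T x)"
proof -
  have x: "x \<in> S" using assms W by auto
  note c = bilinear_linear[OF bilinear_christoffel[OF x]]
  note l = lin[OF assms]
  note p = linear_deriv_along_param[OF W(1) assms lin differentiable_endo[OF assms]]
  note q = linear_deriv_along[OF differentiable_endo[OF assms]]
  show ?thesis
    unfolding bilinear_def cov_deriv_endo_def
    by (intro conjI allI linearI)
      (simp_all add: linear_add[OF p] linear_scale[OF p] linear_add[OF q] linear_scale[OF q]
        linear_add[OF c(1)] linear_add[OF c(2)] linear_scale[OF c(1)] linear_scale[OF c(2)]
        linear_add[OF l] linear_scale[OF l] algebra_simps)
qed

lemma cov_deriv_endo_square: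
  assumes "x \<in> W"
  shows "cov_deriv_endo g T x u (T x v) + T x (cov_deriv_endo g T x u v) = (a + b) *\<^sub>R cov_deriv_endo g T x u v"
proof -
  have x: "x \<in> S" using assms W by auto
  note c = bilinear_linear[OF bilinear_christoffel[OF x]]
  note l = lin[OF assms]
  have "deriv_along (\<lambda>y. T y (T y v)) x u = deriv_along (\<lambda>y. (a + b) *\<^sub>R T y v - (a * b) *\<^sub>R v) x u"
    by (rule deriv_along_cong[OF W(1) assms]) (rule endo_square)
  also have "\<dots> = (a + b) *\<^sub>R deriv_along (\<lambda>y. T y v) x u"
    by (rule deriv_along_eq) (auto intro!: derivative_eq_intros has_derivative_deriv_along differentiable_endo[OF assms])
  finally have "deriv_along (\<lambda>y. T y (T x v)) x u + T x (deriv_along (\<lambda>y. T y v) x u)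
      = (a + b) *\<^sub>R deriv_along (\<lambda>y. T y v) x u"
    using deriv_endo_field[OF assms differentiable_endo[OF assms]] by simp
  \<comment> \<open>\<open>cov_deriv_endo\<close> at the vector \<open>T x v\<close> contains the
    derivative with this vector frozen, so the product rule is solved for that term.\<close>
  then have 1: "deriv_along (\<lambda>y. T y (T x v)) x u
      = (a + b) *\<^sub>R deriv_along (\<lambda>y. T y v) x u - T x (deriv_along (\<lambda>y. T y v) x u)"
    by (simp add: algebra_simps)
  show ?thesis
    unfolding cov_deriv_endo_def 1
    by (simp add: endo_square[OF assms] linear_add[OF l] linear_diff[OF l]
        linear_add[OF c(1)] linear_diff[OF c(1)] linear_scale[OF c(1)] algebra_simps)
qed

lemma cov_deriv_endo_adj:
  assumes "x \<in> W"
  shows "g x (cov_deriv_endo g T x u v) w = g x v (cov_deriv_endo g T x u w)"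
proof -
  have x: "x \<in> S" using assms W by auto
  note m = metric_simps[OF x]
  have "deriv_along (\<lambda>y. g y (T y v) w) x u = deriv_along (\<lambda>y. g y v (T y w)) x u"
    by (rule deriv_along_cong[OF W(1) assms]) (rule adj)
  then have "g x (deriv_along (\<lambda>y. T y v) x u + christoffel g x u (T x v)) w + g x (T x v) (christoffel g x u w)
      = g x (christoffel g x u v) (T x w) + g x v (deriv_along (\<lambda>y. T y w) x u + christoffel g x u (T x w))"
    using deriv_metric_field[OF x differentiable_endo[OF assms], of "\<lambda>_. w" v u]
      deriv_metric_field[OF x _ differentiable_endo[OF assms], of "\<lambda>_. v" w u] by simp
  then show ?thesis
    unfolding cov_deriv_endo_def using adj[OF assms] by (simp add: m)
qed

text \<open>By \<open>sq\<close>, \<open>C u e1\<close> lies in the eigenspace of \<open>b\<close>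
  and \<open>C u e2\<close> in that of \<open>a\<close>. Hence \<open>C e1 e1\<close> is a multiple
  of \<open>e2\<close> and \<open>C e2 e2\<close> a multiple of \<open>e1\<close>; their sum is the
  divergence, so both vanish. Self-adjointness carries this over to the mixed terms.\<close>

lemma cov_deriv_endo_eq_0:
  assumes "x \<in> W" and div: "divergence_endo g T x = 0"
  shows "cov_deriv_endo g T x u v = 0"
proof -
  have x: "x \<in> S" using assms W by auto
  note m = metric_simps[OF x]
  note l = lin[OF assms(1)]
  define C where "C = cov_deriv_endo g T x"
  have bC: "bilinear C" unfolding C_def by (rule bilinear_cov_deriv_endo[OF assms(1)])
  note lC = bilinear_linear[OF bC]
  obtain e1 e2 where e: "orthonormal_basis_at g x (\<lambda>i. if i = 1 then e1 else e2)"
    "T x e1 = a *\<^sub>R e1" "T x e2 = b *\<^sub>R e2"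
    using eigenbasis[OF x lin[OF assms(1)] adj[OF assms(1)] ev[OF assms(1)] ne] by blast
  note ex = orthonormal_expand2[OF x e(1)]
  have sq: "C u (T x v) + T x (C u v) = (a + b) *\<^sub>R C u v" for u v
    unfolding C_def by (rule cov_deriv_endo_square[OF assms(1)])
  have ad: "g x (C u v) w = g x v (C u w)" for u v w
    unfolding C_def by (rule cov_deriv_endo_adj[OF assms(1)])
  have 1: "g x (C u e1) e1 = 0" for u
  proof -
    have "T x (C u e1) = b *\<^sub>R C u e1"
      using sq[of u e1] by (simp add: e linear_scale[OF lC(1)] algebra_simps)
    then have "b * g x (C u e1) e1 = a * g x (C u e1) e1"
      using adj[OF assms(1), of "C u e1" e1] by (simp add: e m)
    then show ?thesis using ne by simp
  qed
  have 2: "g x (C u e2) e2 = 0" for u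
  proof -
    have "T x (C u e2) = a *\<^sub>R C u e2"
      using sq[of u e2] by (simp add: e linear_scale[OF lC(1)] algebra_simps)
    then have "a * g x (C u e2) e2 = b * g x (C u e2) e2"
      using adj[OF assms(1), of "C u e2" e2] by (simp add: e m)
    then show ?thesis using ne by simp
  qed
  have "C e1 e1 + C e2 e2 = 0"
    using div metric_trace_eq[OF x bC e(1)] by (simp add: divergence_endo_def C_def[symmetric] sum_2)
  then have d: "g x (C e1 e1) w + g x (C e2 e2) w = 0" for w
    using m(2)[of "C e1 e1" "C e2 e2" w] by (simp add: m)
  have "C e1 e1 = 0"
    using ex[of "C e1 e1"] 1[of e1] 2[of e2] d[of e2] by simp
  moreover have "C e2 e2 = 0"
    using ex[of "C e2 e2"] 2[of e2] 1[of e1] d[of e1] by simp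
  moreover have "C e1 e2 = 0"
    using ex[of "C e1 e2"] 2[of e1] ad[of e1 e2 e1] \<open>C e1 e1 = 0\<close> by (simp add: m)
  moreover have "C e2 e1 = 0"
    using ex[of "C e2 e1"] 1[of e2] ad[of e2 e1 e2] \<open>C e2 e2 = 0\<close> by (simp add: m)
  moreover obtain p q p' q' where "u = p *\<^sub>R e1 + q *\<^sub>R e2" "v = p' *\<^sub>R e1 + q' *\<^sub>R e2"
    using ex[of u] ex[of v] by blast
  ultimately have "C u v = 0"
    by (simp add: linear_add[OF lC(1)] linear_add[OF lC(2)] linear_scale[OF lC(1)] linear_scale[OF lC(2)])
  then show ?thesis by (simp add: C_def)
qed

text \<open>The eigenspaces are lines, so a vector on the line of the unit vector \<open>E\<close>
  that is orthogonal to \<open>E\<close> vanishes. The intended \<open>z\<close> is the covariant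
  derivative of a unit eigenfield.\<close>

lemma eigenvector_eq_0:
  assumes "x \<in> W" "T x z = a *\<^sub>R z" "T x E = a *\<^sub>R E" "g x E E = 1" "g x z E = 0"
  shows "z = 0"
proof -
  have x: "x \<in> S" using assms W by auto
  note m = metric_simps[OF x]
  obtain e1 e2 where e: "orthonormal_basis_at g x (\<lambda>i. if i = 1 then e1 else e2)"
    "T x e1 = a *\<^sub>R e1" "T x e2 = b *\<^sub>R e2"
    using eigenbasis[OF x lin[OF assms(1)] adj[OF assms(1)] ev[OF assms(1)] ne] by blast
  have "g x w e2 = 0" if "T x w = a *\<^sub>R w" for w
    using adj[OF assms(1), of w e2] that ne by (simp add: e m)
  then have "z = g x z e1 *\<^sub>R e1" "E = g x E e1 *\<^sub>R e1"
    using orthonormal_expand2[OF x e(1), of z] orthonormal_expand2[OF x e(1), of E] assms(2,3) by simp_all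
  moreover have "g x e1 e1 = 1" using e(1) by (simp add: orthonormal_basis_at_def forall_2)
  ultimately have "g x z E = g x z e1 * g x E e1" "g x E E = g x E e1 * g x E e1"
    using m(5)[of z "g x E e1" e1] m(5)[of E "g x E e1" e1] by (simp_all add: mult.commute)
  then have "g x z e1 = 0" using assms(4,5) by auto
  then show ?thesis using \<open>z = g x z e1 *\<^sub>R e1\<close> by simp
qed

text \<open>For constant \<open>v\<close> the field \<open>T x v - b v\<close> lies in the
  eigenspace of \<open>a\<close> and is smooth; near \<open>x0\<close> it can be normalised. As
  \<open>T\<close> is parallel, the covariant derivative of the unit field stays in that eigenspace,
  and as the length is constant it is orthogonal to the field, so it is 0. Symmetry of the
  Christoffel symbols then makes the dual form closed.\<close>

lemma parallel_eigenfield: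
  assumes par: "\<And>x u v. x \<in> W \<Longrightarrow> cov_deriv_endo g T x u v = 0" and x0: "x0 \<in> W"
  shows "\<exists>r E s. r > 0 \<and> ball x0 r \<subseteq> W \<and> smooth_on E (ball x0 r) \<and>
    (\<forall>x\<in>ball x0 r. T x (E x) = a *\<^sub>R E x \<and> g x (E x) (E x) = 1 \<and> (s has_derivative g x (E x)) (at x))"
proof -
  obtain v where v: "v \<noteq> 0" "T x0 v = a *\<^sub>R v"
    using ev[OF x0] unfolding eigenvalues_def by auto
  define E0 where "E0 x = T x v - b *\<^sub>R v" for x
  have smE0: "smooth_on E0 W" unfolding E0_def by (intro smooth_intros smT W)
  define n where "n x = g x (E0 x) (E0 x)" for x
  have smn: "smooth_on n W" unfolding n_def by (intro smooth_metric_field smE0 W)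
  \<comment> \<open>At \<open>x0\<close>, where \<open>v\<close> is an eigenvector, the field is
    \<open>(a - b) v\<close>.\<close>
  have "E0 x0 \<noteq> 0" unfolding E0_def v using v(1) ne by (simp flip: scaleR_left_diff_distrib)
  then have "n x0 > 0" unfolding n_def using pos x0 W by blast
  moreover have "isCont n x0"
    using smooth_on_imp_continuous_on[OF smn] x0 W(1) by (simp add: continuous_on_eq_continuous_at)
  ultimately have "\<forall>\<^sub>F x in at x0. n x > 0" unfolding isCont_def by (rule order_tendstoD(1)[rotated])
  then have "\<forall>\<^sub>F x in nhds x0. n x > 0"
    using \<open>n x0 > 0\<close> by (simp add: eventually_at_filter) (erule eventually_mono, metis)
  with eventually_nhds_in_open[OF W(1) x0] have "\<forall>\<^sub>F x in nhds x0. x \<in> W \<and> n x > 0"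
    by eventually_elim simp
  then obtain r where r: "r > 0" "\<And>x. dist x x0 < r \<Longrightarrow> x \<in> W \<and> n x > 0"
    unfolding eventually_nhds_metric by auto
  define U where "U = ball x0 r"
  have U: "open U" "convex U" "x0 \<in> U" "U \<subseteq> W" "U \<subseteq> S" and npos: "n x > 0" if "x \<in> U" for x
    using r W that by (auto simp: U_def dist_commute)
  have U': "open U" "convex U" "x0 \<in> U" "U \<subseteq> W" "U \<subseteq> S"
    using U[of x0] r(1) by (auto simp: U_def)
  define E where "E x = (1 / sqrt (n x)) *\<^sub>R E0 x" for x
  have smE: "smooth_on E U"
    unfolding E_def using npos
    by (intro smooth_on_scaleR smooth_on_divide smooth_on_const smooth_on_sqrt U'
        smooth_on_subset[OF smn U'(4)] smooth_on_subset[OF smE0 U'(4)]) (auto intro!: less_imp_neq[THEN not_sym])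
  have TE0: "T x (E0 x) = a *\<^sub>R E0 x" if "x \<in> W" for x
    unfolding E0_def using endo_square[OF that, of v]
    by (simp add: linear_diff[OF lin[OF that]] linear_scale[OF lin[OF that]] algebra_simps)
  have TE: "T x (E x) = a *\<^sub>R E x" if "x \<in> U" for x
    using TE0[of x] that U'(4) unfolding E_def by (auto simp: linear_scale[OF lin])
  have EE: "g x (E x) (E x) = 1" if "x \<in> U" for x
    using normalize[of x "E0 x"] npos[OF that] that U'(5) unfolding E_def n_def by auto
  have dE: "E differentiable (at x)" if "x \<in> U" for x
    by (rule smooth_on_differentiable[OF smE that])
  have nabla: "deriv_along E x u + christoffel g x u (E x) = 0" if x: "x \<in> U" for x u
  proof (rule eigenvector_eq_0)
    have xW: "x \<in> W" and xS: "x \<in> S" using x U' by auto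
    note c = bilinear_linear[OF bilinear_christoffel[OF xS]]
    note l = lin[OF xW]
    show "x \<in> W" by (rule xW)
    have "deriv_along (\<lambda>y. T y (E y)) x u = deriv_along (\<lambda>y. a *\<^sub>R E y) x u"
      by (rule deriv_along_cong[OF U'(1) x]) (rule TE)
    also have "\<dots> = a *\<^sub>R deriv_along E x u"
      by (rule deriv_along_linear_compose[OF bounded_linear_scaleR_right dE[OF x]])
    finally have 1: "deriv_along (\<lambda>y. T y (E x)) x u = a *\<^sub>R deriv_along E x u - T x (deriv_along E x u)"
      using deriv_endo_field[OF xW dE[OF x]] by (simp add: algebra_simps)
    have "cov_deriv_endo g T x u (E x) = 0" by (rule par[OF xW])
    then show "T x (deriv_along E x u + christoffel g x u (E x)) = a *\<^sub>R (deriv_along E x u + christoffel g x u (E x))"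
      unfolding cov_deriv_endo_def 1
      by (simp add: TE[OF x] linear_add[OF l] linear_scale[OF c(1)] algebra_simps)
    show "T x (E x) = a *\<^sub>R E x" "g x (E x) (E x) = 1" using TE EE x by auto
    have "deriv_along (\<lambda>y. g y (E y) (E y)) x u = deriv_along (\<lambda>y. 1) x u"
      by (rule deriv_along_cong[OF U'(1) x]) (rule EE)
    then show "g x (deriv_along E x u + christoffel g x u (E x)) (E x) = 0"
      using deriv_metric_field[OF xS dE[OF x] dE[OF x], of u] sym[OF xS] by simp
  qed
  have D\<theta>: "deriv_along (\<lambda>y. g y (E y) w) x u = g x (E x) (christoffel g x u w)" if "x \<in> U" for x u w
  proof -
    have xS: "x \<in> S" using that U' by auto
    show ?thesis
      using deriv_metric_field[OF xS dE[OF that], of "\<lambda>_. w" u] nabla[OF that, of u]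
      by (simp add: metric_simps[OF xS])
  qed
  have "\<exists>s. \<forall>x\<in>U. (s has_derivative g x (E x)) (at x)"
  proof (rule closed_form_has_potential[OF U'(1,2,3), of "\<lambda>x. g x (E x)"])
    show "linear (g x (E x))" if "x \<in> U" for x using metric_linear that U' by auto
    show "smooth_on (\<lambda>x. g x (E x) v) U" for v
      by (rule smooth_metric_field[OF U'(1,5) smE smooth_on_const])
    show "deriv_along (\<lambda>y. g y (E y) v) x u = deriv_along (\<lambda>y. g y (E y) u) x v" if "x \<in> U" for x u v
      using D\<theta>[OF that] christoffel_sym[of x u v] that U'(5) by auto
  qed blast
  then obtain s where s: "\<And>x. x \<in> U \<Longrightarrow> (s has_derivative g x (E x)) (at x)" by blast
  show ?thesis
    by (intro exI[of _ r] exI[of _ E] exI[of _ s]) (use r(1) U' smE TE EE s in \<open>auto simp: U_def\<close>)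
qed

end

end

lemma surj_of_det_nonzero:
  fixes f :: "real ^ 'n \<Rightarrow> real ^ 'n"
  assumes "linear f" "det (matrix f) \<noteq> 0"
  shows "surj f"
  using assms det_nz_iff_inj linear_injective_imp_surjective by blast

text \<open>The differentials of the two potentials are the dual eigenforms, so the metric is the
  sum of their squares and \<open>T\<close> is diagonal. The sign of the second coordinate is still
  free and is used to make the Jacobian positive.\<close>

lemma (in local_metric2) flat_coordinates:
  fixes T :: "real ^ 2 \<Rightarrow> real ^ 2 \<Rightarrow> real ^ 2" and a b :: real
  assumes W: "open W" "W \<subseteq> S"
    and lin: "\<And>x. x \<in> W \<Longrightarrow> linear (T x)"
    and adj: "\<And>x u v. x \<in> W \<Longrightarrow> g x (T x u) v = g x u (T x v)"
    and ev: "\<And>x. x \<in> W \<Longrightarrow> eigenvalues (T x) = {a, b}" and ne: "a \<noteq> b"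
    and smT: "\<And>v. smooth_on (\<lambda>x. T x v) W"
    and div: "\<And>x. x \<in> W \<Longrightarrow> divergence_endo g T x = 0" and x0: "x0 \<in> W"
  shows "\<exists>r f. r > 0 \<and> ball x0 r \<subseteq> W \<and> smooth_on f (ball x0 r) \<and> f x0 = (0 :: real ^ 2) \<and>
    (\<forall>x\<in>ball x0 r.
       (\<forall>u v. g x u v = deriv_along f x u \<bullet> deriv_along f x v) \<and>
       (\<forall>u v. g x (T x u) v = a * (deriv_along f x u $ 1 * deriv_along f x v $ 1)
          + b * (deriv_along f x u $ 2 * deriv_along f x v $ 2)) \<and>
       det (matrix (deriv_along f x)) > 0)"
proof -
  have ev': "\<And>x. x \<in> W \<Longrightarrow> eigenvalues (T x) = {b, a}" using ev by auto
  have par: "cov_deriv_endo g T x u v = 0" if "x \<in> W" for x u v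
    by (rule cov_deriv_endo_eq_0[OF W lin adj ev ne smT that div[OF that]])
  obtain r1 E1 s1 where 1: "r1 > 0" "ball x0 r1 \<subseteq> W" "smooth_on E1 (ball x0 r1)"
    "\<forall>x\<in>ball x0 r1. T x (E1 x) = a *\<^sub>R E1 x \<and> g x (E1 x) (E1 x) = 1 \<and> (s1 has_derivative g x (E1 x)) (at x)"
    using parallel_eigenfield[OF W lin adj ev ne smT par x0] by blast
  obtain r2 E2 s2 where 2: "r2 > 0" "ball x0 r2 \<subseteq> W" "smooth_on E2 (ball x0 r2)"
    "\<forall>x\<in>ball x0 r2. T x (E2 x) = b *\<^sub>R E2 x \<and> g x (E2 x) (E2 x) = 1 \<and> (s2 has_derivative g x (E2 x)) (at x)"
    using parallel_eigenfield[OF W lin adj ev' not_sym[OF ne] smT par x0] by blast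
  define r where "r = min r1 r2"
  define U where "U = ball x0 r"
  have r: "r > 0" using 1(1) 2(1) by (simp add: r_def)
  have U: "open U" "U \<subseteq> ball x0 r1" "U \<subseteq> ball x0 r2" "U \<subseteq> W" "U \<subseteq> S" "x0 \<in> U" "connected U"
    using 1(2) W(2) r by (auto simp: U_def r_def)
  have F1: "\<forall>x\<in>U. T x (E1 x) = a *\<^sub>R E1 x \<and> g x (E1 x) (E1 x) = 1 \<and> (s1 has_derivative g x (E1 x)) (at x)"
    using 1(4) U(2) by blast
  have F2: "\<forall>x\<in>U. T x (E2 x) = b *\<^sub>R E2 x \<and> g x (E2 x) (E2 x) = 1 \<and> (s2 has_derivative g x (E2 x)) (at x)"
    using 2(4) U(3) by blast
  \<comment> \<open>The factor \<open>e\<close> will be 1 or -1; the metric and \<open>T\<close>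
    contain it only through its square.\<close>
  define f\<^sub>0 :: "real \<Rightarrow> real ^ 2 \<Rightarrow> real ^ 2" where
    "f\<^sub>0 e x = (s1 x - s1 x0) *\<^sub>R axis 1 1 + (e * (s2 x - s2 x0)) *\<^sub>R axis 2 1" for e x
  have d0: "(f\<^sub>0 e has_derivative (\<lambda>v. g x (E1 x) v *\<^sub>R axis 1 1 + (e * g x (E2 x) v) *\<^sub>R axis 2 1)) (at x)"
    if "x \<in> U" for e x
    unfolding f\<^sub>0_def using bspec[OF F1 that] bspec[OF F2 that] that U by (auto intro!: derivative_eq_intros)
  have comp: "deriv_along (f\<^sub>0 e) x v $ 1 = g x (E1 x) v" "deriv_along (f\<^sub>0 e) x v $ 2 = e * g x (E2 x) v"
    if "x \<in> U" for e x v
    unfolding deriv_along_eq[OF d0[OF that]] by (simp_all add: axis_def)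
  have sm: "smooth_on (f\<^sub>0 e) U" for e
  proof (rule smooth_on_I)
    show "f\<^sub>0 e differentiable (at x)" if "x \<in> U" for x
      using d0[OF that] unfolding differentiable_def by blast
    have "smooth_on (\<lambda>x. g x (E1 x) v *\<^sub>R axis 1 1 + (e * g x (E2 x) v) *\<^sub>R axis (2::2) (1::real)) U" for v
      by (intro smooth_on_add smooth_on_scaleR smooth_on_mult smooth_on_const smooth_metric_field U
        smooth_on_subset[OF 1(3) U(2)] smooth_on_subset[OF 2(3) U(3)])
    then show "smooth_on (\<lambda>x. deriv_along (f\<^sub>0 e) x v) U" for v
      by (rule smooth_on_cong[OF U(1)]) (simp add: deriv_along_eq[OF d0])
  qed
  have ON: "orthonormal_basis_at g x (\<lambda>i. if i = 1 then E1 x else E2 x)" if "x \<in> U" for x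
  proof (rule orthonormal_pair)
    have xW: "x \<in> W" and xS: "x \<in> S" using that U by auto
    have "a * g x (E1 x) (E2 x) = b * g x (E1 x) (E2 x)"
      using adj[OF xW, of "E1 x" "E2 x"] bspec[OF F1 that] bspec[OF F2 that] that U by (auto simp: metric_simps[OF xS])
    then show "g x (E1 x) (E2 x) = 0" using ne by simp
  qed (use that U bspec[OF F1 that] bspec[OF F2 that] in auto)
  have gg: "g x u v = g x (E1 x) u * g x (E1 x) v + g x (E2 x) u * g x (E2 x) v"
    "g x (T x u) v = a * (g x (E1 x) u * g x (E1 x) v) + b * (g x (E2 x) u * g x (E2 x) v)"
    if "x \<in> U" for x u v
  proof -
    have xW: "x \<in> W" and xS: "x \<in> S" using that U by auto
    note m = metric_simps[OF xS]
    have u: "u = g x (E1 x) u *\<^sub>R E1 x + g x (E2 x) u *\<^sub>R E2 x"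
      using orthonormal_expand2[OF xS ON[OF that], of u] sym[OF xS, of u] by simp
    define p q where "p = g x (E1 x) u" "q = g x (E2 x) u"
    have u': "u = p *\<^sub>R E1 x + q *\<^sub>R E2 x" using u by (simp add: p_q_def)
    have "g x (p *\<^sub>R E1 x + q *\<^sub>R E2 x) v = p * g x (E1 x) v + q * g x (E2 x) v" by (simp add: m)
    then show "g x u v = g x (E1 x) u * g x (E1 x) v + g x (E2 x) u * g x (E2 x) v"
      by (metis u' p_q_def)
    have "T x (p *\<^sub>R E1 x + q *\<^sub>R E2 x) = (a * p) *\<^sub>R E1 x + (b * q) *\<^sub>R E2 x"
      using bspec[OF F1 that] bspec[OF F2 that] that U
      by (auto simp: linear_add[OF lin[OF xW]] linear_scale[OF lin[OF xW]] mult.commute)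
    then have "g x (T x (p *\<^sub>R E1 x + q *\<^sub>R E2 x)) v = a * (p * g x (E1 x) v) + b * (q * g x (E2 x) v)"
      by (simp add: m)
    then show "g x (T x u) v = a * (g x (E1 x) u * g x (E1 x) v) + b * (g x (E2 x) u * g x (E2 x) v)"
      by (metis u' p_q_def)
  qed
  have linD: "linear (deriv_along (f\<^sub>0 e) x)" if "x \<in> U" for e x
    by (rule linear_deriv_along[OF smooth_on_differentiable[OF sm that]])
  have metr: "g x u v = deriv_along (f\<^sub>0 e) x u \<bullet> deriv_along (f\<^sub>0 e) x v" if "x \<in> U" "e * e = 1" for e x u v
    using that(2) by (simp add: inner_vec_def sum_2 comp[OF that(1)] gg(1)[OF that(1), of u v] algebra_simps)
  define \<delta> where "\<delta> e x = det (matrix (deriv_along (f\<^sub>0 e) x))" for e x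
  have \<delta>: "\<delta> e x = e * \<delta> 1 x" if "x \<in> U" for e x
    unfolding \<delta>_def det_2 matrix_def by (simp add: comp[OF that] algebra_simps)
  have \<delta>_ne: "\<delta> 1 x \<noteq> 0" if "x \<in> U" for x
  proof -
    have "inj (deriv_along (f\<^sub>0 1) x)"
      unfolding linear_injective_0[OF linD[OF that]]
    proof (intro allI impI)
      fix v assume "deriv_along (f\<^sub>0 1) x v = 0"
      then have "g x v v = 0" using metr[OF that, of 1 v v] by simp
      then show "v = 0" using pos[of x v] that U by force
    qed
    then show ?thesis using det_nz_iff_inj[OF linD[OF that]] by (simp add: \<delta>_def)
  qed
  have cont: "continuous_on U (\<delta> 1)"
    unfolding \<delta>_def
    by (intro smooth_on_imp_continuous_on smooth_on_det U)
      (simp add: matrix_def smooth_on_nth smooth_on_deriv[OF sm] U)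
  \<comment> \<open>The Jacobian for factor 1 has no zero on the connected set \<open>U\<close>, so
    its sign at \<open>x0\<close> is its sign everywhere.\<close>
  define e where "e = sgn (\<delta> 1 x0)"
  have e: "e * e = 1" using \<delta>_ne[OF U(6)] by (simp add: e_def sgn_if)
  have pos_det: "\<delta> e x > 0" if "x \<in> U" for x
  proof (rule ccontr)
    assume "\<not> \<delta> e x > 0"
    have c: "connected (\<delta> 1 ` U)" by (rule connected_continuous_image[OF cont U(7)])
    have "e * \<delta> 1 x0 > 0" using \<delta>_ne[OF U(6)] by (simp add: e_def sgn_if)
    moreover have "e * \<delta> 1 x < 0"
      using \<open>\<not> \<delta> e x > 0\<close> \<delta>[OF that, of e] \<delta>_ne[OF that] e by (metis less_eq_real_def linorder_not_less mult_eq_0_iff zero_neq_one)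
    ultimately have "0 \<in> \<delta> 1 ` U"
      using connectedD_interval[OF c, of "\<delta> 1 x0" "\<delta> 1 x" 0] connectedD_interval[OF c, of "\<delta> 1 x" "\<delta> 1 x0" 0]
        U(6) that unfolding e_def by (auto simp: sgn_if split: if_splits)
    then show False using \<delta>_ne by auto
  qed
  have TT: "g x (T x u) v
        = a * (deriv_along (f\<^sub>0 e) x u $ 1 * deriv_along (f\<^sub>0 e) x v $ 1)
          + b * (deriv_along (f\<^sub>0 e) x u $ 2 * deriv_along (f\<^sub>0 e) x v $ 2)" if x: "x \<in> U" for x u v
  proof -
    have "deriv_along (f\<^sub>0 e) x u $ 2 * deriv_along (f\<^sub>0 e) x v $ 2 = (e * e) * (g x (E2 x) u * g x (E2 x) v)"
      by (simp add: comp[OF x])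
    then show ?thesis unfolding gg(2)[OF x] e by (simp add: comp[OF x])
  qed
  have "f\<^sub>0 e x0 = 0" by (simp add: f\<^sub>0_def)
  then show ?thesis
    using r U(4) sm metr[OF _ e] TT pos_det unfolding U_def \<delta>_def
    by (intro exI[of _ r] exI[of _ "f\<^sub>0 e"]) auto
qed

section \<open>Charts and tensoriality\<close>

lemma chart_facts:
  assumes "is_chart X c"
  shows chart_open: "openin X (cdom c)" "open (cimg c)"
    and chart_inj: "inj_on (cmap c) (cdom c)"
    and chart_continuous: "continuous_map (subtopology X (cdom c)) euclidean (cmap c)"
    and chart_open_image: "\<And>U. openin X U \<Longrightarrow> U \<subseteq> cdom c \<Longrightarrow> open (cmap c ` U)"
    and chart_inv_continuous: "continuous_map (top_of_set (cimg c)) X (cinv c)"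
proof -
  have o: "openin X (cdom c)" "open (cimg c)"
    and h: "homeomorphic_map (subtopology X (cdom c)) (top_of_set (cimg c)) (cmap c)"
    using assms by (auto simp: is_chart_def)
  show "openin X (cdom c)" "open (cimg c)" by (fact o)+
  have ts: "topspace (subtopology X (cdom c)) = cdom c"
    using openin_subset[OF o(1)] by auto
  show inj: "inj_on (cmap c) (cdom c)"
    using homeomorphic_imp_injective_map[OF h] ts by simp
  show "continuous_map (subtopology X (cdom c)) euclidean (cmap c)"
    using homeomorphic_imp_continuous_map[OF h] continuous_map_into_fulltopology by blast
  show "open (cmap c ` U)" if "openin X U" "U \<subseteq> cdom c" for U
  proof -
    have "openin (subtopology X (cdom c)) U"
      using that openin_subset_topspace_eq openin_subtopology_Int2 by (metis inf.absorb_iff2 openin_subtopology)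
    then have "openin (top_of_set (cimg c)) (cmap c ` U)"
      using homeomorphic_imp_open_map[OF h] by (auto simp: open_map_def)
    then show ?thesis using o(2) openin_open_trans by blast
  qed
  obtain k where k: "homeomorphic_maps (subtopology X (cdom c)) (top_of_set (cimg c)) (cmap c) k"
    using h homeomorphic_map_maps by blast
  \<comment> \<open>\<open>cinv\<close> comes from \<open>inv_into\<close> on the chart domain; on
    the chart image it agrees with the inverse homeomorphism, whose continuity it inherits.\<close>
  have keq: "cinv c x = k x" if "x \<in> cimg c" for x
  proof -
    obtain p where p: "p \<in> cdom c" "x = cmap c p" using \<open>x \<in> cimg c\<close> by blast
    have "k x = p" using k p ts unfolding homeomorphic_maps_def by auto
    then show ?thesis using p inj by (simp add: cinv_def inv_into_f_f)
  qed
  have kc: "continuous_map (top_of_set (cimg c)) (subtopology X (cdom c)) k"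
    using k unfolding homeomorphic_maps_def by blast
  have "continuous_map (top_of_set (cimg c)) (subtopology X (cdom c)) (cinv c)"
    by (rule continuous_map_eq[OF kc]) (simp add: keq)
  then show "continuous_map (top_of_set (cimg c)) X (cinv c)"
    using continuous_map_into_fulltopology by blast
qed

lemma cinv_cmap: "is_chart X c \<Longrightarrow> p \<in> cdom c \<Longrightarrow> cinv c (cmap c p) = p"
  by (simp add: cinv_def chart_inj)

lemma cmap_cinv: "x \<in> cimg c \<Longrightarrow> cmap c (cinv c x) = x"
  unfolding cinv_def by (rule f_inv_into_f)

lemma cinv_in_cdom: "x \<in> cimg c \<Longrightarrow> cinv c x \<in> cdom c"
  unfolding cinv_def by (rule inv_into_into)

lemma local_map_subset:
  assumes "local_map g S h T F W" "open W0" "W0 \<subseteq> W"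
  shows "local_map g S h T F W0"
proof -
  have "F ` W0 \<subseteq> F ` W" using assms(3) by (rule image_mono)
  then show ?thesis
    using assms smooth_on_subset[of F W W0] unfolding local_map_def local_map_axioms_def
    by (meson subset_trans)
qed

lemma transition_cmap: "is_chart X c \<Longrightarrow> p \<in> cdom c \<Longrightarrow> transition c c' (cmap c p) = cmap c' p"
  by (simp add: transition_def cinv_cmap)

lemma local_rep_cmap: "is_chart X c \<Longrightarrow> p \<in> cdom c \<Longrightarrow> local_rep \<phi> c d (cmap c p) = cmap d (\<phi> p)"
  by (simp add: local_rep_def cinv_cmap)

section \<open>Chart transitions as isometries\<close>

context
  fixes M :: "('p, 'n::finite) riem_mfd"
  assumes M: "riemannian_manifold M"
begin

lemma manifold_chart: "c \<in> atlas M \<Longrightarrow> is_chart (mtop M) c"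
  using M by (auto simp: riemannian_manifold_def oriented_smooth_atlas_def)

lemma manifold_chart_exists: "p \<in> points M \<Longrightarrow> \<exists>c\<in>atlas M. p \<in> cdom c"
  using M by (auto simp: riemannian_manifold_def oriented_smooth_atlas_def)

lemma cdom_subset: "c \<in> atlas M \<Longrightarrow> cdom c \<subseteq> points M"
  using M by (auto simp: riemannian_manifold_def oriented_smooth_atlas_def)

lemma manifold_local_metric:
  assumes "c \<in> atlas M" shows "local_metric (metric M c) (cimg c)"
  using M assms chart_open(2)[OF manifold_chart[OF assms]]
  unfolding riemannian_manifold_def riemannian_metric_def local_metric_def by auto

lemma transition_image: "c \<in> atlas M \<Longrightarrow> transition c c' ` cmap c ` (cdom c \<inter> cdom c') = cmap c' ` (cdom c \<inter> cdom c')"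
  using transition_cmap[OF manifold_chart, of c] by (auto simp: image_image)

lemma transition_local_map:
  assumes "c \<in> atlas M" "c' \<in> atlas M"
  shows "local_map (metric M c) (cimg c) (metric M c') (cimg c') (transition c c') (cmap c ` (cdom c \<inter> cdom c'))"
proof -
  have "open (cmap c ` (cdom c \<inter> cdom c'))"
    by (rule chart_open_image[OF manifold_chart[OF assms(1)]])
      (use openin_Int[OF chart_open(1)[OF manifold_chart[OF assms(1)]] chart_open(1)[OF manifold_chart[OF assms(2)]]] in auto)
  moreover have "smooth_on (transition c c') (cmap c ` (cdom c \<inter> cdom c'))"
    using M assms by (auto simp: riemannian_manifold_def oriented_smooth_atlas_def)
  ultimately show ?thesis
    unfolding local_map_def local_map_axioms_def
    using manifold_local_metric assms transition_image[OF assms(1), of c'] by auto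
qed

lemma transition_isometric:
  assumes "c \<in> atlas M" "c' \<in> atlas M" "x \<in> cmap c ` (cdom c \<inter> cdom c')"
  shows "metric M c' (transition c c' x) (deriv_along (transition c c') x u) (deriv_along (transition c c') x v)
    = metric M c x u v"
proof -
  have "\<forall>c\<in>atlas M. \<forall>c'\<in>atlas M. \<forall>x\<in>cmap c ` (cdom c \<inter> cdom c'). \<forall>u v.
      metric M c x u v = metric M c' (transition c c' x)
        (deriv_along (transition c c') x u) (deriv_along (transition c c') x v)"
    using M unfolding riemannian_manifold_def riemannian_metric_def by blast
  from this[rule_format, OF assms, of u v] show ?thesis by simp
qed

lemma transition_det:
  assumes "c \<in> atlas M" "c' \<in> atlas M" "x \<in> cmap c ` (cdom c \<inter> cdom c')"
  shows "det (matrix (deriv_along (transition c c') x)) > 0"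
  using M assms unfolding riemannian_manifold_def oriented_smooth_atlas_def by blast

lemma transition_surj:
  assumes "c \<in> atlas M" "c' \<in> atlas M" "x \<in> cmap c ` (cdom c \<inter> cdom c')"
  shows "surj (deriv_along (transition c c') x)"
  using surj_of_det_nonzero[OF local_map.linear_DF[OF transition_local_map[OF assms(1,2)] assms(3)]]
    transition_det[OF assms] by simp

text \<open>Transitions are isometries between domains of equal dimension, so nothing nonzero is
  normal to the image of their differential. In coordinates this is the transformation law of the
  Christoffel symbols.\<close>

lemma sff_transition:
  assumes "c \<in> atlas M" "c' \<in> atlas M" "x \<in> cmap c ` (cdom c \<inter> cdom c')"
  shows "sff (metric M c) (metric M c') (transition c c') x u v = 0"
  by (rule local_map.sff_eq_0[OF transition_local_map[OF assms(1,2)] assms(3)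
        transition_isometric[OF assms(1,2)] transition_surj[OF assms]])

end

section \<open>Mean curvature and shape operator of an isometric surface\<close>

locale isometric_surface =
  fixes M :: "('p, 2) riem_mfd" and N :: "('q, 'n::finite) riem_mfd" and \<phi> :: "'p \<Rightarrow> 'q"
  assumes M: "riemannian_manifold M" and N: "riemannian_manifold N"
    and isom: "isometric_immersion_on (points M) M N \<phi>"
begin

abbreviation at_charts :: "'p \<Rightarrow> ('p, 2) chart \<Rightarrow> ('q, 'n) chart \<Rightarrow> bool" where
  "at_charts \<equiv> charts_at (points M) M N \<phi>"

definition rep_dom :: "('p, 2) chart \<Rightarrow> ('q, 'n) chart \<Rightarrow> (real ^ 2) set" where
  "rep_dom c d = cmap c ` {p. at_charts p c d}"

lemma at_charts_iff:
  "c \<in> atlas M \<Longrightarrow> d \<in> atlas N \<Longrightarrow> at_charts p c d \<longleftrightarrow> p \<in> cdom c \<and> \<phi> p \<in> cdom d"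
  using cdom_subset[OF M, of c] by (auto simp only: charts_at_def subset_iff)

lemma continuous_\<phi>: "continuous_map (mtop M) (mtop N) \<phi>"
  using isom by (simp add: isometric_immersion_on_def)

lemma openin_charts:
  assumes "c \<in> atlas M" "d \<in> atlas N" shows "openin (mtop M) {p. at_charts p c d}"
proof -
  have "{p. at_charts p c d} = cdom c \<inter> {p \<in> points M. \<phi> p \<in> cdom d}"
    using at_charts_iff[OF assms] cdom_subset[OF M assms(1)] by auto
  then show ?thesis
    using chart_open(1)[OF manifold_chart[OF M assms(1)]]
      openin_continuous_map_preimage[OF continuous_\<phi> chart_open(1)[OF manifold_chart[OF N assms(2)]]]
    by (simp only: openin_Int)
qed

lemma rep_local_map:
  assumes "c \<in> atlas M" "d \<in> atlas N"
  shows "local_map (metric M c) (cimg c) (metric N d) (cimg d) (local_rep \<phi> c d) (rep_dom c d)"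
proof -
  have "open (rep_dom c d)"
    unfolding rep_dom_def
    by (rule chart_open_image[OF manifold_chart[OF M assms(1)] openin_charts[OF assms]])
      (auto simp: charts_at_def)
  moreover have "smooth_on (local_rep \<phi> c d) (rep_dom c d)"
    using isom assms by (simp add: isometric_immersion_on_def rep_dom_def)
  moreover have "rep_dom c d \<subseteq> cimg c" "local_rep \<phi> c d ` rep_dom c d \<subseteq> cimg d"
    using local_rep_cmap[OF manifold_chart[OF M assms(1)], of _ \<phi> d]
    by (auto simp: rep_dom_def charts_at_def)
  ultimately show ?thesis
    unfolding local_map_def local_map_axioms_def
    using manifold_local_metric[OF M assms(1)] manifold_local_metric[OF N assms(2)] by simp
qed

lemma second_ff_sff: "second_ff M N \<phi> c d x u v = sff (metric M c) (metric N d) (local_rep \<phi> c d) x u v"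
  by (simp add: second_ff_def sff_def Let_def)

lemma second_ff_sff': "second_ff M N \<phi> c d x = sff (metric M c) (metric N d) (local_rep \<phi> c d) x"
  by (intro ext) (rule second_ff_sff)

text \<open>The operator \<open>shape_H\<close> with its index lowered. As a bilinear form it
  changes with the charts without any differential being inverted, and \<open>dual\<close> transfers
  its properties to the operator.\<close>

definition shape_form :: "('p, 2) chart \<Rightarrow> ('q, 'n) chart \<Rightarrow> real ^ 2 \<Rightarrow> real ^ 2 \<Rightarrow> real ^ 2 \<Rightarrow> real" where
  "shape_form c d x u v =
    metric N d (local_rep \<phi> c d x) (second_ff M N \<phi> c d x u v) (mean_curvature M N \<phi> c d x)"

context
  fixes c d assumes c: "c \<in> atlas M" and d: "d \<in> atlas N"
begin

interpretation F: local_map "metric M c" "cimg c" "metric N d" "cimg d" "local_rep \<phi> c d" "rep_dom c d"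
  by (rule rep_local_map[OF c d])

interpretation G: local_metric2 "metric M c" "cimg c" ..

lemma bilinear_second_ff: "x \<in> rep_dom c d \<Longrightarrow> bilinear (second_ff M N \<phi> c d x)"
  unfolding second_ff_sff' by (rule F.bilinear_sff)

lemma mean_curvature_eq:
  assumes "x \<in> rep_dom c d" "orthonormal_basis_at (metric M c) x e"
  shows "mean_curvature M N \<phi> c d x = (1/2) *\<^sub>R (\<Sum>i\<in>UNIV. second_ff M N \<phi> c d x (e i) (e i))"
  unfolding mean_curvature_def
  by (simp add: F.dom.metric_trace_eq[OF F.in_dom[OF assms(1)] bilinear_second_ff[OF assms(1)] assms(2)])

lemma smooth_mean_curvature: "smooth_on (mean_curvature M N \<phi> c d) (rep_dom c d)"
  unfolding mean_curvature_def second_ff_sff'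
  by (intro smooth_on_scaleR smooth_on_const F.open_W G.smooth_metric_trace F.W_subset F.bilinear_sff F.smooth_sff)

lemma smooth_shape_form: "smooth_on (\<lambda>x. shape_form c d x u v) (rep_dom c d)"
  unfolding shape_form_def second_ff_sff
  by (rule F.smooth_pullback[OF F.smooth_sff smooth_mean_curvature])

lemma bilinear_shape_form: assumes "x \<in> rep_dom c d" shows "bilinear (shape_form c d x)"
proof -
  note b = bilinear_linear[OF bilinear_second_ff[OF assms]]
  note m = F.cod.metric_simps[OF F.in_cod[OF assms]]
  show ?thesis
    unfolding bilinear_def shape_form_def
    by (intro conjI allI linearI)
      (simp_all add: linear_add[OF b(1)] linear_add[OF b(2)] linear_scale[OF b(1)] linear_scale[OF b(2)] m)
qed

lemma shape_form_sym: "x \<in> rep_dom c d \<Longrightarrow> shape_form c d x u v = shape_form c d x v u"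
  unfolding shape_form_def second_ff_sff by (simp add: F.sff_sym)

lemma shape_H_dual: "shape_H M N \<phi> c d x u = F.dom.dual x (shape_form c d x u)"
  unfolding shape_H_def shape_operator_def F.dom.dual_def shape_form_def ..

lemma shape_H_eq: "x \<in> rep_dom c d \<Longrightarrow> metric M c x (shape_H M N \<phi> c d x u) v = shape_form c d x u v"
  unfolding shape_H_dual by (rule F.dom.dual_eq[OF F.in_dom bilinear_linear(1)[OF bilinear_shape_form]])

lemma smooth_shape_H: "smooth_on (\<lambda>x. shape_H M N \<phi> c d x u) (rep_dom c d)"
  unfolding shape_H_dual
  by (rule F.dom.smooth_dual[OF F.open_W F.W_subset bilinear_linear(1)[OF bilinear_shape_form] smooth_shape_form])

lemma linear_shape_H:
  assumes "x \<in> rep_dom c d" shows "linear (shape_H M N \<phi> c d x)"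
proof -
  note b = bilinear_linear(2)[OF bilinear_shape_form[OF assms]]
  note n = F.dom.nondegenerate[OF F.in_dom[OF assms]]
  show ?thesis
    by (intro linearI; rule n)
      (simp_all add: F.dom.metric_simps[OF F.in_dom[OF assms]] shape_H_eq[OF assms] linear_add[OF b] linear_scale[OF b])
qed

lemma shape_H_adj:
  assumes "x \<in> rep_dom c d"
  shows "metric M c x (shape_H M N \<phi> c d x u) v = metric M c x u (shape_H M N \<phi> c d x v)"
  using shape_H_eq[OF assms] shape_form_sym[OF assms] F.dom.sym[OF F.in_dom[OF assms]] by metis

lemma mean_curvature_norm_square:
  assumes "x \<in> rep_dom c d"
  shows "(mean_curvature_norm M N \<phi> c d x)\<^sup>2 = metric N d (local_rep \<phi> c d x) (mean_curvature M N \<phi> c d x) (mean_curvature M N \<phi> c d x)"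
proof -
  have "metric N d (local_rep \<phi> c d x) h h \<ge> 0" for h
    using F.cod.pos[OF F.in_cod[OF assms], of h] F.cod.metric_simps(9)[OF F.in_cod[OF assms]]
    by (cases "h = 0") auto
  then show ?thesis by (simp add: mean_curvature_norm_def)
qed

text \<open>Writing one factor of \<open>H\<close> in its square as half the trace of the second
  fundamental form gives half the trace of \<open>shape_H\<close>. So constant eigenvalues make |H|
  constant, and their sum is never negative.\<close>

lemma mean_curvature_norm_trace:
  assumes x: "x \<in> rep_dom c d" and ev: "eigenvalues (shape_H M N \<phi> c d x) = {a, b}" "a \<noteq> b"
  shows "(mean_curvature_norm M N \<phi> c d x)\<^sup>2 = (a + b) / 2"
proof -
  note m = F.cod.metric_simps[OF F.in_cod[OF x]]
  note n = F.dom.metric_simps[OF F.in_dom[OF x]]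
  obtain e1 e2 where e: "orthonormal_basis_at (metric M c) x (\<lambda>i. if i = 1 then e1 else e2)"
    "shape_H M N \<phi> c d x e1 = a *\<^sub>R e1" "shape_H M N \<phi> c d x e2 = b *\<^sub>R e2"
    using G.eigenbasis[OF F.in_dom[OF x] linear_shape_H[OF x] shape_H_adj[OF x] ev] by blast
  have on: "metric M c x e1 e1 = 1" "metric M c x e2 e2 = 1"
    using e(1) by (auto simp: orthonormal_basis_at_def forall_2)
  have "metric N d (local_rep \<phi> c d x) (mean_curvature M N \<phi> c d x) (mean_curvature M N \<phi> c d x)
      = (shape_form c d x e1 e1 + shape_form c d x e2 e2) / 2"
    unfolding shape_form_def
    by (subst (1) mean_curvature_eq[OF x e(1)]) (simp add: sum_2 m)
  also have "\<dots> = (a + b) / 2"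
    unfolding shape_H_eq[OF x, symmetric] e by (simp add: n on)
  finally show ?thesis unfolding mean_curvature_norm_square[OF x] .
qed

end

text \<open>On the common domain the map between \<open>c\<close> and \<open>d'\<close> factors
  through the transition of \<open>M\<close> and through that of \<open>N\<close>.
  \<open>sff_compose\<close> computes its form in both ways, and the forms of the transitions
  vanish.\<close>

lemma second_ff_transition:
  assumes p: "at_charts p c d" and c': "c' \<in> atlas M" "p \<in> cdom c'" and d': "d' \<in> atlas N" "\<phi> p \<in> cdom d'"
  shows "second_ff M N \<phi> c' d' (cmap c' p) (deriv_along (transition c c') (cmap c p) u) (deriv_along (transition c c') (cmap c p) v)
    = deriv_along (transition d d') (cmap d (\<phi> p)) (second_ff M N \<phi> c d (cmap c p) u v)"
    and "metric N d' (cmap d' (\<phi> p)) (deriv_along (transition d d') (cmap d (\<phi> p)) a) (deriv_along (transition d d') (cmap d (\<phi> p)) b)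
      = metric N d (cmap d (\<phi> p)) a b"
    and "metric M c' (cmap c' p) (deriv_along (transition c c') (cmap c p) u) (deriv_along (transition c c') (cmap c p) v)
      = metric M c (cmap c p) u v"
    and "linear (deriv_along (transition d d') (cmap d (\<phi> p)))"
proof -
  have c: "c \<in> atlas M" "p \<in> cdom c" and d: "d \<in> atlas N" "\<phi> p \<in> cdom d"
    using p by (auto simp: charts_at_def)
  note cc = manifold_chart[OF M c(1)] and dd = manifold_chart[OF N d(1)]
    and cc' = manifold_chart[OF M c'(1)]
  define \<tau> where "\<tau> = transition c c'"
  define \<sigma> where "\<sigma> = transition d d'"
  define P where "P = {p. at_charts p c d} \<inter> {p. at_charts p c' d'}"
  have P: "P = {p. p \<in> cdom c \<and> p \<in> cdom c' \<and> \<phi> p \<in> cdom d \<and> \<phi> p \<in> cdom d'}"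
    using at_charts_iff[OF c(1) d(1)] at_charts_iff[OF c'(1) d'(1)] by (auto simp: P_def)
  define W0 where "W0 = cmap c ` P"
  have oP: "openin (mtop M) P"
    unfolding P_def using openin_charts[OF c(1) d(1)] openin_charts[OF c'(1) d'(1)] by blast
  have W0: "open W0"
    unfolding W0_def by (rule chart_open_image[OF cc oP]) (auto simp: P)
  have x: "cmap c p \<in> W0" using c d c' d' by (auto simp: W0_def P)
  have FP: "local_rep \<phi> c d (cmap c q) = cmap d (\<phi> q)" "\<tau> (cmap c q) = cmap c' q"
    "\<sigma> (cmap d (\<phi> q)) = cmap d' (\<phi> q)" "local_rep \<phi> c' d' (cmap c' q) = cmap d' (\<phi> q)" if "q \<in> P" for q
    using that local_rep_cmap[OF cc, of q \<phi> d] local_rep_cmap[OF cc', of q \<phi> d'] transition_cmap[OF cc, of q c']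
      transition_cmap[OF dd, of "\<phi> q" d'] by (auto simp: P \<tau>_def \<sigma>_def)
  have pP: "p \<in> P" using c d c' d' by (auto simp: P)
  have sub1: "local_map (metric M c) (cimg c) (metric N d) (cimg d) (local_rep \<phi> c d) W0"
    by (rule local_map_subset[OF rep_local_map[OF c(1) d(1)] W0]) (auto simp: W0_def rep_dom_def P_def)
  have sub2: "local_map (metric M c) (cimg c) (metric M c') (cimg c') \<tau> W0"
    unfolding \<tau>_def
    by (rule local_map_subset[OF transition_local_map[OF M c(1) c'(1)] W0]) (auto simp: W0_def P)
  have \<sigma>: "local_map (metric N d) (cimg d) (metric N d') (cimg d') \<sigma> (cmap d ` (cdom d \<inter> cdom d'))"
    unfolding \<sigma>_def by (rule transition_local_map[OF N d(1) d'(1)])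
  have xd: "cmap d (\<phi> p) \<in> cmap d ` (cdom d \<inter> cdom d')" using d d' by auto
  have xc: "cmap c p \<in> cmap c ` (cdom c \<inter> cdom c')" using c c' by auto
  have D0: "linear (deriv_along (local_rep \<phi> c' d') (cmap c' p))"
    by (rule local_map.linear_DF[OF rep_local_map[OF c'(1) d'(1)]])
      (use c' d' at_charts_iff in \<open>auto simp: rep_dom_def\<close>)
  have "sff (metric M c) (metric N d') (\<lambda>x. local_rep \<phi> c' d' (\<tau> x)) (cmap c p) u v
      = sff (metric M c) (metric N d') (\<lambda>x. \<sigma> (local_rep \<phi> c d x)) (cmap c p) u v"
    by (rule sff_cong[OF W0 x]) (auto simp: W0_def FP)
  moreover have "sff (metric M c) (metric N d') (\<lambda>x. local_rep \<phi> c' d' (\<tau> x)) (cmap c p) u v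
      = sff (metric M c') (metric N d') (local_rep \<phi> c' d') (\<tau> (cmap c p)) (deriv_along \<tau> (cmap c p) u) (deriv_along \<tau> (cmap c p) v)
        + deriv_along (local_rep \<phi> c' d') (\<tau> (cmap c p)) (sff (metric M c) (metric M c') \<tau> (cmap c p) u v)"
    by (rule sff_compose[OF sub2 rep_local_map[OF c'(1) d'(1)] x])
      (auto simp: W0_def FP rep_dom_def P_def)
  moreover have "sff (metric M c) (metric M c') \<tau> (cmap c p) u v = 0"
    unfolding \<tau>_def by (rule sff_transition[OF M c(1) c'(1) xc])
  moreover have "sff (metric M c) (metric N d') (\<lambda>x. \<sigma> (local_rep \<phi> c d x)) (cmap c p) u v
      = sff (metric N d) (metric N d') \<sigma> (local_rep \<phi> c d (cmap c p)) (deriv_along (local_rep \<phi> c d) (cmap c p) u)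
          (deriv_along (local_rep \<phi> c d) (cmap c p) v)
        + deriv_along \<sigma> (local_rep \<phi> c d (cmap c p)) (sff (metric M c) (metric N d) (local_rep \<phi> c d) (cmap c p) u v)"
    by (rule sff_compose[OF sub1 \<sigma> x]) (auto simp: W0_def FP P)
  moreover have "sff (metric N d) (metric N d') \<sigma> (cmap d (\<phi> p)) a b = 0" for a b
    unfolding \<sigma>_def by (rule sff_transition[OF N d(1) d'(1) xd])
  ultimately show "second_ff M N \<phi> c' d' (cmap c' p) (deriv_along (transition c c') (cmap c p) u) (deriv_along (transition c c') (cmap c p) v)
    = deriv_along (transition d d') (cmap d (\<phi> p)) (second_ff M N \<phi> c d (cmap c p) u v)"
    unfolding second_ff_sff FP[OF pP] \<tau>_def[symmetric] \<sigma>_def[symmetric] by (simp add: linear_0[OF D0])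
  show "metric N d' (cmap d' (\<phi> p)) (deriv_along (transition d d') (cmap d (\<phi> p)) a) (deriv_along (transition d d') (cmap d (\<phi> p)) b)
      = metric N d (cmap d (\<phi> p)) a b"
    using transition_isometric[OF N d(1) d'(1) xd, of a b] FP(3)[OF pP] by (simp add: \<sigma>_def)
  show "metric M c' (cmap c' p) (deriv_along (transition c c') (cmap c p) u) (deriv_along (transition c c') (cmap c p) v)
      = metric M c (cmap c p) u v"
    using transition_isometric[OF M c(1) c'(1) xc, of u v] FP(2)[OF pP] by (simp add: \<tau>_def)
  show "linear (deriv_along (transition d d') (cmap d (\<phi> p)))"
    by (rule local_map.linear_DF[OF transition_local_map[OF N d(1) d'(1)] xd])
qed

text \<open>The differential of the transition of \<open>M\<close> carries an orthonormal basis to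
  an orthonormal basis, so the mean curvature vectors correspond under the differential of the
  transition of \<open>N\<close>, which preserves inner products.\<close>

lemma shape_form_transition:
  assumes p: "at_charts p c d" and c': "c' \<in> atlas M" "p \<in> cdom c'" and d': "d' \<in> atlas N" "\<phi> p \<in> cdom d'"
  shows "shape_form c' d' (cmap c' p) (deriv_along (transition c c') (cmap c p) u) (deriv_along (transition c c') (cmap c p) v)
    = shape_form c d (cmap c p) u v"
proof -
  note t = second_ff_transition[OF p c' d']
  have c: "c \<in> atlas M" "p \<in> cdom c" and d: "d \<in> atlas N" "\<phi> p \<in> cdom d"
    using p by (auto simp: charts_at_def)
  have p': "at_charts p c' d'" using c' d' at_charts_iff by blast
  have x: "cmap c p \<in> rep_dom c d" and x': "cmap c' p \<in> rep_dom c' d'"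
    using p p' by (auto simp: rep_dom_def)
  have xM: "cmap c p \<in> cimg c" using c by auto
  interpret G: local_metric2 "metric M c" "cimg c"
    unfolding local_metric2_def by (rule manifold_local_metric[OF M c(1)])
  define e where "e = (\<lambda>i::2. if i = 1 then G.frame1 (cmap c p) else G.frame2 (cmap c p))"
  have e: "orthonormal_basis_at (metric M c) (cmap c p) e"
    unfolding e_def by (rule G.orthonormal_frame[OF xM])
  define D where "D = deriv_along (transition c c') (cmap c p)"
  have e': "orthonormal_basis_at (metric M c') (cmap c' p) (\<lambda>i. D (e i))"
    using e unfolding orthonormal_basis_at_def D_def t(3) .
  have "mean_curvature M N \<phi> c' d' (cmap c' p) = (1/2) *\<^sub>R (\<Sum>i\<in>UNIV. second_ff M N \<phi> c' d' (cmap c' p) (D (e i)) (D (e i)))"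
    by (rule mean_curvature_eq[OF c'(1) d'(1) x' e'])
  also have "\<dots> = deriv_along (transition d d') (cmap d (\<phi> p)) (mean_curvature M N \<phi> c d (cmap c p))"
    unfolding mean_curvature_eq[OF c(1) d(1) x e] D_def t(1)
    by (simp add: linear_sum[OF t(4)] linear_scale[OF t(4)])
  finally have H: "mean_curvature M N \<phi> c' d' (cmap c' p)
      = deriv_along (transition d d') (cmap d (\<phi> p)) (mean_curvature M N \<phi> c d (cmap c p))" .
  show ?thesis
    unfolding shape_form_def t(1) H
      local_rep_cmap[OF manifold_chart[OF M c(1)] c(2)] local_rep_cmap[OF manifold_chart[OF M c'(1)] c'(2)]
    by (rule t(2))
qed

end

text \<open>A constant multiple of the identity is parallel, so only the multiple of
  \<open>T\<close> contributes.\<close>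

lemma cov_deriv_endo_affine:
  assumes "open W" "x \<in> W" "\<And>y v. y \<in> W \<Longrightarrow> T' y v = s *\<^sub>R v + t *\<^sub>R T y v"
    "(\<lambda>y. T y v) differentiable (at x)" "linear (christoffel g x u)"
  shows "cov_deriv_endo g T' x u v = t *\<^sub>R cov_deriv_endo g T x u v"
proof -
  have "deriv_along (\<lambda>y. T' y v) x u = deriv_along (\<lambda>y. s *\<^sub>R v + t *\<^sub>R T y v) x u"
    by (rule deriv_along_cong[OF assms(1,2)]) (rule assms(3))
  also have "\<dots> = t *\<^sub>R deriv_along (\<lambda>y. T y v) x u"
    by (rule deriv_along_eq) (auto intro!: derivative_eq_intros has_derivative_deriv_along assms(4))
  finally show ?thesis
    unfolding cov_deriv_endo_def assms(3)[OF assms(2)]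
    by (simp add: linear_add[OF assms(5)] linear_scale[OF assms(5)] algebra_simps)
qed

section \<open>Flat coordinates on the surface\<close>

context isometric_surface
begin

lemma shape_H_divergence_free:
  assumes bi: "biconservative M N \<phi>" and c: "c \<in> atlas M" and d: "d \<in> atlas N"
    and ev: "\<And>x. x \<in> rep_dom c d \<Longrightarrow> eigenvalues (shape_H M N \<phi> c d x) = {a, b}" and ne: "a \<noteq> b"
    and x: "x \<in> rep_dom c d"
  shows "divergence_endo (metric M c) (shape_H M N \<phi> c d) x = 0"
proof -
  interpret F: local_map "metric M c" "cimg c" "metric N d" "cimg d" "local_rep \<phi> c d" "rep_dom c d"
    by (rule rep_local_map[OF c d])
  obtain p where p: "at_charts p c d" "x = cmap c p" using x by (auto simp: rep_dom_def)
  have S: "stress_bienergy M N \<phi> c d y v = (- (a + b)) *\<^sub>R v + 4 *\<^sub>R shape_H M N \<phi> c d y v"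
    if "y \<in> rep_dom c d" for y v
    unfolding stress_bienergy_def mean_curvature_norm_trace[OF c d that ev[OF that] ne] by simp
  have "cov_deriv_endo (metric M c) (stress_bienergy M N \<phi> c d) x u v
      = 4 *\<^sub>R cov_deriv_endo (metric M c) (shape_H M N \<phi> c d) x u v" for u v
    by (rule cov_deriv_endo_affine[OF F.open_W x S smooth_on_differentiable[OF smooth_shape_H[OF c d] x]
          bilinear_linear(1)[OF F.dom.bilinear_christoffel[OF F.in_dom[OF x]]]])
  then have "divergence_endo (metric M c) (stress_bienergy M N \<phi> c d) x
      = 4 *\<^sub>R divergence_endo (metric M c) (shape_H M N \<phi> c d) x"
    unfolding divergence_endo_def metric_trace_def Let_def by (simp add: scaleR_sum_right)
  moreover have "divergence_endo (metric M c) (stress_bienergy M N \<phi> c d) x = 0"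
    using bi p unfolding biconservative_def by (simp del: split_paired_All)
  ultimately show ?thesis by simp
qed

text \<open>The coordinates come from one pair of charts, but \<open>f\<close> is a function of the
  points, and tensoriality gives its properties in every pair. The bound \<open>\<epsilon>\<close>
  later keeps the image of the immersion in a region that only one chart of the space form
  meets.\<close>

theorem local_flat_coordinates:
  assumes bi: "biconservative M N \<phi>"
    and ev: "\<And>c d x. c \<in> atlas M \<Longrightarrow> d \<in> atlas N \<Longrightarrow> x \<in> rep_dom c d \<Longrightarrow>
      eigenvalues (shape_H M N \<phi> c d x) = {a, b}" and ne: "a \<noteq> b"
    and p\<^sub>0: "p\<^sub>0 \<in> points M" and eps: "\<epsilon> > 0"
  shows "\<exists>V (f :: 'p \<Rightarrow> real ^ 2). openin (mtop M) V \<and> connectedin (mtop M) V \<and> p\<^sub>0 \<in> V \<and>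
    continuous_map (subtopology (mtop M) V) euclidean f \<and> (\<forall>p\<in>V. norm (f p) < \<epsilon>) \<and>
    (\<forall>c\<in>atlas M. smooth_on (f \<circ> cinv c) (cmap c ` (V \<inter> cdom c)) \<and>
      (\<forall>x\<in>cmap c ` (V \<inter> cdom c).
        (\<forall>u v. metric M c x u v = deriv_along (f \<circ> cinv c) x u \<bullet> deriv_along (f \<circ> cinv c) x v) \<and>
        det (matrix (deriv_along (f \<circ> cinv c) x)) > 0 \<and>
        (\<forall>d\<in>atlas N. x \<in> rep_dom c d \<longrightarrow> (\<forall>u v. metric M c x (shape_H M N \<phi> c d x u) v
          = a * (deriv_along (f \<circ> cinv c) x u $ 1 * deriv_along (f \<circ> cinv c) x v $ 1)
            + b * (deriv_along (f \<circ> cinv c) x u $ 2 * deriv_along (f \<circ> cinv c) x v $ 2)))))"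
proof -
  obtain c0 where c0: "c0 \<in> atlas M" "p\<^sub>0 \<in> cdom c0" using manifold_chart_exists[OF M p\<^sub>0] by blast
  have "\<phi> p\<^sub>0 \<in> points N" using continuous_map_image_subset_topspace[OF continuous_\<phi>] p\<^sub>0 by blast
  then obtain d0 where d0: "d0 \<in> atlas N" "\<phi> p\<^sub>0 \<in> cdom d0" using manifold_chart_exists[OF N] by blast
  note C0 = manifold_chart[OF M c0(1)]
  interpret F: local_map "metric M c0" "cimg c0" "metric N d0" "cimg d0" "local_rep \<phi> c0 d0" "rep_dom c0 d0"
    by (rule rep_local_map[OF c0(1) d0(1)])
  interpret G: local_metric2 "metric M c0" "cimg c0" ..
  define x0 where "x0 = cmap c0 p\<^sub>0"
  have x0: "x0 \<in> rep_dom c0 d0" using c0 d0 at_charts_iff unfolding x0_def rep_dom_def by blast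
  obtain r f0 where r: "r > 0" "ball x0 r \<subseteq> rep_dom c0 d0" "smooth_on f0 (ball x0 r)" "f0 x0 = (0 :: real ^ 2)"
    and f0: "\<forall>x\<in>ball x0 r.
       (\<forall>u v. metric M c0 x u v = deriv_along f0 x u \<bullet> deriv_along f0 x v) \<and>
       (\<forall>u v. metric M c0 x (shape_H M N \<phi> c0 d0 x u) v = a * (deriv_along f0 x u $ 1 * deriv_along f0 x v $ 1)
          + b * (deriv_along f0 x u $ 2 * deriv_along f0 x v $ 2)) \<and>
       det (matrix (deriv_along f0 x)) > 0"
    using G.flat_coordinates[OF F.open_W F.W_subset linear_shape_H[OF c0(1) d0(1)] shape_H_adj[OF c0(1) d0(1)]
        ev[OF c0(1) d0(1)] ne smooth_shape_H[OF c0(1) d0(1)]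
        shape_H_divergence_free[OF bi c0(1) d0(1) ev[OF c0(1) d0(1)] ne] x0] by blast
  have "isCont f0 x0"
    using smooth_on_imp_continuous_on[OF r(3)] r(1) by (simp add: continuous_on_eq_continuous_at)
  then obtain r' where r': "r' > 0" "\<And>x. dist x x0 < r' \<Longrightarrow> dist (f0 x) (f0 x0) < \<epsilon>"
    using eps unfolding continuous_at_eps_delta by blast
  define B where "B = ball x0 (min r r')"
  have B: "open B" "connected B" "x0 \<in> B" "B \<subseteq> ball x0 r" "B \<subseteq> cimg c0" "B \<subseteq> rep_dom c0 d0"
    using r r' F.W_subset by (auto simp: B_def)
  have fB: "norm (f0 x) < \<epsilon>" if "x \<in> B" for x
    using r'(2)[of x] that r(4) by (simp add: B_def dist_commute)
  define V where "V = {p \<in> cdom c0. cmap c0 p \<in> B}"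
  define f where "f p = f0 (cmap c0 p)" for p
  \<comment> \<open>As a preimage under the chart \<open>V\<close> is open; as the image of a ball
    under the inverse chart it is connected.\<close>
  have VcB: "V = cinv c0 ` B"
  proof -
    have "cinv c0 x \<in> V" if "x \<in> B" for x
      using that B(5) cinv_in_cdom[of x c0] cmap_cinv[of x c0] by (auto simp: V_def)
    moreover have "p \<in> cinv c0 ` B" if "p \<in> V" for p
      using that cinv_cmap[OF C0, of p] unfolding V_def by (metis (mono_tags, lifting) image_eqI mem_Collect_eq)
    ultimately show ?thesis by blast
  qed
  have ts: "topspace (subtopology (mtop M) (cdom c0)) = cdom c0"
    using cdom_subset[OF M c0(1)] by auto
  have V: "openin (mtop M) V"
  proof -
    have "openin (subtopology (mtop M) (cdom c0)) {p \<in> topspace (subtopology (mtop M) (cdom c0)). cmap c0 p \<in> B}"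
      by (rule openin_continuous_map_preimage[OF chart_continuous[OF C0]]) (use B(1) in simp)
    then show ?thesis
      unfolding ts V_def using openin_trans_full[OF _ chart_open(1)[OF C0]] by blast
  qed
  have conn: "connectedin (mtop M) V"
    unfolding VcB
    by (rule connectedin_continuous_map_image[OF chart_inv_continuous[OF C0]])
      (use B(2,5) in \<open>simp add: connectedin_subtopology\<close>)
  have p0V: "p\<^sub>0 \<in> V" using c0 B(3) by (simp add: V_def x0_def)
  have VM: "V \<subseteq> cdom c0" by (auto simp: V_def)
  have cont: "continuous_map (subtopology (mtop M) V) euclidean f"
  proof -
    have 1: "continuous_map (subtopology (mtop M) V) euclidean (cmap c0)"
      using continuous_map_from_subtopology_mono[OF chart_continuous[OF C0] VM] .
    have "continuous_map (subtopology (mtop M) V) (top_of_set B) (cmap c0)"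
      using 1 by (auto simp: continuous_map_in_subtopology V_def)
    moreover have "continuous_map (top_of_set B) euclidean f0"
      using continuous_on_subset[OF smooth_on_imp_continuous_on[OF r(3)] B(4)] by simp
    ultimately have "continuous_map (subtopology (mtop M) V) euclidean (f0 \<circ> cmap c0)"
      by (rule continuous_map_compose)
    then show ?thesis by (simp add: f_def[abs_def] o_def)
  qed
  have main: "smooth_on (f \<circ> cinv c) (cmap c ` (V \<inter> cdom c)) \<and>
      (\<forall>x\<in>cmap c ` (V \<inter> cdom c).
        (\<forall>u v. metric M c x u v = deriv_along (f \<circ> cinv c) x u \<bullet> deriv_along (f \<circ> cinv c) x v) \<and>
        det (matrix (deriv_along (f \<circ> cinv c) x)) > 0 \<and>
        (\<forall>d\<in>atlas N. x \<in> rep_dom c d \<longrightarrow> (\<forall>u v. metric M c x (shape_H M N \<phi> c d x u) v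
          = a * (deriv_along (f \<circ> cinv c) x u $ 1 * deriv_along (f \<circ> cinv c) x v $ 1)
            + b * (deriv_along (f \<circ> cinv c) x u $ 2 * deriv_along (f \<circ> cinv c) x v $ 2))))"
    if c: "c \<in> atlas M" for c
  proof -
    note C = manifold_chart[OF M c]
    define \<tau> where "\<tau> = transition c c0"
    have f\<tau>: "f \<circ> cinv c = (\<lambda>x. f0 (\<tau> x))" by (auto simp: f_def \<tau>_def transition_def)
    define U where "U = cmap c ` (V \<inter> cdom c)"
    have U: "open U"
      unfolding U_def by (rule chart_open_image[OF C openin_Int[OF V chart_open(1)[OF C]]]) simp
    have Usub: "U \<subseteq> cmap c ` (cdom c \<inter> cdom c0)" using VM by (auto simp: U_def)
    have \<tau>U: "\<tau> ` U \<subseteq> B"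
      using transition_cmap[OF C, of _ c0] by (auto simp: U_def \<tau>_def V_def)
    have L\<tau>: "local_map (metric M c) (cimg c) (metric M c0) (cimg c0) \<tau> U"
      unfolding \<tau>_def by (rule local_map_subset[OF transition_local_map[OF M c c0(1)] U Usub])
    interpret T: local_map "metric M c" "cimg c" "metric M c0" "cimg c0" \<tau> U by (rule L\<tau>)
    have smf: "smooth_on f0 B" using smooth_on_subset[OF r(3) B(4)] .
    have sm: "smooth_on (f \<circ> cinv c) U"
      unfolding f\<tau> by (rule smooth_on_compose[OF smf T.smooth_F U \<tau>U])
    have D: "deriv_along (f \<circ> cinv c) x u = deriv_along f0 (\<tau> x) (deriv_along \<tau> x u)" if "x \<in> U" for x u
      unfolding f\<tau> by (rule deriv_along_compose_smooth[OF smf T.smooth_F \<tau>U that])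
    have m: "metric M c0 (\<tau> x) (deriv_along \<tau> x u) (deriv_along \<tau> x v) = metric M c x u v" if "x \<in> U" for x u v
      unfolding \<tau>_def using transition_isometric[OF M c c0(1)] Usub that by blast
    have 1: "metric M c x u v = deriv_along (f \<circ> cinv c) x u \<bullet> deriv_along (f \<circ> cinv c) x v" if "x \<in> U" for x u v
      using f0 \<tau>U B(4) that unfolding D[OF that] m[OF that, symmetric] by blast
    have 2: "det (matrix (deriv_along (f \<circ> cinv c) x)) > 0" if "x \<in> U" for x
    proof -
      have \<tau>x: "\<tau> x \<in> ball x0 r" using \<tau>U B(4) that by blast
      have "deriv_along (f \<circ> cinv c) x = deriv_along f0 (\<tau> x) \<circ> deriv_along \<tau> x"
        using D[OF that] by auto
      moreover have "det (matrix (deriv_along \<tau> x)) > 0"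
        unfolding \<tau>_def using transition_det[OF M c c0(1)] Usub that by blast
      moreover have "det (matrix (deriv_along f0 (\<tau> x))) > 0" using f0 \<tau>x by blast
      ultimately show ?thesis
        using matrix_compose[OF T.linear_DF[OF that] linear_deriv_along[OF smooth_on_differentiable[OF r(3) \<tau>x]]]
        by (simp only: det_mul mult_pos_pos)
    qed
    have 3: "metric M c x (shape_H M N \<phi> c d x u) v
          = a * (deriv_along (f \<circ> cinv c) x u $ 1 * deriv_along (f \<circ> cinv c) x v $ 1)
            + b * (deriv_along (f \<circ> cinv c) x u $ 2 * deriv_along (f \<circ> cinv c) x v $ 2)"
      if x: "x \<in> U" and d: "d \<in> atlas N" "x \<in> rep_dom c d" for x d u v
    proof -
      obtain p where p: "p \<in> V" "p \<in> cdom c" "x = cmap c p" using x by (auto simp: U_def)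
      obtain q where q: "at_charts q c d" "x = cmap c q" using d(2) by (auto simp: rep_dom_def)
      have "p = q" using p q chart_inj[OF C] by (auto simp: charts_at_def dest: inj_onD)
      then have pd: "at_charts p c d" using q by simp
      have \<tau>x: "\<tau> x = cmap c0 p" using transition_cmap[OF C p(2)] by (simp add: \<tau>_def p(3))
      have \<tau>B: "\<tau> x \<in> B" using \<tau>U x by blast
      have pc0: "p \<in> cdom c0" using p VM by blast
      obtain q' where q': "at_charts q' c0 d0" "\<tau> x = cmap c0 q'" using \<tau>B B(6) unfolding rep_dom_def by blast
      have "p = q'" using q' \<tau>x pc0 chart_inj[OF C0] by (auto simp: charts_at_def dest: inj_onD)
      then have pd0: "\<phi> p \<in> cdom d0" using q' by (simp add: charts_at_def)
      \<comment> \<open>Pass to the bilinear form, change to the charts \<open>c0\<close> and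
        \<open>d0\<close>, and return to the operator there.\<close>
      have "metric M c x (shape_H M N \<phi> c d x u) v = shape_form c d x u v"
        by (rule shape_H_eq[OF c d])
      also have "\<dots> = shape_form c0 d0 (\<tau> x) (deriv_along \<tau> x u) (deriv_along \<tau> x v)"
        using shape_form_transition[OF pd c0(1) pc0 d0(1) pd0, of u v] \<tau>x by (simp add: p(3) \<tau>_def)
      also have "\<dots> = metric M c0 (\<tau> x) (shape_H M N \<phi> c0 d0 (\<tau> x) (deriv_along \<tau> x u)) (deriv_along \<tau> x v)"
        by (rule shape_H_eq[OF c0(1) d0(1), symmetric]) (use \<tau>B B(6) in blast)
      also have "\<dots> = a * (deriv_along (f \<circ> cinv c) x u $ 1 * deriv_along (f \<circ> cinv c) x v $ 1)
            + b * (deriv_along (f \<circ> cinv c) x u $ 2 * deriv_along (f \<circ> cinv c) x v $ 2)"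
        using f0 \<tau>B B(4) unfolding D[OF x] by blast
      finally show ?thesis .
    qed
    show ?thesis using sm 1 2 3 unfolding U_def by blast
  qed
  have fV: "\<forall>p\<in>V. norm (f p) < \<epsilon>" using fB by (simp add: V_def f_def)
  show ?thesis
    by (rule exI[of _ V], rule exI[of _ f]) (intro conjI V conn p0V cont fV ballI[where P = "\<lambda>c. _ c"] main; assumption)
qed

end

section \<open>Model metrics of constant curvature\<close>

text \<open>The metric induced on the graph \<open>y = sqrt (1 / k - |x|\<^sup>2)\<close>, i.e. the orthogonal projection of a
  hemisphere of radius \<open>1 / sqrt k\<close>; for \<open>k < 0\<close> this is the hyperboloid model.\<close>

definition model_metric :: "real \<Rightarrow> real ^ 'n::finite \<Rightarrow> real ^ 'n \<Rightarrow> real ^ 'n \<Rightarrow> real" where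
  "model_metric k x u v = u \<bullet> v + k * (x \<bullet> u) * (x \<bullet> v) / (1 - k * (x \<bullet> x))"

definition model_dom :: "real \<Rightarrow> (real ^ 'n::finite) set" where
  "model_dom k = {x. k * (x \<bullet> x) < 1}"

text \<open>After multiplication by the denominator, both terms are nonnegative for k \<ge> 0. For k
  < 0 the second one is negative or 0, but by Cauchy-Schwarz the part of the first one containing
  \<open>k\<close> outweighs it, and \<open>u \<bullet> u\<close> is left over.\<close>

lemma model_metric_pos:
  assumes "x \<in> model_dom k" "u \<noteq> 0" shows "model_metric k x u u > 0"
proof -
  have d: "1 - k * (x \<bullet> x) > 0" using assms(1) by (simp add: model_dom_def)
  have uu: "u \<bullet> u > 0" using assms(2) by simp
  have "(u \<bullet> u) * (1 - k * (x \<bullet> x)) + k * (x \<bullet> u)\<^sup>2 > 0"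
  proof (cases "k \<ge> 0")
    case True
    have "(u \<bullet> u) * (1 - k * (x \<bullet> x)) > 0" using uu d by (rule mult_pos_pos)
    moreover have "k * (x \<bullet> u)\<^sup>2 \<ge> 0" using True by simp
    ultimately show ?thesis by linarith
  next
    case False
    have "(x \<bullet> u)\<^sup>2 \<le> (x \<bullet> x) * (u \<bullet> u)" by (rule Cauchy_Schwarz_ineq)
    then have "- k * (x \<bullet> u)\<^sup>2 \<le> - k * ((x \<bullet> x) * (u \<bullet> u))"
      using False by (intro mult_left_mono) auto
    moreover have "(u \<bullet> u) * (1 - k * (x \<bullet> x)) + k * (x \<bullet> u)\<^sup>2
        = u \<bullet> u + (- k * ((x \<bullet> x) * (u \<bullet> u)) + k * (x \<bullet> u)\<^sup>2)"
      by (simp add: algebra_simps)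
    ultimately show ?thesis using uu by linarith
  qed
  then have "((u \<bullet> u) * (1 - k * (x \<bullet> x)) + k * (x \<bullet> u)\<^sup>2) / (1 - k * (x \<bullet> x)) > 0"
    using d by simp
  moreover have "((u \<bullet> u) * (1 - k * (x \<bullet> x)) + k * (x \<bullet> u)\<^sup>2) / (1 - k * (x \<bullet> x)) = model_metric k x u u"
  proof -
    define D where "D = 1 - k * (x \<bullet> x)"
    have "D \<noteq> 0" using d by (simp add: D_def)
    then show ?thesis
      unfolding model_metric_def D_def[symmetric] by (simp add: add_divide_distrib power2_eq_square mult.assoc)
  qed
  ultimately show ?thesis by simp
qed

lemma open_model_dom: "open (model_dom k)"
  unfolding model_dom_def by (intro open_Collect_less continuous_intros)

lemma bilinear_model_metric: "bilinear (model_metric k x)"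
  unfolding bilinear_def model_metric_def
  by (intro conjI allI linearI) (simp_all add: inner_simps algebra_simps add_divide_distrib)

lemma smooth_model_metric: "smooth_on (\<lambda>x. model_metric k x u v) (model_dom k)"
  unfolding model_metric_def
  by (intro smooth_on_add smooth_on_const smooth_on_divide smooth_on_mult smooth_on_inner smooth_on_id
      smooth_on_diff open_model_dom) (auto simp: model_dom_def)

lemma model_metric_sym: "model_metric k x u v = model_metric k x v u"
  by (simp add: model_metric_def inner_commute mult_ac)

lemma local_metric_model: "local_metric (model_metric k) (model_dom k)"
  by unfold_locales
    (auto simp: open_model_dom bilinear_model_metric smooth_model_metric model_metric_pos intro: model_metric_sym)

lemma deriv_model_metric:
  assumes "x \<in> model_dom k"
  shows "deriv_along (\<lambda>y. model_metric k y v w) x u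
    = k * ((u \<bullet> v) * (x \<bullet> w) + (x \<bullet> v) * (u \<bullet> w)) / (1 - k * (x \<bullet> x))
      + 2 * k\<^sup>2 * (x \<bullet> u) * (x \<bullet> v) * (x \<bullet> w) / (1 - k * (x \<bullet> x))\<^sup>2"
proof (rule deriv_along_eq)
  define D where "D = 1 - k * (x \<bullet> x)"
  have D: "D \<noteq> 0" using assms by (simp add: model_dom_def D_def)
  have "((\<lambda>y. model_metric k y v w) has_derivative (\<lambda>u. (k * ((u \<bullet> v) * (x \<bullet> w) + (x \<bullet> v) * (u \<bullet> w)) * D
      + k * (x \<bullet> v) * (x \<bullet> w) * (k * (2 * (x \<bullet> u)))) / (D * D))) (at x)"
    unfolding model_metric_def using D unfolding D_def
    by (auto intro!: derivative_eq_intros simp: inner_commute algebra_simps)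
  then show "((\<lambda>y. model_metric k y v w) has_derivative
      (\<lambda>u. k * ((u \<bullet> v) * (x \<bullet> w) + (x \<bullet> v) * (u \<bullet> w)) / (1 - k * (x \<bullet> x))
      + 2 * k\<^sup>2 * (x \<bullet> u) * (x \<bullet> v) * (x \<bullet> w) / (1 - k * (x \<bullet> x))\<^sup>2)) (at x)"
    by (rule has_derivative_eq_rhs)
      (use D in \<open>auto simp: D_def[symmetric] fun_eq_iff add_divide_distrib power2_eq_square\<close>)
qed

lemma model_metric_center:
  assumes "x \<in> model_dom k" shows "model_metric k x x w = (x \<bullet> w) / (1 - k * (x \<bullet> x))"
  using assms by (simp add: model_metric_def model_dom_def field_simps)

text \<open>Geodesics of the quadric accelerate along the position vector, with factor - k times the
  squared speed. Projection preserves this, so the Christoffel symbol is radial;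
  \<open>model_metric_center\<close> makes the Koszul check short.\<close>

lemma christoffel_model:
  assumes "x \<in> model_dom k"
  shows "christoffel (model_metric k) x u v = (k * model_metric k x u v) *\<^sub>R x"
proof -
  interpret local_metric "model_metric k" "model_dom k" by (rule local_metric_model)
  define D where "D = 1 - k * (x \<bullet> x)"
  have D: "D \<noteq> 0" using assms by (simp add: model_dom_def D_def)
  show ?thesis
  proof (rule christoffel_unique[OF assms])
    fix w
    have "model_metric k x ((k * model_metric k x u v) *\<^sub>R x) w = k * model_metric k x u v * ((x \<bullet> w) / D)"
      by (simp add: metric_simps[OF assms] model_metric_center[OF assms] D_def)
    also have "\<dots> = koszul x u v w"
      unfolding koszul_def deriv_model_metric[OF assms] unfolding model_metric_def D_def[symmetric]
      using D by (simp add: inner_commute field_simps power2_eq_square)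
    finally show "model_metric k x ((k * model_metric k x u v) *\<^sub>R x) w = koszul x u v w" .
  qed
qed

lemma riemann_model:
  assumes x: "x \<in> model_dom k"
  shows "riemann (model_metric k) x u v w = k *\<^sub>R (model_metric k x v w *\<^sub>R u - model_metric k x u w *\<^sub>R v)"
proof -
  interpret local_metric "model_metric k" "model_dom k" by (rule local_metric_model)
  have D: "deriv_along (\<lambda>y. christoffel (model_metric k) y v w) x u
      = (k * deriv_along (\<lambda>y. model_metric k y v w) x u) *\<^sub>R x + (k * model_metric k x v w) *\<^sub>R u" for u v w
  proof -
    have "deriv_along (\<lambda>y. christoffel (model_metric k) y v w) x u
        = deriv_along (\<lambda>y. (k * model_metric k y v w) *\<^sub>R y) x u"
      by (rule deriv_along_cong[OF open_model_dom x]) (rule christoffel_model)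
    also have "\<dots> = (k * deriv_along (\<lambda>y. model_metric k y v w) x u) *\<^sub>R x + (k * model_metric k x v w) *\<^sub>R u"
      by (rule deriv_along_eq)
        (auto intro!: derivative_eq_intros has_derivative_deriv_along metric_differentiable[OF x] simp: algebra_simps)
    finally show ?thesis .
  qed
  \<comment> \<open>Metric compatibility expresses derivatives of the metric through the Christoffel
    symbols just found, so the explicit derivative formula is not differentiated again.\<close>
  have C: "deriv_along (\<lambda>y. model_metric k y v w) x u
      = k * model_metric k x u v * model_metric k x x w + k * model_metric k x u w * model_metric k x x v" for u v w
    unfolding metric_compatible[OF x] christoffel_model[OF x]
    by (simp add: metric_simps[OF x] sym[OF x, of v x])
  show ?thesis
    unfolding riemann_def D C christoffel_model[OF x]
    by (simp add: metric_simps[OF x] sym[OF x] algebra_simps)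
qed

lemma sectional_model:
  assumes x: "x \<in> model_dom k" and uv: "independent {u, v}" "u \<noteq> v"
  shows "sectional (model_metric k) x u v = k"
proof -
  interpret local_metric "model_metric k" "model_dom k" by (rule local_metric_model)
  define G where "G = model_metric k x"
  have v0: "v \<noteq> 0" using uv(1) dependent_zero by blast
  then have vv: "G v v > 0" unfolding G_def using pos[OF x] by blast
  \<comment> \<open>The part of \<open>u\<close> orthogonal to \<open>v\<close> is nonzero by
    independence; its squared length times \<open>G v v\<close> is the denominator of
    \<open>sectional\<close>.\<close>
  have "u - (G u v / G v v) *\<^sub>R v \<noteq> 0"
  proof
    assume "u - (G u v / G v v) *\<^sub>R v = 0"
    then have "u = (G u v / G v v) *\<^sub>R v" by simp
    then have "u \<in> span {v}" by (metis span_base span_scale singletonI)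
    then show False using uv by (metis dependent_def insert_Diff_single insertI1 Diff_insert_absorb insert_commute singletonD)
  qed
  then have "G (u - (G u v / G v v) *\<^sub>R v) (u - (G u v / G v v) *\<^sub>R v) > 0"
    unfolding G_def using pos[OF x] by blast
  then have "G u u - (G u v)\<^sup>2 / G v v > 0"
    using vv sym[OF x, of v u] unfolding G_def
    by (simp add: metric_simps[OF x] power2_eq_square field_simps)
  then have "G u u * G v v - (G u v)\<^sup>2 > 0"
    using vv by (simp add: field_simps)
  moreover have "G (riemann (model_metric k) x u v v) u = k * (G u u * G v v - (G u v)\<^sup>2)"
    unfolding riemann_model[OF x] G_def
    by (simp add: metric_simps[OF x] power2_eq_square sym[OF x, of v u] algebra_simps)
  ultimately show ?thesis unfolding sectional_def G_def by simp
qed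

section \<open>Generalised trigonometric functions\<close>

text \<open>\<open>tcos a\<close> and \<open>tsin a\<close> solve \<open>y'' = - a y\<close>; \<open>tvers a\<close> is the primitive of \<open>tsin a\<close> vanishing at \<open>0\<close>.\<close>

definition tcos :: "real \<Rightarrow> real \<Rightarrow> real" where
  "tcos a t = (if a > 0 then cos (sqrt a * t) else cosh (sqrt (- a) * t))"

definition tsin :: "real \<Rightarrow> real \<Rightarrow> real" where
  "tsin a t = (if a > 0 then sin (sqrt a * t) / sqrt a else if a = 0 then t else sinh (sqrt (- a) * t) / sqrt (- a))"

definition tvers :: "real \<Rightarrow> real \<Rightarrow> real" where
  "tvers a t = (if a = 0 then t\<^sup>2 / 2 else (1 - tcos a t) / a)"

text \<open>Valid for every sign of \<open>a\<close>, including 0. It removes \<open>tcos\<close>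
  from later identities, which become polynomial in \<open>tsin\<close> and
  \<open>tvers\<close>.\<close>

lemma tcos_eq: "tcos a t = 1 - a * tvers a t"
  by (simp add: tvers_def tcos_def)

lemma t_zero [simp]: "tcos a 0 = 1" "tsin a 0 = 0" "tvers a 0 = 0"
  by (simp_all add: tcos_def tsin_def tvers_def)

lemma has_derivative_tsin: "(tsin a has_real_derivative tcos a t) (at t)"
proof -
  consider "a > 0" | "a = 0" | "a < 0" by linarith
  then show ?thesis
  proof cases
    case 1
    then show ?thesis unfolding tsin_def[abs_def] tcos_def
      by (auto intro!: derivative_eq_intros simp: mult.assoc)
  next
    case 2
    then show ?thesis unfolding tsin_def[abs_def] tcos_def by (auto intro!: derivative_eq_intros)
  next
    case 3
    then show ?thesis unfolding tsin_def[abs_def] tcos_def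
      by (auto intro!: derivative_eq_intros simp: mult.assoc)
  qed
qed

lemma has_derivative_tcos: "(tcos a has_real_derivative - a * tsin a t) (at t)"
proof -
  consider "a > 0" | "a = 0" | "a < 0" by linarith
  then show ?thesis
  proof cases
    case 1
    then have "a = sqrt a * sqrt a" by simp
    then have "a * z / sqrt a = z * sqrt a" for z
      using 1 by (metis mult.commute mult.assoc nonzero_mult_div_cancel_right real_sqrt_gt_zero less_irrefl)
    with 1 show ?thesis unfolding tsin_def tcos_def[abs_def] by (auto intro!: derivative_eq_intros)
  next
    case 2
    then show ?thesis unfolding tsin_def tcos_def[abs_def] by (auto intro!: derivative_eq_intros)
  next
    case 3
    then have "- a = sqrt (- a) * sqrt (- a)" by simp
    then have "- a * z / sqrt (- a) = z * sqrt (- a)" for z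
      using 3 by (metis mult.commute mult.assoc nonzero_mult_div_cancel_right real_sqrt_gt_zero less_irrefl neg_0_less_iff_less)
    with 3 show ?thesis unfolding tsin_def tcos_def[abs_def] by (auto intro!: derivative_eq_intros)
  qed
qed

lemma has_derivative_tvers: "(tvers a has_real_derivative tsin a t) (at t)"
proof (cases "a = 0")
  case True
  then show ?thesis unfolding tvers_def[abs_def] tsin_def by (auto intro!: derivative_eq_intros)
next
  case False
  then show ?thesis unfolding tvers_def[abs_def]
    by (auto intro!: derivative_eq_intros has_derivative_tcos)
qed

lemma tcos_tsin: "(tcos a t)\<^sup>2 + a * (tsin a t)\<^sup>2 = 1"
proof -
  consider "a > 0" | "a = 0" | "a < 0" by linarith
  then show ?thesis
  proof cases
    case 3
    then show ?thesis
      using cosh_square_eq[of "sqrt (- a) * t"] by (simp add: tcos_def tsin_def power_divide)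
  qed (auto simp: tcos_def tsin_def power_divide)
qed

text \<open>The identity \<open>tcos_tsin\<close> with \<open>tcos\<close> eliminated and a factor
  \<open>a\<close> divided out. The result remains informative at \<open>a = 0\<close>, where
  \<open>tcos_tsin\<close> says nothing about \<open>tsin\<close>.\<close>

lemma tsin_square: "(tsin a t)\<^sup>2 = 2 * tvers a t - a * (tvers a t)\<^sup>2"
proof (cases "a = 0")
  case True
  then show ?thesis by (simp add: tsin_def tvers_def)
next
  case False
  have "a * (tsin a t)\<^sup>2 = a * (2 * tvers a t - a * (tvers a t)\<^sup>2)"
    using tcos_tsin[of a t] unfolding tcos_eq by (simp add: power2_eq_square algebra_simps)
  then show ?thesis using False by simp
qed

text \<open>Each derivative is a constant multiple of the other function, so the orders of
  regularity have to rise together.\<close>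

lemma Ck_on_tcos_tsin: "Ck_on k (tcos a) UNIV \<and> Ck_on k (tsin a) UNIV"
proof (induction k)
  case 0
  then show ?case
    using has_derivative_tcos has_derivative_tsin
    by (auto intro!: continuous_at_imp_continuous_on DERIV_isCont)
next
  case (Suc k)
  have dc: "(tcos a has_derivative (\<lambda>h. (- a * h) * tsin a t)) (at t)" for t
    using has_derivative_tcos[of a t] unfolding has_field_derivative_def
    by (rule has_derivative_eq_rhs) auto
  have ds: "(tsin a has_derivative (\<lambda>h. h * tcos a t)) (at t)" for t
    using has_derivative_tsin[of a t] unfolding has_field_derivative_def
    by (rule has_derivative_eq_rhs) auto
  have "Ck_on k (\<lambda>t. (- a * h) * tsin a t) UNIV" for h
    by (rule Ck_on_bilinear[OF Ck_on_const _ open_UNIV bounded_bilinear_mult]) (use Suc in simp)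
  moreover have "Ck_on k (\<lambda>t. h * tcos a t) UNIV" for h
    by (rule Ck_on_bilinear[OF Ck_on_const _ open_UNIV bounded_bilinear_mult]) (use Suc in simp)
  moreover have "tcos a differentiable (at t)" "tsin a differentiable (at t)" for t
    using dc ds unfolding differentiable_def by blast+
  ultimately show ?case
    by (simp add: deriv_along_eq[OF dc] deriv_along_eq[OF ds])
qed

lemma smooth_tcos: "smooth_on (tcos a) UNIV" and smooth_tsin: "smooth_on (tsin a) UNIV"
  using Ck_on_tcos_tsin by (auto simp: smooth_on_def)

lemma smooth_tvers: "smooth_on (tvers a) UNIV"
proof (cases "a = 0")
  case True
  then have "tvers a = (\<lambda>t. t ^ 2 / 2)" by (auto simp: tvers_def)
  then show ?thesis by (auto intro!: smooth_intros)
next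
  case False
  then have "tvers a = (\<lambda>t. (1 - tcos a t) / a)" by (auto simp: tvers_def)
  then show ?thesis using False by (auto intro!: smooth_intros smooth_tcos)
qed

section \<open>Space forms\<close>

lemma vector_4 [simp]:
  "(vector [x, y, z, w] :: 'a::zero ^ 4) $ 1 = x" "(vector [x, y, z, w] :: 'a ^ 4) $ 2 = y"
  "(vector [x, y, z, w] :: 'a ^ 4) $ 3 = z" "(vector [x, y, z, w] :: 'a ^ 4) $ 4 = w"
  unfolding vector_def by simp_all

lemma inner_3: "(x :: real ^ 3) \<bullet> y = x $ 1 * y $ 1 + x $ 2 * y $ 2 + x $ 3 * y $ 3"
  by (simp add: inner_vec_def sum_3)

lemma inner_4: "(x :: real ^ 4) \<bullet> y = x $ 1 * y $ 1 + x $ 2 * y $ 2 + x $ 3 * y $ 3 + x $ 4 * y $ 4"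
  by (simp add: inner_vec_def sum_4)

definition vec_part :: "real ^ 4 \<Rightarrow> real ^ 3" where
  "vec_part p = vector [p $ 1, p $ 2, p $ 3]"

definition join4 :: "real ^ 3 \<Rightarrow> real \<Rightarrow> real ^ 4" where
  "join4 x t = vector [x $ 1, x $ 2, x $ 3, t]"

lemma vec_part_nth [simp]: "vec_part p $ 1 = p $ 1" "vec_part p $ 2 = p $ 2" "vec_part p $ 3 = p $ 3"
  by (simp_all add: vec_part_def)

lemma join4_nth [simp]: "join4 x t $ 1 = x $ 1" "join4 x t $ 2 = x $ 2" "join4 x t $ 3 = x $ 3" "join4 x t $ 4 = t"
  by (simp_all add: join4_def)

lemma vec_part_join4 [simp]: "vec_part (join4 x t) = x"
  by (simp add: vec_eq_iff forall_3)

lemma join4_vec_part [simp]: "join4 (vec_part p) (p $ 4) = p"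
  by (simp add: vec_eq_iff forall_4)

lemma bounded_linear_vec_part: "bounded_linear vec_part"
  by (rule linear_conv_bounded_linear[THEN iffD1], rule linearI) (simp_all add: vec_eq_iff forall_3)

lemma bounded_linear_join4_0: "bounded_linear (\<lambda>x. join4 x 0)"
  by (rule linear_conv_bounded_linear[THEN iffD1], rule linearI) (simp_all add: vec_eq_iff forall_4)

lemma join4_inner: "join4 x s \<bullet> join4 y t = x \<bullet> y + s * t"
  by (simp add: inner_3 inner_4)

lemma inner_vec_part: "p \<bullet> q = vec_part p \<bullet> vec_part q + p $ 4 * q $ 4"
  by (simp add: inner_3 inner_4)

lemma Hausdorff_second_countable_euclidean_subset:
  fixes S :: "'a::euclidean_space set"
  shows "Hausdorff_space (top_of_set S)" "second_countable (top_of_set S)"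
proof -
  show "Hausdorff_space (top_of_set S)"
    by (rule Hausdorff_space_subtopology) simp
  have "second_countable (euclidean :: 'a topology)"
  proof -
    obtain \<B> :: "'a set set" where "countable \<B>" "topological_basis \<B>" using ex_countable_basis by blast
    then show ?thesis
      unfolding second_countable_def topological_basis_def
      by (metis open_openin openin_topspace subset_iff topological_basisE topological_basis_def)
  qed
  then show "second_countable (top_of_set S)"
    by (rule second_countable_subtopology)
qed

lemma vector_derivative_tcos_tsin:
  fixes x u :: "'a::real_normed_vector"
  shows "vector_derivative (\<lambda>t. tcos a t *\<^sub>R x + tsin a t *\<^sub>R u) (at t) = tcos a t *\<^sub>R u - (a * tsin a t) *\<^sub>R x"
    and "vector_derivative (\<lambda>t. tcos a t *\<^sub>R u - (a * tsin a t) *\<^sub>R x) (at t)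
      = - a *\<^sub>R (tcos a t *\<^sub>R x + tsin a t *\<^sub>R u)"
proof -
  have "((\<lambda>t. tcos a t *\<^sub>R x + tsin a t *\<^sub>R u) has_vector_derivative
      (tcos a t *\<^sub>R 0 + (- a * tsin a t) *\<^sub>R x) + (tsin a t *\<^sub>R 0 + tcos a t *\<^sub>R u)) (at t)"
    by (intro has_vector_derivative_add has_vector_derivative_scaleR has_derivative_tcos has_derivative_tsin
        has_vector_derivative_const)
  then show "vector_derivative (\<lambda>t. tcos a t *\<^sub>R x + tsin a t *\<^sub>R u) (at t) = tcos a t *\<^sub>R u - (a * tsin a t) *\<^sub>R x"
    by (simp add: vector_derivative_at)
  have "((\<lambda>t. tcos a t *\<^sub>R u - tsin a t *\<^sub>R (a *\<^sub>R x)) has_vector_derivative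
      (tcos a t *\<^sub>R 0 + (- a * tsin a t) *\<^sub>R u) - (tsin a t *\<^sub>R 0 + tcos a t *\<^sub>R (a *\<^sub>R x))) (at t)"
    by (intro has_vector_derivative_diff has_vector_derivative_scaleR has_derivative_tcos has_derivative_tsin
        has_vector_derivative_const)
  then show "vector_derivative (\<lambda>t. tcos a t *\<^sub>R u - (a * tsin a t) *\<^sub>R x) (at t)
      = - a *\<^sub>R (tcos a t *\<^sub>R x + tsin a t *\<^sub>R u)"
    by (simp add: vector_derivative_at algebra_simps)
qed

lemma smooth_tcos_tsin_curve:
  fixes x u :: "'a::real_normed_vector"
  shows "open T \<Longrightarrow> smooth_on (\<lambda>t. tcos a t *\<^sub>R x + tsin a t *\<^sub>R u) T"
  by (intro smooth_on_add smooth_on_scaleR smooth_on_const smooth_on_subset[OF smooth_tcos]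
      smooth_on_subset[OF smooth_tsin]) auto

text \<open>Conservation of energy; the cross terms combine to the Wronskian \<open>C\<^sup>2 + k n S\<^sup>2 = 1\<close>.\<close>

lemma model_geodesic_speed:
  fixes x u :: "real ^ 'n::finite"
  assumes n: "n = model_metric k x u u" and x: "x \<in> model_dom k"
    and CS: "C\<^sup>2 + k * n * S\<^sup>2 = 1" and c: "C *\<^sub>R x + S *\<^sub>R u \<in> model_dom k"
  shows "model_metric k (C *\<^sub>R x + S *\<^sub>R u) (C *\<^sub>R u - (k * n * S) *\<^sub>R x) (C *\<^sub>R u - (k * n * S) *\<^sub>R x) = n"
proof -
  define a b e where "a = x \<bullet> x" "b = x \<bullet> u" "e = u \<bullet> u"
  define q where "q = C *\<^sub>R x + S *\<^sub>R u"
  define q' where "q' = C *\<^sub>R u - (k * n * S) *\<^sub>R x"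
  have D: "1 - k * a \<noteq> 0" using x by (simp add: model_dom_def a_b_e_def)
  have E: "1 - k * (q \<bullet> q) \<noteq> 0" using c by (simp add: model_dom_def q_def)
  \<comment> \<open>The definition of the squared speed \<open>n\<close>, cleared of its
    denominator.\<close>
  have kb: "k * b\<^sup>2 = (n - e) * (1 - k * a)"
    using D unfolding n model_metric_def a_b_e_def[symmetric] by (simp add: power2_eq_square)
  have qq: "q \<bullet> q = C\<^sup>2 * a + 2 * C * S * b + S\<^sup>2 * e"
    and qq': "q \<bullet> q' = C\<^sup>2 * b + C * S * e - k * n * S * C * a - k * n * S\<^sup>2 * b"
    and q'q': "q' \<bullet> q' = C\<^sup>2 * e - 2 * k * n * S * C * b + (k * n * S)\<^sup>2 * a"
    unfolding q_def q'_def a_b_e_def by (simp_all add: inner_simps inner_commute power2_eq_square algebra_simps)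
  \<comment> \<open>The Gram determinant of \<open>q\<close>, \<open>q'\<close> is that of
    \<open>x\<close>, \<open>u\<close> times the squared determinant of the change of basis, which
    is the Wronskian.\<close>
  have lagrange: "(q \<bullet> q) * (q' \<bullet> q') - (q \<bullet> q')\<^sup>2 = (C\<^sup>2 + k * n * S\<^sup>2)\<^sup>2 * (a * e - b\<^sup>2)"
    unfolding qq qq' q'q' by (simp add: power2_eq_square algebra_simps)
  have "q' \<bullet> q' + k * n * (q \<bullet> q) = (C\<^sup>2 + k * n * S\<^sup>2) * (e + k * n * a)"
    unfolding qq q'q' by (simp add: power2_eq_square algebra_simps)
  then have 1: "q' \<bullet> q' + k * n * (q \<bullet> q) = e + k * n * a" unfolding CS by simp
  have 2: "(q \<bullet> q) * (q' \<bullet> q') - (q \<bullet> q')\<^sup>2 = a * e - b\<^sup>2" unfolding lagrange CS by simp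
  have "(q' \<bullet> q') * (1 - k * (q \<bullet> q)) + k * (q \<bullet> q')\<^sup>2
      = q' \<bullet> q' - k * ((q \<bullet> q) * (q' \<bullet> q') - (q \<bullet> q')\<^sup>2)"
    by (simp add: algebra_simps)
  also have "\<dots> = q' \<bullet> q' - k * a * e + k * b\<^sup>2" unfolding 2 by (simp add: algebra_simps)
  also have "\<dots> = n * (1 - k * (q \<bullet> q))"
    unfolding kb using 1 by (simp add: algebra_simps)
  finally have "(q' \<bullet> q') * (1 - k * (q \<bullet> q)) + k * (q \<bullet> q')\<^sup>2 = n * (1 - k * (q \<bullet> q))" .
  then have "((q' \<bullet> q') * (1 - k * (q \<bullet> q)) + k * (q \<bullet> q')\<^sup>2) / (1 - k * (q \<bullet> q)) = n"
    using E by simp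
  then have "q' \<bullet> q' + k * (q \<bullet> q')\<^sup>2 / (1 - k * (q \<bullet> q)) = n"
    using E by (simp add: add_divide_distrib)
  then show ?thesis
    unfolding model_metric_def q_def[symmetric] q'_def[symmetric] by (simp add: power2_eq_square mult.assoc)
qed

lemma riemannian_metric_model:
  assumes "\<And>c. c \<in> A \<Longrightarrow> cimg c \<subseteq> model_dom k"
    and "\<And>c c' x u v. c \<in> A \<Longrightarrow> c' \<in> A \<Longrightarrow> x \<in> cmap c ` (cdom c \<inter> cdom c') \<Longrightarrow>
      model_metric k x u v = model_metric k (transition c c' x)
          (deriv_along (transition c c') x u) (deriv_along (transition c c') x v)"
  shows "riemannian_metric A (\<lambda>_. model_metric k)"
  unfolding riemannian_metric_def
proof (intro conjI ballI allI impI)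
  fix c x u v assume c: "c \<in> A" and x: "x \<in> cimg c"
  show "bilinear (model_metric k x)" by (rule bilinear_model_metric)
  show "model_metric k x u v = model_metric k x v u" by (rule model_metric_sym)
  show "u \<noteq> 0 \<Longrightarrow> 0 < model_metric k x u u" using assms(1)[OF c] x model_metric_pos by blast
next
  fix c u v assume "c \<in> A"
  then show "smooth_on (\<lambda>x. model_metric k x u v) (cimg c)"
    using smooth_on_subset[OF smooth_model_metric assms(1)] by blast
qed (rule assms(2))

lemma constant_curvature_model:
  assumes "\<And>c. c \<in> atlas Q \<Longrightarrow> cimg c \<subseteq> model_dom k" "metric Q = (\<lambda>_. model_metric k)"
  shows "constant_sectional_curvature Q k"
  unfolding constant_sectional_curvature_def assms(2) using assms(1) sectional_model by blast

section \<open>The space form of curvature k \<le> 0\<close>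

definition hyperplane4 :: "(real ^ 4) set" where
  "hyperplane4 = {p. p $ 4 = 0}"

definition global_chart :: "(real ^ 4, 3) chart" where
  "global_chart = (hyperplane4, vec_part)"

text \<open>For k \<le> 0 the model domain is the whole space, so one chart suffices. The points
  form a hyperplane of \<open>real ^ 4\<close> in order to share their type with the sphere.\<close>

definition global_model :: "real \<Rightarrow> (real ^ 4, 3) riem_mfd" where
  "global_model k = \<lparr>mtop = top_of_set hyperplane4, atlas = {global_chart}, metric = (\<lambda>_. model_metric k)\<rparr>"

lemma vec_part_hyperplane4: "vec_part ` hyperplane4 = UNIV"
proof -
  have "x \<in> vec_part ` hyperplane4" for x
    by (rule image_eqI[of _ _ "join4 x 0"]) (simp_all add: hyperplane4_def)
  then show ?thesis by blast
qed

lemma cinv_global_chart: "cinv global_chart x = join4 x 0"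
proof -
  have "inj_on vec_part hyperplane4"
    by (rule inj_onI) (metis (mono_tags, lifting) hyperplane4_def join4_vec_part mem_Collect_eq)
  then have "inv_into hyperplane4 vec_part (vec_part (join4 x 0)) = join4 x 0"
    by (rule inv_into_f_f) (simp add: hyperplane4_def)
  then show ?thesis by (simp add: cinv_def global_chart_def)
qed

lemma model_dom_UNIV: "k \<le> 0 \<Longrightarrow> model_dom k = UNIV"
proof -
  assume "k \<le> 0"
  then have "k * (x \<bullet> x) \<le> 0" for x :: "real ^ 'n" by (simp add: mult_nonpos_nonneg)
  then show ?thesis unfolding model_dom_def by (force intro: le_less_trans[OF _ zero_less_one])
qed

lemma transition_global_chart: "transition global_chart global_chart = (\<lambda>x. x)"
  by (rule ext) (simp add: transition_def cinv_global_chart, simp add: global_chart_def)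

lemma is_chart_global_chart: "is_chart (top_of_set hyperplane4) global_chart"
proof -
  have "homeomorphic_maps (top_of_set hyperplane4) euclidean vec_part (\<lambda>x. join4 x 0)"
    unfolding homeomorphic_maps_def
  proof (intro conjI ballI)
    show "continuous_map (top_of_set hyperplane4) euclidean vec_part"
      by (simp add: linear_continuous_on bounded_linear_vec_part)
    show "continuous_map euclidean (top_of_set hyperplane4) (\<lambda>x. join4 x 0)"
      by (auto simp: continuous_map_in_subtopology hyperplane4_def linear_continuous_on bounded_linear_join4_0)
  qed (auto simp: hyperplane4_def vec_eq_iff forall_4 forall_3)
  then have "homeomorphic_map (top_of_set hyperplane4) euclidean vec_part"
    using homeomorphic_map_maps by blast
  then show ?thesis
    by (simp add: is_chart_def global_chart_def vec_part_hyperplane4 subtopology_subtopology)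
qed

lemma space_form_global_model:
  assumes k: "k \<le> 0" shows "space_form (global_model k) k"
  unfolding space_form_def
proof (intro conjI)
  note dom = model_dom_UNIV[OF k]
  have cmap: "cmap global_chart = vec_part" "cdom global_chart = hyperplane4" by (simp_all add: global_chart_def)
  show "constant_sectional_curvature (global_model k) k"
    by (rule constant_curvature_model) (simp_all add: global_model_def dom)
  have "connected hyperplane4"
  proof -
    have "convex hyperplane4" unfolding hyperplane4_def convex_def by simp
    then show ?thesis by (rule convex_connected)
  qed
  moreover have "0 \<in> hyperplane4" by (simp add: hyperplane4_def)
  moreover have "oriented_smooth_atlas (top_of_set hyperplane4) {global_chart}"
    unfolding oriented_smooth_atlas_def
    by (auto simp: is_chart_global_chart transition_global_chart smooth_on_id cmap matrix_id_mat_1[unfolded id_def])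
  moreover have "riemannian_metric {global_chart} (\<lambda>_. model_metric k)"
    by (rule riemannian_metric_model) (auto simp: dom transition_global_chart)
  ultimately show "riemannian_manifold (global_model k)"
    unfolding riemannian_manifold_def global_model_def
    using Hausdorff_second_countable_euclidean_subset[of hyperplane4] by (auto simp: connected_space_subtopology)
  show "geodesically_complete (global_model k)"
    unfolding geodesically_complete_def
  proof (intro ballI allI)
    fix c p u assume "c \<in> atlas (global_model k)" "p \<in> cdom c"
    then have c: "c = global_chart" and p: "p \<in> hyperplane4" by (auto simp: global_model_def cmap)
    define x where "x = vec_part p"
    define n where "n = model_metric k x u u"
    \<comment> \<open>A solution of \<beta>'' = - k n \<beta>. Since the Christoffel term is
      \<open>k\<close> times the squared speed times \<beta>, this is the geodesic equation provided
      that the squared speed remains \<open>n\<close>, which is \<open>speed\<close>.\<close>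
    define \<beta> where "\<beta> t = tcos (k * n) t *\<^sub>R x + tsin (k * n) t *\<^sub>R u" for t
    define \<gamma> where "\<gamma> t = join4 (\<beta> t) 0" for t
    have \<beta>: "cmap global_chart \<circ> \<gamma> = \<beta>" by (auto simp: \<gamma>_def cmap)
    have \<beta>1: "vector_derivative \<beta> (at t) = tcos (k * n) t *\<^sub>R u - (k * n * tsin (k * n) t) *\<^sub>R x" for t
      unfolding \<beta>_def[abs_def] by (rule vector_derivative_tcos_tsin)
    have \<beta>2: "vector_derivative (\<lambda>s. vector_derivative \<beta> (at s)) (at t) = - (k * n) *\<^sub>R \<beta> t" for t
      unfolding \<beta>1 unfolding \<beta>_def by (rule vector_derivative_tcos_tsin)
    have speed: "model_metric k (\<beta> t) (vector_derivative \<beta> (at t)) (vector_derivative \<beta> (at t)) = n" for t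
      unfolding \<beta>1 unfolding \<beta>_def
      by (rule model_geodesic_speed[OF n_def]) (use tcos_tsin[of "k * n" t] in \<open>auto simp: dom\<close>)
    have sm: "smooth_on \<beta> UNIV" unfolding \<beta>_def[abs_def] by (rule smooth_tcos_tsin_curve) simp
    have cont: "continuous_map euclideanreal (top_of_set hyperplane4) \<gamma>"
      unfolding \<gamma>_def[abs_def]
      using bounded_linear.continuous_on[OF bounded_linear_join4_0 smooth_on_imp_continuous_on[OF sm]]
      by (auto simp: continuous_map_in_subtopology hyperplane4_def)
    show "\<exists>\<gamma>. complete_geodesic (global_model k) \<gamma> \<and> \<gamma> 0 = p \<and> vector_derivative (cmap c \<circ> \<gamma>) (at 0) = u"
    proof (intro exI[of _ \<gamma>] conjI)
      show "\<gamma> 0 = p"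
        using p join4_vec_part[of p] by (simp add: \<gamma>_def \<beta>_def x_def hyperplane4_def)
      show "vector_derivative (cmap c \<circ> \<gamma>) (at 0) = u"
        unfolding c \<beta> \<beta>1 by simp
      have "vector_derivative (\<lambda>s. vector_derivative \<beta> (at s)) (at t)
          + christoffel (model_metric k) (\<beta> t) (vector_derivative \<beta> (at t)) (vector_derivative \<beta> (at t)) = 0" for t
        unfolding \<beta>2 by (subst christoffel_model) (simp_all add: dom speed)
      moreover have "vec_part (\<gamma> t) = \<beta> t" for t by (simp add: \<gamma>_def)
      ultimately show "complete_geodesic (global_model k) \<gamma>"
        unfolding complete_geodesic_def
        using cont smooth_on_subset[OF sm] by (simp add: global_model_def \<beta>) (simp add: cmap)
    qed
  qed
qed

subsection \<open>The round three-sphere\<close>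

text \<open>Quaternion multiplication, with the real part in the last coordinate. Left multiplication by
  unit quaternions carries the chart around the pole to charts around all other points.\<close>

definition qmul :: "real ^ 4 \<Rightarrow> real ^ 4 \<Rightarrow> real ^ 4" where
  "qmul a p = vector
    [a $ 4 * p $ 1 + a $ 1 * p $ 4 + a $ 2 * p $ 3 - a $ 3 * p $ 2,
     a $ 4 * p $ 2 + a $ 2 * p $ 4 + a $ 3 * p $ 1 - a $ 1 * p $ 3,
     a $ 4 * p $ 3 + a $ 3 * p $ 4 + a $ 1 * p $ 2 - a $ 2 * p $ 1,
     a $ 4 * p $ 4 - a $ 1 * p $ 1 - a $ 2 * p $ 2 - a $ 3 * p $ 3]"

definition qconj :: "real ^ 4 \<Rightarrow> real ^ 4" where
  "qconj a = vector [- a $ 1, - a $ 2, - a $ 3, a $ 4]"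

lemma qmul_inner: "qmul a p \<bullet> qmul a q = (a \<bullet> a) * (p \<bullet> q)"
  by (simp add: inner_4 qmul_def algebra_simps)

lemma qconj_inner [simp]: "qconj a \<bullet> qconj a = a \<bullet> a"
  by (simp add: inner_4 qconj_def)

lemma qmul_assoc: "qmul a (qmul b p) = qmul (qmul a b) p"
  by (simp add: vec_eq_iff forall_4 qmul_def algebra_simps)

lemma qmul_qconj:
  "qmul a (qmul (qconj a) p) = (a \<bullet> a) *\<^sub>R p" "qmul (qconj a) (qmul a p) = (a \<bullet> a) *\<^sub>R p"
  by (simp_all add: vec_eq_iff forall_4 inner_4 qmul_def qconj_def algebra_simps)

lemma qmul_one: "qmul (axis 4 1) p = p" "qconj (axis 4 1) = axis 4 1"
  by (simp_all add: vec_eq_iff forall_4 qmul_def qconj_def axis_def)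

lemma bounded_linear_qmul: "bounded_linear (qmul a)"
  by (rule linear_conv_bounded_linear[THEN iffD1], rule linearI)
    (simp_all add: vec_eq_iff forall_4 qmul_def algebra_simps)

lemma qmul_linear: "linear (qmul a)" and vec_part_linear: "linear vec_part"
  using bounded_linear_qmul bounded_linear_vec_part by (simp_all add: bounded_linear.linear)

text \<open>Orthogonal projection along the last axis turns the Euclidean metric on the sphere of
  curvature \<open>k\<close> into the model metric.\<close>

lemma model_metric_tangent:
  assumes k: "k > 0" and p: "p \<bullet> p = 1 / k" "p $ 4 \<noteq> 0" and v: "p \<bullet> v = 0" and w: "p \<bullet> w = 0"
  shows "model_metric k (vec_part p) (vec_part v) (vec_part w) = v \<bullet> w"
proof -
  have 1: "1 - k * (vec_part p \<bullet> vec_part p) = k * (p $ 4 * p $ 4)"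
    using p(1) k unfolding inner_vec_part[of p p] by (simp add: field_simps)
  have 2: "vec_part p \<bullet> vec_part v = - (p $ 4 * v $ 4)" "vec_part p \<bullet> vec_part w = - (p $ 4 * w $ 4)"
    using v w unfolding inner_vec_part[of p] by simp_all
  show ?thesis
    unfolding model_metric_def 1 2 inner_vec_part[of v w] using k p(2) by simp
qed

context
  fixes k :: real
  assumes k: "k > 0"
begin

definition sphere3 :: "(real ^ 4) set" where
  "sphere3 = {p. p \<bullet> p = 1 / k}"

definition height :: "real ^ 3 \<Rightarrow> real" where
  "height x = sqrt (1 / k - x \<bullet> x)"

definition lift :: "real ^ 3 \<Rightarrow> real ^ 4" where
  "lift x = join4 x (height x)"

text \<open>Only the chart around the pole \<open>axis 4 1\<close> contains points of height at least
  \<open>1 / (2 * sqrt k)\<close>; near the pole there is therefore a single chart.\<close>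

definition sph_dom :: "real ^ 4 \<Rightarrow> (real ^ 4) set" where
  "sph_dom q = {p \<in> sphere3. qmul (qconj q) p $ 4 > 0 \<and> (q = axis 4 1 \<or> p $ 4 < 1 / (2 * sqrt k))}"

definition sph_chart :: "real ^ 4 \<Rightarrow> (real ^ 4, 3) chart" where
  "sph_chart q = (sph_dom q, \<lambda>p. vec_part (qmul (qconj q) p))"

definition sphere_model :: "(real ^ 4, 3) riem_mfd" where
  "sphere_model = \<lparr>mtop = top_of_set sphere3, atlas = sph_chart ` {q. q \<bullet> q = 1}, metric = (\<lambda>_. model_metric k)\<rparr>"

lemma sph_chart_sel [simp]: "cdom (sph_chart q) = sph_dom q" "cmap (sph_chart q) = (\<lambda>p. vec_part (qmul (qconj q) p))"
  by (simp_all add: sph_chart_def)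

lemma model_dom_iff: "x \<in> model_dom k \<longleftrightarrow> 1 / k - x \<bullet> x > 0"
  using k by (simp add: model_dom_def field_simps)

lemma height_pos: "x \<in> model_dom k \<Longrightarrow> height x > 0" "x \<in> model_dom k \<Longrightarrow> height x * height x = 1 / k - x \<bullet> x"
  by (simp_all add: model_dom_iff height_def)

lemma lift_facts:
  assumes "x \<in> model_dom k" shows "lift x \<bullet> lift x = 1 / k" "lift x $ 4 > 0" "vec_part (lift x) = x"
  using height_pos[OF assms] by (simp_all add: lift_def join4_inner)

lemma lift_vec_part:
  assumes "p \<in> sphere3" "p $ 4 > 0"
  shows "lift (vec_part p) = p" "vec_part p \<in> model_dom k"
proof -
  have 1: "1 / k - vec_part p \<bullet> vec_part p = p $ 4 * p $ 4"
    using assms(1) unfolding sphere3_def by (simp add: inner_vec_part[of p p])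
  then have "height (vec_part p) = p $ 4" using assms(2) by (simp add: height_def)
  then show "lift (vec_part p) = p" by (simp add: lift_def)
  show "vec_part p \<in> model_dom k" unfolding model_dom_iff 1 using assms(2) by simp
qed

lemma qmul_sphere3: "a \<bullet> a = 1 \<Longrightarrow> p \<in> sphere3 \<Longrightarrow> qmul a p \<in> sphere3"
  by (simp add: sphere3_def qmul_inner)

lemma sph_chart_facts:
  assumes q: "q \<bullet> q = 1" and p: "p \<in> sph_dom q"
  shows "vec_part (qmul (qconj q) p) \<in> model_dom k"
    and "qmul q (lift (vec_part (qmul (qconj q) p))) = p"
    and "lift (vec_part (qmul (qconj q) p)) = qmul (qconj q) p"
proof -
  have 1: "qmul (qconj q) p \<in> sphere3" "qmul (qconj q) p $ 4 > 0"
    using p qmul_sphere3[of "qconj q" p] q by (auto simp: sph_dom_def)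
  show "vec_part (qmul (qconj q) p) \<in> model_dom k" by (rule lift_vec_part(2)[OF 1])
  show 2: "lift (vec_part (qmul (qconj q) p)) = qmul (qconj q) p" by (rule lift_vec_part(1)[OF 1])
  show "qmul q (lift (vec_part (qmul (qconj q) p))) = p" unfolding 2 by (simp add: qmul_qconj q)
qed

lemma cimg_sph_chart:
  assumes q: "q \<bullet> q = 1"
  shows "cimg (sph_chart q) = {x \<in> model_dom k. q = axis 4 1 \<or> qmul q (lift x) $ 4 < 1 / (2 * sqrt k)}"
proof (intro equalityI subsetI)
  fix x assume "x \<in> cimg (sph_chart q)"
  then obtain p where p: "p \<in> sph_dom q" "x = vec_part (qmul (qconj q) p)" by auto
  then show "x \<in> {x \<in> model_dom k. q = axis 4 1 \<or> qmul q (lift x) $ 4 < 1 / (2 * sqrt k)}"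
    using sph_chart_facts[OF q p(1)] by (auto simp: sph_dom_def)
next
  fix x assume "x \<in> {x \<in> model_dom k. q = axis 4 1 \<or> qmul q (lift x) $ 4 < 1 / (2 * sqrt k)}"
  then have x: "x \<in> model_dom k" "q = axis 4 1 \<or> qmul q (lift x) $ 4 < 1 / (2 * sqrt k)" by auto
  note l = lift_facts[OF x(1)]
  have c: "qmul (qconj q) (qmul q (lift x)) = lift x" by (simp add: qmul_qconj q)
  have "qmul q (lift x) \<in> sphere3" using l(1) q by (simp add: sphere3_def qmul_inner)
  then have "qmul q (lift x) \<in> sph_dom q" using x(2) l(2) c by (simp add: sph_dom_def)
  moreover have "x = vec_part (qmul (qconj q) (qmul q (lift x)))" using c l(3) by simp
  ultimately show "x \<in> cimg (sph_chart q)" by auto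
qed

lemma cinv_sph_chart:
  assumes q: "q \<bullet> q = 1" and x: "x \<in> cimg (sph_chart q)"
  shows "cinv (sph_chart q) x = qmul q (lift x)"
  using sph_chart_facts(2)[OF q, of "cinv (sph_chart q) x"] cinv_in_cdom[OF x] cmap_cinv[OF x] by simp

lemma smooth_lift: "smooth_on lift (model_dom k)"
proof (rule smooth_on_vec[OF _ open_model_dom])
  fix i
  have h: "smooth_on height (model_dom k)"
    unfolding height_def
    by (intro smooth_on_sqrt smooth_on_diff smooth_on_const smooth_on_inner smooth_on_id open_model_dom)
      (simp add: model_dom_iff)
  have "smooth_on (\<lambda>x. lift x $ 1) (model_dom k)" "smooth_on (\<lambda>x. lift x $ 2) (model_dom k)"
    "smooth_on (\<lambda>x. lift x $ 3) (model_dom k)" "smooth_on (\<lambda>x. lift x $ 4) (model_dom k)"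
    unfolding lift_def using h by (simp_all add: smooth_on_nth smooth_on_id open_model_dom)
  then show "smooth_on (\<lambda>x. lift x $ i) (model_dom k)" using exhaust_4[of i] by auto
qed

lemma deriv_lift:
  assumes x: "x \<in> model_dom k"
  shows "deriv_along lift x u = join4 u (- (x \<bullet> u) / height x)"
proof -
  have "1 / k - x \<bullet> x > 0" using x by (simp add: model_dom_iff)
  then have h: "(height has_derivative (\<lambda>u. - (x \<bullet> u) / height x)) (at x)"
    unfolding height_def by (auto intro!: derivative_eq_intros simp: inner_commute field_simps)
  have l: "lift = (\<lambda>x. join4 x 0 + height x *\<^sub>R axis 4 1)"
    by (rule ext) (simp add: lift_def vec_eq_iff forall_4 axis_def)
  have "(lift has_derivative (\<lambda>u. join4 u 0 + (- (x \<bullet> u) / height x) *\<^sub>R axis 4 1)) (at x)"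
    unfolding l
    by (intro has_derivative_add has_derivative_scaleR_left h bounded_linear_imp_has_derivative bounded_linear_join4_0)
  from deriv_along_eq[OF this] show ?thesis by (simp add: vec_eq_iff forall_4 axis_def)
qed

lemma deriv_lift_facts:
  assumes x: "x \<in> model_dom k"
  shows "lift x \<bullet> deriv_along lift x u = 0" "vec_part (deriv_along lift x u) = u"
  using height_pos(1)[OF x] by (simp_all add: deriv_lift[OF x] join4_inner lift_def)

lemma model_metric_lift:
  assumes x: "x \<in> model_dom k"
  shows "model_metric k x u v = deriv_along lift x u \<bullet> deriv_along lift x v"
  using model_metric_tangent[OF k lift_facts(1)[OF x] _ deriv_lift_facts(1)[OF x] deriv_lift_facts(1)[OF x], of u v]
    lift_facts(2,3)[OF x] deriv_lift_facts(2)[OF x] by simp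

lemma is_chart_sph_chart:
  assumes q: "q \<bullet> q = 1" shows "is_chart (top_of_set sphere3) (sph_chart q)"
  unfolding is_chart_def
proof (intro conjI)
  note bl = bounded_linear_qmul[THEN linear_continuous_on]
  have c4: "continuous_on A (\<lambda>p. qmul a p $ 4)" for A a
    by (intro continuous_intros bl)
  have "open {p. qmul (qconj q) p $ 4 > 0 \<and> (q = axis 4 1 \<or> p $ 4 < 1 / (2 * sqrt k))}"
    by (intro open_Collect_conj open_Collect_disj open_Collect_less open_Collect_const continuous_intros c4)
  moreover have "sph_dom q = sphere3 \<inter> {p. qmul (qconj q) p $ 4 > 0 \<and> (q = axis 4 1 \<or> p $ 4 < 1 / (2 * sqrt k))}"
    by (auto simp: sph_dom_def)
  ultimately show "openin (top_of_set sphere3) (cdom (sph_chart q))"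
    by (simp add: openin_open_Int)
  have cl: "continuous_on (model_dom k) (\<lambda>x. qmul q (lift x))"
    by (rule continuous_on_compose2[OF bl smooth_on_imp_continuous_on[OF smooth_lift]]) auto
  show op: "open (cimg (sph_chart q))"
  proof (cases "q = axis 4 1")
    case True
    then show ?thesis unfolding cimg_sph_chart[OF q] by (simp add: open_model_dom)
  next
    case False
    have "continuous_on (model_dom k) (\<lambda>x. qmul q (lift x) $ 4)" by (intro continuous_intros cl)
    from continuous_open_preimage[OF this open_model_dom open_lessThan]
    have "open (model_dom k \<inter> (\<lambda>x. qmul q (lift x) $ 4) -` {..<1 / (2 * sqrt k)})" .
    moreover have "model_dom k \<inter> (\<lambda>x. qmul q (lift x) $ 4) -` {..<1 / (2 * sqrt k)}
        = {x \<in> model_dom k. qmul q (lift x) $ 4 < 1 / (2 * sqrt k)}" by auto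
    ultimately have "open {x \<in> model_dom k. qmul q (lift x) $ 4 < 1 / (2 * sqrt k)}" by simp
    then show ?thesis unfolding cimg_sph_chart[OF q] using False by simp
  qed
  have st: "subtopology (top_of_set sphere3) (sph_dom q) = top_of_set (sph_dom q)"
    by (simp add: subtopology_subtopology sph_dom_def Int_absorb1 subset_iff)
  have "homeomorphic_maps (top_of_set (sph_dom q)) (top_of_set (cimg (sph_chart q)))
      (cmap (sph_chart q)) (\<lambda>x. qmul q (lift x))"
    unfolding homeomorphic_maps_def
  proof (intro conjI ballI)
    show "continuous_map (top_of_set (sph_dom q)) (top_of_set (cimg (sph_chart q))) (cmap (sph_chart q))"
      using continuous_on_compose2[OF linear_continuous_on[OF bounded_linear_vec_part] bl subset_UNIV]
      by (auto simp: continuous_map_in_subtopology)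
    have "qmul q (lift x) \<in> sph_dom q" if "x \<in> cimg (sph_chart q)" for x
      using cinv_in_cdom[OF that] cinv_sph_chart[OF q that] by simp
    moreover have "continuous_on (cimg (sph_chart q)) (\<lambda>x. qmul q (lift x))"
      by (rule continuous_on_subset[OF cl]) (auto simp: cimg_sph_chart[OF q] simp del: sph_chart_sel)
    ultimately show "continuous_map (top_of_set (cimg (sph_chart q))) (top_of_set (sph_dom q)) (\<lambda>x. qmul q (lift x))"
      by (auto simp: continuous_map_in_subtopology simp del: sph_chart_sel)
  next
    fix p assume "p \<in> topspace (top_of_set (sph_dom q))"
    then show "qmul q (lift (cmap (sph_chart q) p)) = p" using sph_chart_facts(2)[OF q] by simp
  next
    fix x assume "x \<in> topspace (top_of_set (cimg (sph_chart q)))"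
    then have x: "x \<in> cimg (sph_chart q)" by (simp del: sph_chart_sel)
    show "cmap (sph_chart q) (qmul q (lift x)) = x"
      using cmap_cinv[OF x] cinv_sph_chart[OF q x] by simp
  qed
  then show "homeomorphic_map (subtopology (top_of_set sphere3) (cdom (sph_chart q)))
      (top_of_set (cimg (sph_chart q))) (cmap (sph_chart q))"
    using homeomorphic_map_maps st by (metis sph_chart_sel(1))
qed

text \<open>The vectors \<open>join4 u (- (x \<bullet> u) / y)\<close> are tangent to the sphere at
  height \<open>y\<close>. Projection along the last axis scales oriented tangent volume in
  proportion to the height, so up to the factor \<open>r \<bullet> r\<close> the Jacobian of a
  transition is the quotient of the new height by the old one, and both are positive in the
  charts.\<close>

lemma det_quaternion_chart:
  fixes r :: "real ^ 4"
  assumes y: "y \<noteq> 0"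
  shows "det (matrix (\<lambda>u. vec_part (qmul r (join4 u (- (x \<bullet> u) / y))))) * y = (r \<bullet> r) * qmul r (join4 x y) $ 4"
proof -
  \<comment> \<open>The slopes of the sphere: with x = - s y the quotients disappear and a
    polynomial identity remains.\<close>
  define s where "s i = - (x $ i) / y" for i
  have s: "x $ i = - (s i * y)" for i using y by (simp add: s_def)
  have e: "- (x \<bullet> axis i 1) / y = s i" for i by (simp add: s_def inner_axis)
  show ?thesis
    unfolding det_3 matrix_def vec_lambda_beta e
    by (simp add: qmul_def inner_4 s) (simp add: axis_def algebra_simps)
qed

text \<open>In the ambient space a transition is left multiplication by \<open>r\<close>, a linear
  map, so only \<open>lift\<close> contributes a nontrivial derivative.\<close>

lemma sph_transition:
  assumes q: "q \<bullet> q = 1" and q': "q' \<bullet> q' = 1"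
    and x: "x \<in> cmap (sph_chart q) ` (sph_dom q \<inter> sph_dom q')"
  defines "r \<equiv> qmul (qconj q') q"
  shows "deriv_along (transition (sph_chart q) (sph_chart q')) x u = vec_part (qmul r (deriv_along lift x u))"
    and "transition (sph_chart q) (sph_chart q') x = vec_part (qmul r (lift x))"
    and "x \<in> model_dom k" "qmul r (lift x) $ 4 > 0" "qmul r (lift x) \<in> sphere3"
    and "smooth_on (transition (sph_chart q) (sph_chart q')) (cmap (sph_chart q) ` (sph_dom q \<inter> sph_dom q'))"
proof -
  define W where "W = cmap (sph_chart q) ` (sph_dom q \<inter> sph_dom q')"
  have W: "open W"
    unfolding W_def
    by (rule chart_open_image[OF is_chart_sph_chart[OF q]])
      (use openin_Int[OF chart_open(1)[OF is_chart_sph_chart[OF q]] chart_open(1)[OF is_chart_sph_chart[OF q']]] in simp_all)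
  have Wi: "W \<subseteq> cimg (sph_chart q)" by (auto simp: W_def)
  then have Wd: "W \<subseteq> model_dom k" unfolding cimg_sph_chart[OF q] by blast
  have t: "transition (sph_chart q) (sph_chart q') y = vec_part (qmul r (lift y))" if "y \<in> W" for y
    using cinv_sph_chart[OF q, of y] that Wi by (auto simp: transition_def r_def qmul_assoc simp del: sph_chart_sel(1))
  have smr: "smooth_on (\<lambda>y. vec_part (qmul r (lift y))) W"
    by (intro smooth_on_linear_compose[OF bounded_linear_vec_part] smooth_on_linear_compose[OF bounded_linear_qmul]
        smooth_on_subset[OF smooth_lift Wd] W)
  have xW: "x \<in> W" using x by (simp add: W_def)
  show "x \<in> model_dom k" using xW Wd by blast
  show "transition (sph_chart q) (sph_chart q') x = vec_part (qmul r (lift x))" by (rule t[OF xW])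
  have ld: "lift differentiable (at x)" by (rule smooth_on_differentiable[OF smooth_lift]) (use xW Wd in blast)
  have "deriv_along (transition (sph_chart q) (sph_chart q')) x u = deriv_along (\<lambda>y. vec_part (qmul r (lift y))) x u"
    by (rule deriv_along_cong[OF W xW t])
  also have "\<dots> = vec_part (qmul r (deriv_along lift x u))"
    by (rule deriv_along_linear_compose[OF bounded_linear_compose[OF bounded_linear_vec_part bounded_linear_qmul] ld])
  finally show "deriv_along (transition (sph_chart q) (sph_chart q')) x u = vec_part (qmul r (deriv_along lift x u))" .
  obtain p where p: "p \<in> sph_dom q" "p \<in> sph_dom q'" "x = vec_part (qmul (qconj q) p)" using x by auto
  have "qmul r (lift x) = qmul (qconj q') p"
    unfolding p(3) r_def qmul_assoc[symmetric] sph_chart_facts(2)[OF q p(1)] ..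
  then show "qmul r (lift x) $ 4 > 0" "qmul r (lift x) \<in> sphere3"
    using p(2) qmul_sphere3[of "qconj q'" p] q' by (auto simp: sph_dom_def)
  show "smooth_on (transition (sph_chart q) (sph_chart q')) (cmap (sph_chart q) ` (sph_dom q \<inter> sph_dom q'))"
    using smooth_on_cong[OF W smr] t unfolding W_def by metis
qed

lemma unit_quotient: "q \<bullet> q = 1 \<Longrightarrow> q' \<bullet> q' = 1 \<Longrightarrow> qmul (qconj q') q \<bullet> qmul (qconj q') q = 1"
  by (simp add: qmul_inner)

lemma riemannian_manifold_sphere_model: "riemannian_manifold sphere_model"
proof -
  let ?A = "sph_chart ` {q. q \<bullet> q = 1}"
  have "sphere3 = sphere 0 (1 / sqrt k)"
  proof -
    have "p \<bullet> p = 1 / k \<longleftrightarrow> norm p = sqrt (1 / k)" for p :: "real ^ 4"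
      unfolding norm_eq_sqrt_inner by simp
    moreover have "sqrt (1 / k) = 1 / sqrt k" by (simp add: real_sqrt_divide)
    ultimately show ?thesis unfolding sphere3_def sphere_def dist_0_norm by simp
  qed
  moreover have "connected (sphere (0 :: real ^ 4) (1 / sqrt k))"
    by (rule connected_sphere) simp
  ultimately have conn: "connected sphere3" by simp
  have "join4 0 (1 / sqrt k) \<in> sphere3" using k by (simp add: sphere3_def join4_inner)
  then have ne: "sphere3 \<noteq> {}" by blast
  have cover: "(\<Union>c\<in>?A. cdom c) = sphere3"
  proof (intro equalityI subsetI)
    fix p assume p: "p \<in> sphere3"
    show "p \<in> (\<Union>c\<in>?A. cdom c)"
    proof (cases "p $ 4 < 1 / (2 * sqrt k)")
      case True
      \<comment> \<open>The unit quaternion in the direction of \<open>p\<close>; multiplication by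
        its conjugate moves \<open>p\<close> to the pole, the centre of its chart.\<close>
      define q where "q = sqrt k *\<^sub>R p"
      have q: "q \<bullet> q = 1" using p k by (simp add: q_def sphere3_def)
      have "qmul (qconj q) p $ 4 = sqrt k * (p \<bullet> p)"
        by (simp add: q_def qmul_def qconj_def inner_4 algebra_simps)
      also have "\<dots> > 0" using p k by (simp add: sphere3_def)
      finally have "p \<in> sph_dom q" using p True by (simp add: sph_dom_def)
      then show ?thesis using q by auto
    next
      case False
      moreover have "1 / (2 * sqrt k) > 0" using k by simp
      ultimately have "p $ 4 > 0" by linarith
      then have "p \<in> sph_dom (axis 4 1)" using p by (simp add: sph_dom_def qmul_one)
      then show ?thesis by (intro UN_I[of "sph_chart (axis 4 1)"]) (auto simp: inner_axis)
    qed
  qed (auto simp: sph_dom_def)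
  have atlas: "oriented_smooth_atlas (top_of_set sphere3) ?A"
    unfolding oriented_smooth_atlas_def
  proof (intro conjI ballI)
    show "is_chart (top_of_set sphere3) c" if "c \<in> ?A" for c using that is_chart_sph_chart by blast
    show "(\<Union>c\<in>?A. cdom c) = topspace (top_of_set sphere3)" using cover by simp
    fix c c' assume "c \<in> ?A" "c' \<in> ?A"
    then obtain q q' where q: "c = sph_chart q" "q \<bullet> q = 1" and q': "c' = sph_chart q'" "q' \<bullet> q' = 1" by blast
    note st = sph_transition[OF q(2) q'(2)]
    show "smooth_on (transition c c') (cmap c ` (cdom c \<inter> cdom c'))"
    proof (cases "cmap c ` (cdom c \<inter> cdom c') = {}")
      case False
      then obtain x where "x \<in> cmap c ` (cdom c \<inter> cdom c')" by blast
      then show ?thesis using st(6) unfolding q(1) q'(1) sph_chart_sel(1) by blast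
    qed simp
    fix x assume "x \<in> cmap c ` (cdom c \<inter> cdom c')"
    then have x: "x \<in> cmap (sph_chart q) ` (sph_dom q \<inter> sph_dom q')" by (simp add: q q')
    define r where "r = qmul (qconj q') q"
    have r: "r \<bullet> r = 1" unfolding r_def by (rule unit_quotient[OF q(2) q'(2)])
    have h: "height x > 0" by (rule height_pos(1)[OF st(3)[OF x]])
    have "deriv_along (transition c c') x = (\<lambda>u. vec_part (qmul r (join4 u (- (x \<bullet> u) / height x))))"
      unfolding q(1) q'(1) by (rule ext) (simp add: st(1)[OF x] deriv_lift[OF st(3)[OF x]] r_def)
    then have "det (matrix (deriv_along (transition c c') x)) * height x = qmul r (lift x) $ 4"
      using det_quaternion_chart[of "height x" r x] h r by (simp add: lift_def)
    also have "\<dots> > 0" using st(4)[OF x] by (simp add: r_def)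
    finally show "det (matrix (deriv_along (transition c c') x)) > 0"
      using h by (simp add: zero_less_mult_iff)
  qed
  have "riemannian_metric ?A (\<lambda>_. model_metric k)"
  proof (rule riemannian_metric_model)
    show "cimg c \<subseteq> model_dom k" if "c \<in> ?A" for c
      using that cimg_sph_chart by blast
    fix c c' x u v assume "c \<in> ?A" "c' \<in> ?A" and x: "x \<in> cmap c ` (cdom c \<inter> cdom c')"
    then obtain q q' where q: "c = sph_chart q" "q \<bullet> q = 1" and q': "c' = sph_chart q'" "q' \<bullet> q' = 1" by blast
    have x: "x \<in> cmap (sph_chart q) ` (sph_dom q \<inter> sph_dom q')" using x by (simp add: q q')
    note st = sph_transition[OF q(2) q'(2) x]
    define r where "r = qmul (qconj q') q"
    have r: "r \<bullet> r = 1" unfolding r_def by (rule unit_quotient[OF q(2) q'(2)])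
    have "model_metric k (vec_part (qmul r (lift x))) (vec_part (qmul r (deriv_along lift x u))) (vec_part (qmul r (deriv_along lift x v)))
        = qmul r (deriv_along lift x u) \<bullet> qmul r (deriv_along lift x v)"
      by (rule model_metric_tangent[OF k])
        (use st(4,5) deriv_lift_facts(1)[OF st(3)] in \<open>auto simp: r_def[symmetric] sphere3_def qmul_inner\<close>)
    also have "\<dots> = model_metric k x u v" unfolding qmul_inner r model_metric_lift[OF st(3)] by simp
    finally show "model_metric k x u v = model_metric k (transition c c' x)
          (deriv_along (transition c c') x u) (deriv_along (transition c c') x v)"
      unfolding q(1) q'(1) st(1,2) r_def by simp
  qed
  then show ?thesis
    unfolding riemannian_manifold_def sphere_model_def
    using Hausdorff_second_countable_euclidean_subset[of sphere3] atlas conn ne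
    by (auto simp: connected_space_subtopology)
qed

text \<open>The geodesics are great circles. In the ambient space such a curve is a combination of
  \<open>p\<close> and its velocity \<open>w\<close>, and every chart is the restriction of a linear
  map, so one computation covers all charts that the curve meets.\<close>

lemma geodesically_complete_sphere_model: "geodesically_complete sphere_model"
  unfolding geodesically_complete_def
proof (intro ballI allI)
  fix c p u assume "c \<in> atlas sphere_model" "p \<in> cdom c"
  then obtain q where c: "c = sph_chart q" and q: "q \<bullet> q = 1" and p: "p \<in> sph_dom q"
    by (auto simp: sphere_model_def)
  define x where "x = vec_part (qmul (qconj q) p)"
  note f = sph_chart_facts[OF q p, folded x_def]
  define w where "w = qmul q (deriv_along lift x u)"
  have pS: "p \<bullet> p = 1 / k" using p by (simp add: sph_dom_def sphere3_def)
  have "p \<bullet> w = qmul q (lift x) \<bullet> qmul q (deriv_along lift x u)" unfolding f(2) w_def ..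
  then have pw: "p \<bullet> w = 0" using deriv_lift_facts(1)[OF f(1)] by (simp add: qmul_inner)
  \<comment> \<open>The squared angular speed on the sphere of radius 1 / sqrt k.\<close>
  define a where "a = k * (w \<bullet> w)"
  define \<gamma> where "\<gamma> t = tcos a t *\<^sub>R p + tsin a t *\<^sub>R w" for t
  define \<gamma>' where "\<gamma>' t = tcos a t *\<^sub>R w - (a * tsin a t) *\<^sub>R p" for t
  have cs: "(tcos a t)\<^sup>2 + a * (tsin a t)\<^sup>2 = 1" for t by (rule tcos_tsin)
  have \<gamma>\<gamma>: "\<gamma> t \<bullet> \<gamma> t = 1 / k" for t
  proof -
    have "\<gamma> t \<bullet> \<gamma> t = (tcos a t)\<^sup>2 * (1 / k) + (tsin a t)\<^sup>2 * (w \<bullet> w)"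
      unfolding \<gamma>_def using pw pS by (simp add: inner_simps inner_commute[of w p] power2_eq_square algebra_simps)
    also have "\<dots> = ((tcos a t)\<^sup>2 + a * (tsin a t)\<^sup>2) * (1 / k)" using k by (simp add: a_def field_simps)
    finally show ?thesis unfolding cs by simp
  qed
  have \<gamma>\<gamma>': "\<gamma> t \<bullet> \<gamma>' t = 0" for t
  proof -
    have "\<gamma> t \<bullet> \<gamma>' t = tcos a t * tsin a t * (w \<bullet> w - a * (1 / k))"
      unfolding \<gamma>_def \<gamma>'_def using pw pS by (simp add: inner_simps inner_commute[of w p] algebra_simps)
    also have "\<dots> = 0" using k by (simp add: a_def)
    finally show ?thesis .
  qed
  have speed: "\<gamma>' t \<bullet> \<gamma>' t = w \<bullet> w" for t
  proof -
    have "\<gamma>' t \<bullet> \<gamma>' t = (tcos a t)\<^sup>2 * (w \<bullet> w) + a * (a * (1 / k)) * (tsin a t)\<^sup>2"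
      unfolding \<gamma>'_def using pw pS by (simp add: inner_simps inner_commute[of w p] power2_eq_square algebra_simps)
    also have "a * (1 / k) = w \<bullet> w" using k by (simp add: a_def)
    finally have "\<gamma>' t \<bullet> \<gamma>' t = ((tcos a t)\<^sup>2 + a * (tsin a t)\<^sup>2) * (w \<bullet> w)" by (simp add: algebra_simps)
    then show ?thesis unfolding cs by simp
  qed
  define L where "L q' p = vec_part (qmul (qconj q') p)" for q' p
  have L: "linear (L q')" for q'
    unfolding L_def using linear_compose[OF qmul_linear vec_part_linear] by (simp add: o_def)
  have cm: "cmap (sph_chart q') \<circ> \<gamma> = (\<lambda>t. tcos a t *\<^sub>R L q' p + tsin a t *\<^sub>R L q' w)" for q'
    by (rule ext) (simp add: \<gamma>_def L_def[symmetric] linear_add[OF L] linear_scale[OF L])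
  have cm1: "vector_derivative (cmap (sph_chart q') \<circ> \<gamma>) (at t) = tcos a t *\<^sub>R L q' w - (a * tsin a t) *\<^sub>R L q' p" for q' t
    unfolding cm by (rule vector_derivative_tcos_tsin)
  have cm1': "tcos a t *\<^sub>R L q' w - (a * tsin a t) *\<^sub>R L q' p = L q' (\<gamma>' t)" for q' t
    by (simp add: \<gamma>'_def linear_diff[OF L] linear_scale[OF L])
  have cm2: "vector_derivative (\<lambda>s. vector_derivative (cmap (sph_chart q') \<circ> \<gamma>) (at s)) (at t) = - a *\<^sub>R L q' (\<gamma> t)" for q' t
    unfolding cm1 by (subst vector_derivative_tcos_tsin) (simp add: \<gamma>_def linear_add[OF L] linear_scale[OF L])
  \<comment> \<open>By linearity of \<open>L q'\<close> the curve in the chart has acceleration - a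
    times its position, which the radial Christoffel term cancels.\<close>
  have geod: "vector_derivative (\<lambda>s. vector_derivative (cmap (sph_chart q') \<circ> \<gamma>) (at s)) (at t)
      + christoffel (model_metric k) (L q' (\<gamma> t)) (vector_derivative (cmap (sph_chart q') \<circ> \<gamma>) (at t))
          (vector_derivative (cmap (sph_chart q') \<circ> \<gamma>) (at t)) = 0"
    if q': "q' \<bullet> q' = 1" and t: "\<gamma> t \<in> sph_dom q'" for q' t
  proof -
    have d: "L q' (\<gamma> t) \<in> model_dom k" unfolding L_def by (rule sph_chart_facts(1)[OF q' t])
    have "model_metric k (L q' (\<gamma> t)) (L q' (\<gamma>' t)) (L q' (\<gamma>' t)) = qmul (qconj q') (\<gamma>' t) \<bullet> qmul (qconj q') (\<gamma>' t)"
      unfolding L_def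
      by (rule model_metric_tangent[OF k])
        (use t \<gamma>\<gamma>' q' in \<open>auto simp: sph_dom_def sphere3_def qmul_inner\<close>)
    also have "\<dots> = w \<bullet> w" using q' by (simp add: qmul_inner speed)
    finally have m: "model_metric k (L q' (\<gamma> t)) (L q' (\<gamma>' t)) (L q' (\<gamma>' t)) = w \<bullet> w" .
    show ?thesis
      unfolding cm2 unfolding cm1 cm1' christoffel_model[OF d] m by (simp add: a_def)
  qed
  have sm: "smooth_on \<gamma> UNIV" unfolding \<gamma>_def[abs_def] by (rule smooth_tcos_tsin_curve) simp
  have cont: "continuous_map euclideanreal (top_of_set sphere3) \<gamma>"
    using smooth_on_imp_continuous_on[OF sm] \<gamma>\<gamma> by (auto simp: continuous_map_in_subtopology sphere3_def)
  show "\<exists>\<gamma>. complete_geodesic sphere_model \<gamma> \<and> \<gamma> 0 = p \<and> vector_derivative (cmap c \<circ> \<gamma>) (at 0) = u"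
  proof (intro exI[of _ \<gamma>] conjI)
    show "\<gamma> 0 = p" by (simp add: \<gamma>_def)
    show "vector_derivative (cmap c \<circ> \<gamma>) (at 0) = u"
      unfolding c cm1 using deriv_lift_facts(2)[OF f(1)] q
      by (simp add: L_def w_def qmul_qconj)
    show "complete_geodesic sphere_model \<gamma>"
      unfolding complete_geodesic_def
    proof (intro conjI ballI allI impI)
      show "continuous_map euclideanreal (mtop sphere_model) \<gamma>" using cont by (simp add: sphere_model_def)
      fix c' assume "c' \<in> atlas sphere_model"
      then obtain q' where c': "c' = sph_chart q'" and q': "q' \<bullet> q' = 1" by (auto simp: sphere_model_def)
      show "smooth_on (cmap c' \<circ> \<gamma>) {t. \<gamma> t \<in> cdom c'}"
        unfolding c' cm by (rule smooth_on_subset[OF smooth_tcos_tsin_curve[OF open_UNIV]]) simp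
      fix t assume "\<gamma> t \<in> cdom c'"
      then have t: "\<gamma> t \<in> sph_dom q'" by (simp add: c')
      show "vector_derivative (\<lambda>s. vector_derivative (cmap c' \<circ> \<gamma>) (at s)) (at t) +
          christoffel (metric sphere_model c') (cmap c' (\<gamma> t)) (vector_derivative (cmap c' \<circ> \<gamma>) (at t))
            (vector_derivative (cmap c' \<circ> \<gamma>) (at t)) = 0"
        using geod[OF q' t] unfolding c' by (simp add: sphere_model_def L_def)
    qed
  qed
qed

lemma space_form_sphere_model: "space_form sphere_model k"
  unfolding space_form_def
proof (intro conjI riemannian_manifold_sphere_model geodesically_complete_sphere_model constant_curvature_model)
  show "metric sphere_model = (\<lambda>_. model_metric k)" by (simp add: sphere_model_def)
  show "cimg c \<subseteq> model_dom k" if "c \<in> atlas sphere_model" for c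
    using that cimg_sph_chart unfolding sphere_model_def by (auto simp del: sph_chart_sel)
qed

text \<open>The cut-off in \<open>sph_dom\<close> keeps all other charts strictly below the height 1
  / (2 sqrt k), while |x| < 1 / (2 sqrt k) gives the lift of \<open>x\<close> at least this height.
  So claims about all charts reduce to one.\<close>

lemma sphere_model_near_pole:
  "\<exists>e\<in>atlas sphere_model. \<exists>\<delta>>0. cimg e = model_dom k \<and>
    (\<forall>x\<in>ball 0 \<delta>. \<forall>e'\<in>atlas sphere_model. cinv e x \<in> cdom e' \<longrightarrow> e' = e)"
proof (intro bexI[of _ "sph_chart (axis 4 1)"] exI[of _ "1 / (2 * sqrt k)"] conjI ballI impI)
  have one: "axis 4 1 \<bullet> (axis 4 1 :: real ^ 4) = 1" by (simp add: inner_axis)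
  show "sph_chart (axis 4 1) \<in> atlas sphere_model" using one by (simp add: sphere_model_def)
  show "1 / (2 * sqrt k) > 0" using k by simp
  show ci: "cimg (sph_chart (axis 4 1)) = model_dom k" unfolding cimg_sph_chart[OF one] by simp
  fix x e' assume x: "x \<in> ball 0 (1 / (2 * sqrt k))" and e': "e' \<in> atlas sphere_model"
    and c: "cinv (sph_chart (axis 4 1)) x \<in> cdom e'"
  obtain q where q: "e' = sph_chart q" "q \<bullet> q = 1" using e' by (auto simp: sphere_model_def)
  have "norm x < 1 / (2 * sqrt k)" using x by simp
  then have "(norm x)\<^sup>2 < (1 / (2 * sqrt k))\<^sup>2" by (intro power_strict_mono) auto
  then have xx: "x \<bullet> x < 1 / (4 * k)" using k by (simp add: power2_norm_eq_inner power_divide power_mult_distrib)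
  then have xd: "x \<in> model_dom k" using k by (simp add: model_dom_def field_simps)
  have "(1 / (2 * sqrt k))\<^sup>2 \<le> 1 / k - x \<bullet> x" using xx k by (simp add: power_divide power_mult_distrib field_simps)
  then have "1 / (2 * sqrt k) \<le> height x" unfolding height_def by (rule real_le_rsqrt)
  moreover have "cinv (sph_chart (axis 4 1)) x = lift x"
    using cinv_sph_chart[OF one, of x] ci xd by (simp add: qmul_one del: sph_chart_sel)
  ultimately have "\<not> cinv (sph_chart (axis 4 1)) x $ 4 < 1 / (2 * sqrt k)" by (simp add: lift_def)
  then have "q = axis 4 1" using c unfolding q(1) by (simp add: sph_dom_def)
  then show "e' = sph_chart (axis 4 1)" using q(1) by simp
qed

end

theorem space_form_model_exists:
  obtains Q :: "(real ^ 4, 3) riem_mfd" and e \<delta> where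
    "space_form Q k" "metric Q = (\<lambda>_. model_metric k)" "e \<in> atlas Q" "cimg e = model_dom k" "\<delta> > 0"
    "\<And>x e'. x \<in> ball 0 \<delta> \<Longrightarrow> e' \<in> atlas Q \<Longrightarrow> cinv e x \<in> cdom e' \<Longrightarrow> e' = e"
proof (cases "k > 0")
  case True
  obtain e \<delta> where "e \<in> atlas (sphere_model k)" "\<delta> > 0" "cimg e = model_dom k"
    "\<forall>x\<in>ball 0 \<delta>. \<forall>e'\<in>atlas (sphere_model k). cinv e x \<in> cdom e' \<longrightarrow> e' = e"
    using sphere_model_near_pole[OF True] by blast
  moreover have "metric (sphere_model k) = (\<lambda>_. model_metric k)"
    by (simp add: sphere_model_def[OF True])
  ultimately show ?thesis
    using that[OF space_form_sphere_model[OF True], of e \<delta>] by blast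
next
  case False
  then have k: "k \<le> 0" by simp
  have "cimg global_chart = model_dom k"
    by (simp add: global_chart_def model_dom_UNIV[OF k] vec_part_hyperplane4)
  \<comment> \<open>There is only one chart, so any positive radius will do.\<close>
  then show ?thesis
    using that[of "global_model k" global_chart 1] space_form_global_model[OF k] by (simp add: global_model_def)
qed

section \<open>Flat surfaces with constant principal curvatures in the model metrics\<close>

lemma local_metric_euclidean: "local_metric (\<lambda>_. (\<bullet>)) (UNIV :: (real ^ 'n::finite) set)"
  by unfold_locales (auto simp: bilinear_def inner_commute smooth_on_const intro!: linearI inner_simps)

lemma christoffel_euclidean: "christoffel (\<lambda>_. (\<bullet>)) x u v = (0 :: real ^ 'n::finite)"
proof -
  interpret local_metric "\<lambda>_. (\<bullet>)" "UNIV :: (real ^ 'n) set" by (rule local_metric_euclidean)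
  show ?thesis by (rule christoffel_unique) (simp_all add: koszul_def)
qed

text \<open>A torus, a cylinder or an equidistant tube around a geodesic, in the model of curvature
  \<open>k = - k1 * k2\<close>. In ambient coordinates it solves \<open>P\<^sub>s\<^sub>s = - k P + k1 \<nu>\<close>, \<open>P\<^sub>t\<^sub>t = - k P + k2 \<nu>\<close>,
  \<open>P\<^sub>s\<^sub>t = 0\<close>, \<open>\<nu>\<^sub>s = - k1 P\<^sub>s\<close>, \<open>\<nu>\<^sub>t = - k2 P\<^sub>t\<close>, starting at the pole; \<open>tube_map\<close> is the projected
  part of \<open>P\<close> and \<open>tube_height\<close> the remaining coordinate. The constants \<open>al\<close>, \<open>be\<close> are the squared
  curvatures of the parameter lines in the ambient space.\<close>

locale tube =
  fixes k1 k2 :: real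
begin

definition kap :: real where "kap = - (k1 * k2)"
definition al :: real where "al = k1\<^sup>2 + kap"
definition be :: real where "be = k2\<^sup>2 + kap"

definition tube_map :: "real ^ 2 \<Rightarrow> real ^ 3" where
  "tube_map z = vector [tsin al (z $ 1), tsin be (z $ 2), k1 * tvers al (z $ 1) + k2 * tvers be (z $ 2)]"

definition tube_normal :: "real ^ 2 \<Rightarrow> real ^ 3" where
  "tube_normal z = vector [- k1 * tsin al (z $ 1), - k2 * tsin be (z $ 2),
     1 - k1\<^sup>2 * tvers al (z $ 1) - k2\<^sup>2 * tvers be (z $ 2)]"

definition tube_height :: "real ^ 2 \<Rightarrow> real" where
  "tube_height z = 1 - kap * (tvers al (z $ 1) + tvers be (z $ 2))"

definition tube_s :: "real ^ 2 \<Rightarrow> real ^ 3" where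
  "tube_s z = vector [tcos al (z $ 1), 0, k1 * tsin al (z $ 1)]"

definition tube_t :: "real ^ 2 \<Rightarrow> real ^ 3" where
  "tube_t z = vector [0, tcos be (z $ 2), k2 * tsin be (z $ 2)]"

text \<open>Give the height coordinate of the ambient space the weight 1 / kap. There the vectors
  whose projections are \<open>tube_s\<close>, \<open>tube_t\<close>, \<open>tube_normal\<close> are
  orthonormal and orthogonal to the position, and their heights are - kap times
  \<open>tsin al\<close>, - kap times \<open>tsin be\<close>, and \<open>kap * p\<close>. The
  products here are what remains without the height coordinate; in this form they also make sense
  for kap = 0.\<close>

lemma tube_inner:
  fixes z :: "real ^ 2"
  defines "p \<equiv> k1 * tvers al (z $ 1) + k2 * tvers be (z $ 2)"
  shows "1 - kap * (tube_map z \<bullet> tube_map z) = (tube_height z)\<^sup>2"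
    and "tube_map z \<bullet> tube_s z = tube_height z * tsin al (z $ 1)"
    and "tube_map z \<bullet> tube_t z = tube_height z * tsin be (z $ 2)"
    and "tube_map z \<bullet> tube_normal z = - (tube_height z * p)"
    and "tube_s z \<bullet> tube_s z = 1 - kap * (tsin al (z $ 1))\<^sup>2"
    and "tube_t z \<bullet> tube_t z = 1 - kap * (tsin be (z $ 2))\<^sup>2"
    and "tube_s z \<bullet> tube_t z = - kap * (tsin al (z $ 1) * tsin be (z $ 2))"
    and "tube_normal z \<bullet> tube_normal z = 1 - kap * p\<^sup>2"
    and "tube_s z \<bullet> tube_normal z = kap * (tsin al (z $ 1) * p)"
    and "tube_t z \<bullet> tube_normal z = kap * (tsin be (z $ 2) * p)"
    and "det (vector [tube_s z, tube_t z, tube_normal z] :: real ^ 3 ^ 3) = tube_height z"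
proof -
  define A B S T where "A = tvers al (z $ 1)" "B = tvers be (z $ 2)" "S = tsin al (z $ 1)" "T = tsin be (z $ 2)"
  note d = A_B_S_T_def[symmetric]
  \<comment> \<open>This relation and the next one link the four functions; modulo them each claim
    is a polynomial identity.\<close>
  have S: "S * S = 2 * A - (k1 * k1 - k1 * k2) * A * A"
    using tsin_square[of al "z $ 1"] unfolding d by (simp add: al_def kap_def power2_eq_square)
  have T: "T * T = 2 * B - (k2 * k2 - k1 * k2) * B * B"
    using tsin_square[of be "z $ 2"] unfolding d by (simp add: be_def kap_def power2_eq_square)
  note defs = tube_map_def tube_normal_def tube_height_def tube_s_def tube_t_def inner_3 tcos_eq p_def d vector_3
  have k: "al = k1 * k1 - k1 * k2" "be = k2 * k2 - k1 * k2" "kap = - (k1 * k2)"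
    by (simp_all add: al_def be_def kap_def power2_eq_square)
  show "1 - kap * (tube_map z \<bullet> tube_map z) = (tube_height z)\<^sup>2"
    unfolding defs unfolding k power2_eq_square using S T by algebra
  show "tube_map z \<bullet> tube_s z = tube_height z * tsin al (z $ 1)"
    unfolding defs unfolding k power2_eq_square by (simp add: algebra_simps)
  show "tube_map z \<bullet> tube_t z = tube_height z * tsin be (z $ 2)"
    unfolding defs unfolding k power2_eq_square by (simp add: algebra_simps)
  show "tube_map z \<bullet> tube_normal z = - (tube_height z * p)"
    unfolding defs unfolding k power2_eq_square using S T by algebra
  show "tube_s z \<bullet> tube_s z = 1 - kap * (tsin al (z $ 1))\<^sup>2"
    unfolding defs unfolding k power2_eq_square using S T by algebra
  show "tube_t z \<bullet> tube_t z = 1 - kap * (tsin be (z $ 2))\<^sup>2"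
    unfolding defs unfolding k power2_eq_square using S T by algebra
  show "tube_s z \<bullet> tube_t z = - kap * (tsin al (z $ 1) * tsin be (z $ 2))"
    unfolding defs unfolding k power2_eq_square by (simp add: algebra_simps)
  show "tube_normal z \<bullet> tube_normal z = 1 - kap * p\<^sup>2"
    unfolding defs unfolding k power2_eq_square using S T by algebra
  show "tube_s z \<bullet> tube_normal z = kap * (tsin al (z $ 1) * p)"
    unfolding defs unfolding k power2_eq_square by (simp add: algebra_simps)
  show "tube_t z \<bullet> tube_normal z = kap * (tsin be (z $ 2) * p)"
    unfolding defs unfolding k power2_eq_square by (simp add: algebra_simps)
  show "det (vector [tube_s z, tube_t z, tube_normal z] :: real ^ 3 ^ 3) = tube_height z"
    unfolding defs det_3 unfolding k power2_eq_square using S T by algebra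
qed

text \<open>The denominator of \<open>model_metric\<close> is the square of the height, which
  cancels against the factors in \<open>tube_inner\<close>; the correction term then restores
  exactly what the Euclidean products lack.\<close>

lemma tube_metric:
  assumes y: "tube_height z > 0"
  shows "tube_map z \<in> model_dom kap"
    and "model_metric kap (tube_map z) (tube_s z) (tube_s z) = 1"
    and "model_metric kap (tube_map z) (tube_t z) (tube_t z) = 1"
    and "model_metric kap (tube_map z) (tube_s z) (tube_t z) = 0"
    and "model_metric kap (tube_map z) (tube_s z) (tube_normal z) = 0"
    and "model_metric kap (tube_map z) (tube_t z) (tube_normal z) = 0"
    and "model_metric kap (tube_map z) (tube_normal z) (tube_normal z) = 1"
proof -
  have "(tube_height z)\<^sup>2 > 0" using y by simp
  then show "tube_map z \<in> model_dom kap"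
    using tube_inner(1)[of z] unfolding model_dom_def mem_Collect_eq by linarith
  show "model_metric kap (tube_map z) (tube_s z) (tube_s z) = 1"
    "model_metric kap (tube_map z) (tube_t z) (tube_t z) = 1"
    "model_metric kap (tube_map z) (tube_s z) (tube_t z) = 0"
    "model_metric kap (tube_map z) (tube_s z) (tube_normal z) = 0"
    "model_metric kap (tube_map z) (tube_t z) (tube_normal z) = 0"
    "model_metric kap (tube_map z) (tube_normal z) (tube_normal z) = 1"
    unfolding model_metric_def tube_inner using y by (simp_all add: power2_eq_square)
qed

lemma vector3_expand: "(vector [p, q, r] :: real ^ 3) = p *\<^sub>R axis 1 1 + q *\<^sub>R axis 2 1 + r *\<^sub>R axis 3 1"
  by (simp add: vec_eq_iff forall_3 axis_def)

lemma has_derivative_vector3: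
  assumes "(p has_derivative p') F" "(q has_derivative q') F" "(r has_derivative r') F"
  shows "((\<lambda>z. vector [p z, q z, r z] :: real ^ 3) has_derivative (\<lambda>h. vector [p' h, q' h, r' h])) F"
  unfolding vector3_expand by (intro has_derivative_add has_derivative_scaleR_left assms)

lemma has_derivative_nth_compose:
  fixes z :: "real ^ 2"
  assumes "\<And>t. (\<phi> has_real_derivative \<phi>' t) (at t)"
  shows "((\<lambda>z. \<phi> (z $ i)) has_derivative (\<lambda>h. h $ i * \<phi>' (z $ i))) (at z)"
proof -
  have "((\<lambda>z. z $ i) has_derivative (\<lambda>h. h $ i)) (at z)"
    by (rule bounded_linear_imp_has_derivative[OF bounded_linear_vec_nth])
  from has_derivative_compose[OF this assms[unfolded has_field_derivative_def]]
  show ?thesis by (simp add: mult.commute)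
qed

lemmas tube_derivs = has_derivative_nth_compose[OF has_derivative_tsin] has_derivative_nth_compose[OF has_derivative_tcos]
  has_derivative_nth_compose[OF has_derivative_tvers]

lemma deriv_tube_map: "(tube_map has_derivative (\<lambda>h. h $ 1 *\<^sub>R tube_s z + h $ 2 *\<^sub>R tube_t z)) (at z)"
  unfolding tube_map_def[abs_def]
  by (rule has_derivative_eq_rhs[OF has_derivative_vector3[OF tube_derivs(1) tube_derivs(1)
        has_derivative_add[OF has_derivative_mult_right[OF tube_derivs(3)] has_derivative_mult_right[OF tube_derivs(3)]]]])
    (auto simp: fun_eq_iff vec_eq_iff forall_3 tube_s_def tube_t_def algebra_simps)

lemma deriv_along_tube_map: "deriv_along tube_map z u = u $ 1 *\<^sub>R tube_s z + u $ 2 *\<^sub>R tube_t z"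
  by (rule deriv_along_eq[OF deriv_tube_map])

text \<open>The second-order equations of the ambient surface, projected. Since the induced metric
  is \<open>u \<bullet> v\<close>, the second summand on the left is the Christoffel term of the
  model, so the right side is the second fundamental form.\<close>

lemma deriv2_tube_map:
  "deriv2_along tube_map z u v + (kap * (u \<bullet> v)) *\<^sub>R tube_map z
    = (k1 * (u $ 1 * v $ 1) + k2 * (u $ 2 * v $ 2)) *\<^sub>R tube_normal z"
proof -
  have s: "(tube_s has_derivative (\<lambda>h. h $ 1 *\<^sub>R vector [- al * tsin al (z $ 1), 0, k1 * tcos al (z $ 1)])) (at z)"
    unfolding tube_s_def[abs_def]
    by (rule has_derivative_eq_rhs[OF has_derivative_vector3[OF tube_derivs(2) has_derivative_const
          has_derivative_mult_right[OF tube_derivs(1)]]])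
      (auto simp: fun_eq_iff vec_eq_iff forall_3 algebra_simps)
  have t: "(tube_t has_derivative (\<lambda>h. h $ 2 *\<^sub>R vector [0, - be * tsin be (z $ 2), k2 * tcos be (z $ 2)])) (at z)"
    unfolding tube_t_def[abs_def]
    by (rule has_derivative_eq_rhs[OF has_derivative_vector3[OF has_derivative_const tube_derivs(2)
          has_derivative_mult_right[OF tube_derivs(1)]]])
      (auto simp: fun_eq_iff vec_eq_iff forall_3 algebra_simps)
  have "deriv2_along tube_map z u v
      = v $ 1 *\<^sub>R (u $ 1 *\<^sub>R vector [- al * tsin al (z $ 1), 0, k1 * tcos al (z $ 1)])
        + v $ 2 *\<^sub>R (u $ 2 *\<^sub>R vector [0, - be * tsin be (z $ 2), k2 * tcos be (z $ 2)])"
    unfolding deriv_along_tube_map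
    by (rule deriv_along_eq) (intro has_derivative_add has_derivative_scaleR_right s t)
  then show ?thesis
    by (simp add: vec_eq_iff forall_3 tube_map_def tube_normal_def inner_vec_def sum_2 tcos_eq al_def be_def kap_def
        power2_eq_square algebra_simps)
qed

lemma smooth_nth_compose: "smooth_on \<phi> UNIV \<Longrightarrow> smooth_on (\<lambda>z :: real ^ 2. \<phi> (z $ i)) UNIV" for \<phi> :: "real \<Rightarrow> real"
  by (rule smooth_on_compose[of \<phi> UNIV]) (auto intro: smooth_on_nth smooth_on_id)

lemma smooth_tube_map: "smooth_on tube_map UNIV"
  unfolding tube_map_def[abs_def] vector3_expand
  by (intro smooth_on_add smooth_on_scaleR smooth_on_mult smooth_on_const smooth_nth_compose
      smooth_tsin smooth_tvers open_UNIV)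

definition tube_dom :: "(real ^ 2) set" where
  "tube_dom = {z. tube_height z > 0}"

lemma continuous_tube_height: "continuous_on UNIV tube_height"
  unfolding tube_height_def[abs_def]
  by (intro continuous_intros smooth_on_imp_continuous_on[OF smooth_nth_compose[OF smooth_tvers]])

lemma open_tube_dom: "open tube_dom"
  unfolding tube_dom_def by (intro open_Collect_less continuous_on_const continuous_tube_height)

lemma tube_isometric:
  assumes "z \<in> tube_dom"
  shows "model_metric kap (tube_map z) (deriv_along tube_map z u) (deriv_along tube_map z v) = u \<bullet> v"
proof -
  interpret local_metric "model_metric kap" "model_dom kap :: (real ^ 3) set" by (rule local_metric_model)
  have y: "tube_height z > 0" using assms by (simp add: tube_dom_def)
  note m = tube_metric[OF y]
  show ?thesis
    unfolding deriv_along_tube_map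
    by (simp add: metric_simps[OF m(1)] m sym[OF m(1), of "tube_t z" "tube_s z"] inner_vec_def sum_2)
qed

lemma tube_local_map:
  "local_map (\<lambda>_. (\<bullet>)) UNIV (model_metric kap) (model_dom kap) tube_map tube_dom"
  unfolding local_map_def local_map_axioms_def
  using local_metric_euclidean local_metric_model open_tube_dom smooth_on_subset[OF smooth_tube_map]
    tube_metric(1) by (auto simp: tube_dom_def)

lemma sff_tube:
  assumes "z \<in> tube_dom"
  shows "sff (\<lambda>_. (\<bullet>)) (model_metric kap) tube_map z u v = (k1 * (u $ 1 * v $ 1) + k2 * (u $ 2 * v $ 2)) *\<^sub>R tube_normal z"
proof -
  have "tube_map z \<in> model_dom kap" using tube_metric(1) assms by (simp add: tube_dom_def)
  then show ?thesis
    unfolding sff_def christoffel_euclidean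
    by (simp add: christoffel_model tube_isometric[OF assms] deriv2_tube_map
        linear_0[OF linear_deriv_along[OF smooth_on_differentiable[OF smooth_tube_map]]])
qed

lemma tube_near_origin:
  assumes "\<delta> > 0"
  shows "\<exists>\<epsilon>>0. \<forall>z. norm z < \<epsilon> \<longrightarrow> z \<in> tube_dom \<and> tube_map z \<in> ball 0 \<delta>"
proof -
  have z: "0 \<in> tube_dom" "tube_map 0 = 0"
    by (simp_all add: tube_dom_def tube_height_def tube_map_def vec_eq_iff forall_3)
  have "open (tube_dom \<inter> tube_map -` ball 0 \<delta>)"
    by (rule continuous_open_preimage[OF continuous_on_subset[OF smooth_on_imp_continuous_on[OF smooth_tube_map]] open_tube_dom open_ball])
      simp
  moreover have "0 \<in> tube_dom \<inter> tube_map -` ball 0 \<delta>" using z assms by simp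
  ultimately obtain \<epsilon> where "\<epsilon> > 0" "ball 0 \<epsilon> \<subseteq> tube_dom \<inter> tube_map -` ball 0 \<delta>"
    using open_contains_ball by blast
  then show ?thesis by (intro exI[of _ \<epsilon>]) (auto simp: subset_iff)
qed

end

text \<open>The part \<zeta> of \<eta> orthogonal to \<nu> is also orthogonal to \<open>a\<close>
  and \<open>b\<close>. These three vectors form a basis by the determinant, so \<zeta> = 0 and
  \<eta> = c \<nu> with c^2 = 1; the orientation excludes c = -1.\<close>

lemma unit_normal_unique:
  fixes a b \<nu> \<eta> :: "real ^ 3"
  assumes "local_metric h T" and x: "x \<in> T"
    and nu: "h x \<nu> \<nu> = 1" "h x a \<nu> = 0" "h x b \<nu> = 0" "det (vector [a, b, \<nu>] :: real ^ 3 ^ 3) > 0"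
    and eta: "h x \<eta> \<eta> = 1" "h x a \<eta> = 0" "h x b \<eta> = 0" "det (vector [a, b, \<eta>] :: real ^ 3 ^ 3) > 0"
  shows "\<eta> = \<nu>"
proof -
  interpret local_metric h T by fact
  note m = metric_simps[OF x] and s = sym[OF x]
  define c where "c = h x \<eta> \<nu>"
  define \<zeta> where "\<zeta> = \<eta> - c *\<^sub>R \<nu>"
  \<comment> \<open>The Euclidean representative of the form \<open>h x \<zeta>\<close>, which turns
    the three orthogonality relations into one matrix equation.\<close>
  define l where "l = (\<chi> i. h x \<zeta> (axis i 1))"
  have hl: "h x \<zeta> w = w \<bullet> l" for w
    using linear_axis_expand[OF metric_linear(1)[OF x], of \<zeta> w] by (simp add: l_def inner_vec_def)
  have "h x \<zeta> a = 0" "h x \<zeta> b = 0" "h x \<zeta> \<nu> = 0"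
    using nu eta s[of \<eta> a] s[of \<nu> a] s[of \<eta> b] s[of \<nu> b] by (simp_all add: \<zeta>_def m c_def)
  then have "(vector [a, b, \<nu>] :: real ^ 3 ^ 3) *v l = 0"
    unfolding hl by (simp add: vec_eq_iff forall_3 matrix_vector_mult_def inner_vec_def)
  moreover have "\<exists>B. B ** (vector [a, b, \<nu>] :: real ^ 3 ^ 3) = mat 1"
    using nu(4) invertible_det_nz[of "vector [a, b, \<nu>] :: real ^ 3 ^ 3"] by (auto simp: invertible_def)
  ultimately have "l = 0" by (simp add: matrix_left_invertible_ker)
  then have "\<zeta> = 0" using hl[of \<zeta>] pos[OF x, of \<zeta>] by force
  then have e: "\<eta> = c *\<^sub>R \<nu>" by (simp add: \<zeta>_def)
  have "c * c = 1" using eta(1) nu(1) unfolding e by (simp add: m)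
  moreover have "det (vector [a, b, \<eta>] :: real ^ 3 ^ 3) = c * det (vector [a, b, \<nu>] :: real ^ 3 ^ 3)"
    unfolding e det_3 by (simp add: algebra_simps)
  ultimately have "c > 0" "c * c = 1" using eta(4) nu(4) by (simp_all add: zero_less_mult_iff)
  then have "c = 1" using square_eq_1_iff[of c] by linarith
  then show ?thesis using e by simp
qed

subsection \<open>Realising a shape operator\<close>

text \<open>Joins the two constructions: \<open>f\<close> with its properties is delivered by
  \<open>local_flat_coordinates\<close>, and \<open>Q\<close> with \<open>e\<close> and
  \<open>\<delta>\<close> by \<open>space_form_model_exists\<close>; \<open>f_small\<close> is
  arranged by the bound on \<open>f\<close>.\<close>

locale tube_surface = tube k1 k2 for k1 k2 :: real +
  fixes M :: "('p, 2) riem_mfd" and V :: "'p set" and f :: "'p \<Rightarrow> real ^ 2"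
    and Q :: "(real ^ 4, 3) riem_mfd" and e :: "(real ^ 4, 3) chart" and \<delta> :: real
  assumes M: "riemannian_manifold M" and V: "openin (mtop M) V"
    and f_continuous: "continuous_map (subtopology (mtop M) V) euclidean f"
    and f_smooth: "\<And>c. c \<in> atlas M \<Longrightarrow> smooth_on (f \<circ> cinv c) (cmap c ` (V \<inter> cdom c))"
    and f_metric: "\<And>c x u v. c \<in> atlas M \<Longrightarrow> x \<in> cmap c ` (V \<inter> cdom c) \<Longrightarrow>
      metric M c x u v = deriv_along (f \<circ> cinv c) x u \<bullet> deriv_along (f \<circ> cinv c) x v"
    and f_det: "\<And>c x. c \<in> atlas M \<Longrightarrow> x \<in> cmap c ` (V \<inter> cdom c) \<Longrightarrow>
      det (matrix (deriv_along (f \<circ> cinv c) x)) > 0"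
    and Q: "riemannian_manifold Q" and metric_Q: "metric Q = (\<lambda>_. model_metric kap)"
    and e: "e \<in> atlas Q" and cimg_e: "cimg e = model_dom kap"
    and single_chart: "\<And>x e'. x \<in> ball 0 \<delta> \<Longrightarrow> e' \<in> atlas Q \<Longrightarrow> cinv e x \<in> cdom e' \<Longrightarrow> e' = e"
    and f_small: "\<And>p. p \<in> V \<Longrightarrow> f p \<in> tube_dom" "\<And>p. p \<in> V \<Longrightarrow> tube_map (f p) \<in> ball 0 \<delta>"
begin

definition immersion :: "'p \<Rightarrow> real ^ 4" where
  "immersion p = cinv e (tube_map (f p))"

lemma tube_map_in_cimg: "p \<in> V \<Longrightarrow> tube_map (f p) \<in> cimg e"
  using f_small(1) tube_metric(1) cimg_e by (simp add: tube_dom_def)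

text \<open>In the chart \<open>e\<close> the image stays within \<delta> of the origin, so no other
  chart of \<open>Q\<close> meets it, and quantifiers over charts of \<open>Q\<close>
  collapse.\<close>

lemma charts_at_immersion:
  "charts_at V M Q immersion p c e' \<longleftrightarrow> c \<in> atlas M \<and> p \<in> V \<inter> cdom c \<and> e' = e"
  using single_chart[OF f_small(2)] e cinv_in_cdom[OF tube_map_in_cimg]
  unfolding charts_at_def immersion_def by blast

context
  fixes c assumes c: "c \<in> atlas M"
begin

abbreviation (input) U :: "(real ^ 2) set" where "U \<equiv> cmap c ` (V \<inter> cdom c)"

abbreviation (input) D :: "real ^ 2 \<Rightarrow> real ^ 2 \<Rightarrow> real ^ 2" where "D \<equiv> deriv_along (f \<circ> cinv c)"

lemma open_U: "open U"
  by (rule chart_open_image[OF manifold_chart[OF M c] openin_Int[OF V chart_open(1)[OF manifold_chart[OF M c]]]]) simp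

lemma cinv_U: "x \<in> U \<Longrightarrow> cinv c x \<in> V"
  using cinv_cmap[OF manifold_chart[OF M c]] by auto

lemma flat_local_map: "local_map (metric M c) (cimg c) (\<lambda>_. (\<bullet>)) UNIV (f \<circ> cinv c) U"
  unfolding local_map_def local_map_axioms_def
  using manifold_local_metric[OF M c] local_metric_euclidean open_U f_smooth[OF c] by auto

interpretation L: local_map "metric M c" "cimg c" "\<lambda>_. (\<bullet>)" UNIV "f \<circ> cinv c" U
  by (rule flat_local_map)

interpretation L2: local_metric2 "metric M c" "cimg c" ..

lemma local_rep_immersion: "x \<in> U \<Longrightarrow> local_rep immersion c e x = tube_map ((f \<circ> cinv c) x)"
  using cmap_cinv[OF tube_map_in_cimg[OF cinv_U]] by (simp add: local_rep_def immersion_def)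

lemma f_tube_dom: "(f \<circ> cinv c) ` U \<subseteq> tube_dom"
  using f_small(1)[OF cinv_U] by auto

lemma deriv_local_rep:
  assumes x: "x \<in> U"
  shows "deriv_along (local_rep immersion c e) x u
    = D x u $ 1 *\<^sub>R tube_s ((f \<circ> cinv c) x) + D x u $ 2 *\<^sub>R tube_t ((f \<circ> cinv c) x)"
proof -
  have "deriv_along (local_rep immersion c e) x u = deriv_along (\<lambda>x. tube_map ((f \<circ> cinv c) x)) x u"
    by (rule deriv_along_cong[OF open_U x local_rep_immersion])
  also have "\<dots> = deriv_along tube_map ((f \<circ> cinv c) x) (D x u)"
    by (rule deriv_along_compose_smooth[OF smooth_tube_map L.smooth_F subset_UNIV x])
  finally show ?thesis unfolding deriv_along_tube_map .
qed

lemma surj_D: "x \<in> U \<Longrightarrow> surj (D x)"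
  using surj_of_det_nonzero[OF L.linear_DF] f_det[OF c] by fastforce

text \<open>The flat coordinates are isometric with surjective differential, so their own form
  vanishes, and \<open>sff_compose\<close> leaves that of the tube, evaluated on their
  differential.\<close>

lemma second_ff_immersion:
  assumes x: "x \<in> U"
  shows "second_ff M Q immersion c e x u v
    = (k1 * (D x u $ 1 * D x v $ 1) + k2 * (D x u $ 2 * D x v $ 2)) *\<^sub>R tube_normal ((f \<circ> cinv c) x)"
proof -
  have fx: "(f \<circ> cinv c) x \<in> tube_dom" using f_tube_dom x by blast
  have "second_ff M Q immersion c e x u v
      = sff (metric M c) (model_metric kap) (local_rep immersion c e) x u v"
    by (simp add: second_ff_def sff_def Let_def metric_Q)
  also have "\<dots> = sff (metric M c) (model_metric kap) (\<lambda>x. tube_map ((f \<circ> cinv c) x)) x u v"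
    by (rule sff_cong[OF open_U x local_rep_immersion])
  also have "\<dots> = sff (\<lambda>_. (\<bullet>)) (model_metric kap) tube_map ((f \<circ> cinv c) x) (D x u) (D x v)
      + deriv_along tube_map ((f \<circ> cinv c) x) (sff (metric M c) (\<lambda>_. (\<bullet>)) (f \<circ> cinv c) x u v)"
    by (rule sff_compose[OF flat_local_map tube_local_map x f_tube_dom])
  also have "sff (metric M c) (\<lambda>_. (\<bullet>)) (f \<circ> cinv c) x u v = 0"
    by (rule L.sff_eq_0[OF x f_metric[OF c, symmetric] surj_D[OF x]])
  finally show ?thesis
    unfolding sff_tube[OF fx] by (simp add: deriv_along_tube_map)
qed

lemma unit_normal_immersion:
  assumes x: "x \<in> U"
  shows "unit_normal M Q immersion c e x = tube_normal ((f \<circ> cinv c) x)"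
proof -
  define z where "z = (f \<circ> cinv c) x"
  have y: "tube_height z > 0" using f_tube_dom x by (auto simp: z_def tube_dom_def)
  note t = tube_metric[OF y]
  interpret G: local_metric "model_metric kap" "model_dom kap :: (real ^ 3) set" by (rule local_metric_model)
  note m = G.metric_simps[OF t(1)]
  have Fx: "local_rep immersion c e x = tube_map z" unfolding z_def by (rule local_rep_immersion[OF x])
  have dF: "deriv_along (local_rep immersion c e) x u = D x u $ 1 *\<^sub>R tube_s z + D x u $ 2 *\<^sub>R tube_t z" for u
    unfolding z_def by (rule deriv_local_rep[OF x])
  have n: "model_metric kap (tube_map z) (deriv_along (local_rep immersion c e) x u) (tube_normal z) = 0" for u
    unfolding dF by (simp add: m t)
  \<comment> \<open>The determinant splits into the Jacobian of the coordinates and the determinant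
    of the tube. This is where the sign chosen in \<open>flat_coordinates\<close> matters.\<close>
  have "det (vector [deriv_along (local_rep immersion c e) x (axis 1 1),
        deriv_along (local_rep immersion c e) x (axis 2 1), tube_normal z] :: real ^ 3 ^ 3)
      = det (matrix (D x)) * det (vector [tube_s z, tube_t z, tube_normal z] :: real ^ 3 ^ 3)"
    unfolding dF det_3 det_2 matrix_def by (simp add: algebra_simps)
  also have "\<dots> > 0"
    unfolding tube_inner(11) using f_det[OF c x] y by (rule mult_pos_pos)
  finally have d: "det (vector [deriv_along (local_rep immersion c e) x (axis 1 1),
        deriv_along (local_rep immersion c e) x (axis 2 1), tube_normal z] :: real ^ 3 ^ 3) > 0" .
  show ?thesis
    unfolding unit_normal_def Let_def metric_Q Fx z_def[symmetric]
  proof (rule the_equality)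
    show "model_metric kap (tube_map z) (tube_normal z) (tube_normal z) = 1 \<and>
        (\<forall>u. model_metric kap (tube_map z) (deriv_along (local_rep immersion c e) x u) (tube_normal z) = 0) \<and>
        0 < det (vector [deriv_along (local_rep immersion c e) x (axis 1 1),
          deriv_along (local_rep immersion c e) x (axis 2 1), tube_normal z] :: real ^ 3 ^ 3)"
      using t(7) n d by blast
  next
    fix \<eta>
    assume "model_metric kap (tube_map z) \<eta> \<eta> = 1 \<and>
        (\<forall>u. model_metric kap (tube_map z) (deriv_along (local_rep immersion c e) x u) \<eta> = 0) \<and>
        0 < det (vector [deriv_along (local_rep immersion c e) x (axis 1 1),
          deriv_along (local_rep immersion c e) x (axis 2 1), \<eta>] :: real ^ 3 ^ 3)"
    then show "\<eta> = tube_normal z"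
      using unit_normal_unique[OF local_metric_model t(1) t(7) n n d] by blast
  qed
qed

lemma shape_immersion:
  assumes x: "x \<in> U"
  shows "metric M c x (shape_unit_normal M Q immersion c e x u) w
    = k1 * (D x u $ 1 * D x w $ 1) + k2 * (D x u $ 2 * D x w $ 2)"
proof -
  define z where "z = (f \<circ> cinv c) x"
  have y: "tube_height z > 0" using f_tube_dom x by (auto simp: z_def tube_dom_def)
  interpret G: local_metric "model_metric kap" "model_dom kap :: (real ^ 3) set" by (rule local_metric_model)
  note l = L.linear_DF[OF x]
  have "shape_unit_normal M Q immersion c e x u
      = L.dom.dual x (\<lambda>w. k1 * (D x u $ 1 * D x w $ 1) + k2 * (D x u $ 2 * D x w $ 2))"
    unfolding shape_unit_normal_def shape_operator_def L.dom.dual_def unit_normal_immersion[OF x]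
      second_ff_immersion[OF x] local_rep_immersion[OF x] metric_Q z_def[symmetric]
    by (simp add: G.metric_simps[OF tube_metric(1)[OF y]] tube_metric(7)[OF y])
  moreover have "linear (\<lambda>w. k1 * (D x u $ 1 * D x w $ 1) + k2 * (D x u $ 2 * D x w $ 2))"
    by (intro linearI) (simp_all add: linear_add[OF l] linear_scale[OF l] algebra_simps)
  ultimately show ?thesis using L.dom.dual_eq[OF L.in_dom[OF x]] by simp
qed

text \<open>Pulling the axes back gives the principal directions; they are orthonormal because the
  coordinates are isometric.\<close>

lemma coordinate_frame:
  assumes x: "x \<in> U"
  obtains e1 e2 where "D x e1 = axis 1 1" "D x e2 = axis 2 1"
    "orthonormal_basis_at (metric M c) x (\<lambda>i. if i = 1 then e1 else e2)"
proof -
  obtain e1 e2 where e12: "D x e1 = axis 1 1" "D x e2 = axis 2 1"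
    using surj_D[OF x] by (metis surjD)
  then show ?thesis
    by (intro that[of e1 e2] L2.orthonormal_pair L.in_dom[OF x])
      (simp_all add: f_metric[OF c x] inner_axis_axis)
qed

lemma eigenvalues_immersion:
  assumes x: "x \<in> U"
  shows "eigenvalues (shape_unit_normal M Q immersion c e x) = {k1, k2}"
proof -
  define A where "A = shape_unit_normal M Q immersion c e x"
  have A: "metric M c x (A u) w = k1 * (D x u $ 1 * D x w $ 1) + k2 * (D x u $ 2 * D x w $ 2)" for u w
    unfolding A_def by (rule shape_immersion[OF x])
  note xd = L.in_dom[OF x] and g = f_metric[OF c x]
  note l = L.linear_DF[OF x]
  obtain e1 e2 where e12: "D x e1 = axis 1 1" "D x e2 = axis 2 1"
    using coordinate_frame[OF x] by blast
  have "metric M c x (A e1) w = metric M c x (k1 *\<^sub>R e1) w" "metric M c x (A e2) w = metric M c x (k2 *\<^sub>R e2) w" for w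
    unfolding A L.dom.metric_simps[OF xd] by (simp_all add: g e12 inner_vec_def sum_2 axis_def)
  then have "A e1 = k1 *\<^sub>R e1" "A e2 = k2 *\<^sub>R e2"
    using L.dom.nondegenerate[OF xd] by blast+
  moreover have "e1 \<noteq> 0" "e2 \<noteq> 0" using e12 linear_0[OF l] by (auto simp: axis_eq_0_iff)
  ultimately have "{k1, k2} \<subseteq> eigenvalues A" by (auto simp: eigenvalues_def)
  moreover have "t \<in> {k1, k2}" if t: "t \<in> eigenvalues A" for t
  proof -
    obtain v where v: "v \<noteq> 0" "A v = t *\<^sub>R v" using t by (auto simp: eigenvalues_def)
    have *: "k1 * (D x v $ 1 * D x w $ 1) + k2 * (D x v $ 2 * D x w $ 2) = t * (D x v \<bullet> D x w)" for w
      using A[of v w] unfolding v(2) by (simp add: L.dom.metric_simps[OF xd] linear_scale[OF l] g)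
    \<comment> \<open>Testing with the two principal directions splits the eigenvalue equation into
      its components.\<close>
    have 1: "(k1 - t) * D x v $ 1 = 0" "(k2 - t) * D x v $ 2 = 0"
      using *[of e1] *[of e2] unfolding e12 by (simp_all add: inner_vec_def sum_2 axis_def algebra_simps)
    have "D x v \<bullet> D x v > 0" using L.dom.pos[OF xd v(1)] g by simp
    then have "D x v $ 1 \<noteq> 0 \<or> D x v $ 2 \<noteq> 0" by (auto simp: inner_vec_def sum_2)
    then show ?thesis using 1 by auto
  qed
  ultimately show ?thesis unfolding A_def by blast
qed

text \<open>The mean curvature vector is (k1 + k2) / 2 times the unit normal; the sign condition
  removes the absolute value left by the square root.\<close>

lemma mean_curvature_norm_immersion:
  assumes x: "x \<in> U" and nn: "k1 + k2 \<ge> 0"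
  shows "mean_curvature_norm M Q immersion c e x = (k1 + k2) / 2"
proof -
  define z where "z = (f \<circ> cinv c) x"
  have y: "tube_height z > 0" using f_tube_dom x by (auto simp: z_def tube_dom_def)
  interpret G: local_metric "model_metric kap" "model_dom kap :: (real ^ 3) set" by (rule local_metric_model)
  obtain e1 e2 where e12: "D x e1 = axis 1 1" "D x e2 = axis 2 1"
    "orthonormal_basis_at (metric M c) x (\<lambda>i. if i = 1 then e1 else e2)"
    using coordinate_frame[OF x] by blast
  note l = L.linear_DF[OF x]
  have "bilinear (second_ff M Q immersion c e x)"
    unfolding bilinear_def second_ff_immersion[OF x]
    by (intro conjI allI linearI) (simp_all add: linear_add[OF l] linear_scale[OF l] algebra_simps)
  from L.dom.metric_trace_eq[OF L.in_dom[OF x] this e12(3)]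
  have "metric_trace (metric M c) x (second_ff M Q immersion c e x) = (k1 + k2) *\<^sub>R tube_normal z"
    by (simp add: sum_2 second_ff_immersion[OF x] e12 axis_def z_def scaleR_add_left)
  then have H: "mean_curvature M Q immersion c e x = ((k1 + k2) / 2) *\<^sub>R tube_normal z"
    by (simp add: mean_curvature_def)
  have "mean_curvature_norm M Q immersion c e x = sqrt (((k1 + k2) / 2) * ((k1 + k2) / 2))"
    unfolding mean_curvature_norm_def H local_rep_immersion[OF x] metric_Q z_def[symmetric]
    by (simp add: G.metric_simps[OF tube_metric(1)[OF y]] tube_metric(7)[OF y])
  then show ?thesis unfolding real_sqrt_abs2 using nn by simp
qed

end

lemma isometric_immersion: "isometric_immersion_on V M Q immersion"
  unfolding isometric_immersion_on_def
proof (intro conjI ballI allI impI)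
  have "continuous_map (subtopology (mtop M) V) euclidean (\<lambda>p. tube_map (f p))"
    using continuous_map_compose[OF f_continuous, of euclidean tube_map]
      smooth_on_imp_continuous_on[OF smooth_tube_map] by (simp add: o_def)
  then have "continuous_map (subtopology (mtop M) V) (top_of_set (cimg e)) (\<lambda>p. tube_map (f p))"
    using tube_map_in_cimg by (auto simp: continuous_map_in_subtopology simp del: image_eqI)
  from continuous_map_compose[OF this chart_inv_continuous[OF manifold_chart[OF Q e]]]
  show "continuous_map (subtopology (mtop M) V) (mtop Q) immersion"
    by (simp add: o_def immersion_def[abs_def])
next
  fix c d assume c: "c \<in> atlas M" and d: "d \<in> atlas Q"
  show "smooth_on (local_rep immersion c d) (cmap c ` {p. charts_at V M Q immersion p c d})"
  proof (cases "d = e")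
    case True
    have "smooth_on (\<lambda>x. tube_map ((f \<circ> cinv c) x)) (cmap c ` (V \<inter> cdom c))"
      by (rule smooth_on_compose[OF smooth_tube_map f_smooth[OF c] open_U[OF c] subset_UNIV])
    then have "smooth_on (local_rep immersion c e) (cmap c ` (V \<inter> cdom c))"
      by (rule smooth_on_cong[OF open_U[OF c]]) (rule local_rep_immersion[OF c, symmetric])
    moreover have "{p. charts_at V M Q immersion p c e} = V \<inter> cdom c"
      using c by (auto simp: charts_at_immersion)
    ultimately show ?thesis using True by simp
  next
    case False
    then show ?thesis by (simp add: charts_at_immersion)
  qed
next
  fix p c d u v assume "charts_at V M Q immersion p c d"
  then have c: "c \<in> atlas M" and p: "p \<in> V" "p \<in> cdom c" and d: "d = e" by (auto simp: charts_at_immersion)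
  have x: "cmap c p \<in> cmap c ` (V \<inter> cdom c)" using p by blast
  define z where "z = (f \<circ> cinv c) (cmap c p)"
  have z: "z \<in> tube_dom" unfolding z_def using f_tube_dom[OF c] x by blast
  have "cmap e (immersion p) = local_rep immersion c e (cmap c p)"
    using local_rep_cmap[OF manifold_chart[OF M c] p(2), of immersion e] by simp
  also have "\<dots> = tube_map z" unfolding z_def by (rule local_rep_immersion[OF c x])
  finally show "metric Q d (cmap d (immersion p)) (deriv_along (local_rep immersion c d) (cmap c p) u)
      (deriv_along (local_rep immersion c d) (cmap c p) v) = metric M c (cmap c p) u v"
    using tube_isometric[OF z]
    unfolding d metric_Q deriv_local_rep[OF c x] z_def[symmetric] deriv_along_tube_map f_metric[OF c x] by simp
qed

lemma isoparametric: "isoparametric_on V M Q immersion"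
  unfolding isoparametric_on_def
proof (intro exI allI impI)
  fix p c d assume "charts_at V M Q immersion p c d"
  then show "eigenvalues (shape_unit_normal M Q immersion c d (cmap c p)) = {k1, k2}"
    using eigenvalues_immersion by (auto simp: charts_at_immersion)
qed

end

theorem (in isometric_surface) shape_operator_realization:
  fixes a b \<alpha> \<beta> :: real
  assumes bi: "biconservative M N \<phi>"
    and ev: "\<And>c d x. c \<in> atlas M \<Longrightarrow> d \<in> atlas N \<Longrightarrow> x \<in> rep_dom c d \<Longrightarrow>
      eigenvalues (shape_H M N \<phi> c d x) = {a, b}" and ne: "a \<noteq> b"
  defines "k1 \<equiv> \<alpha> + \<beta> * a" and "k2 \<equiv> \<alpha> + \<beta> * b"
  assumes nn: "k1 + k2 \<ge> 0"
  shows "\<exists>Q :: (real ^ 4, 3) riem_mfd. space_form Q (- (k1 * k2)) \<and>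
    (\<forall>p\<^sub>0\<in>points M. \<exists>V \<psi>. p\<^sub>0 \<in> V \<and> isoparametric_surface V M Q \<psi> \<and>
      (\<forall>p c d e. charts_at V M N \<phi> p c d \<and> charts_at V M Q \<psi> p c e \<longrightarrow>
        (\<forall>u. shape_unit_normal M Q \<psi> c e (cmap c p) u = \<alpha> *\<^sub>R u + \<beta> *\<^sub>R shape_H M N \<phi> c d (cmap c p) u) \<and>
        mean_curvature_norm M Q \<psi> c e (cmap c p) = (k1 + k2) / 2))"
proof -
  \<comment> \<open>The space form and \<epsilon> depend only on \<open>k1\<close> and
    \<open>k2\<close>. They are fixed before the point, so one space form serves all of
    \<open>M\<close>.\<close>
  interpret T: tube k1 k2 .
  obtain Q :: "(real ^ 4, 3) riem_mfd" and e \<delta> where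
    Q: "space_form Q T.kap" "metric Q = (\<lambda>_. model_metric T.kap)" "e \<in> atlas Q" "cimg e = model_dom T.kap" "\<delta> > 0"
    "\<And>x e'. x \<in> ball 0 \<delta> \<Longrightarrow> e' \<in> atlas Q \<Longrightarrow> cinv e x \<in> cdom e' \<Longrightarrow> e' = e"
    by (rule space_form_model_exists[of T.kap]) blast
  obtain \<epsilon> where eps: "\<epsilon> > 0" "\<And>z. norm z < \<epsilon> \<Longrightarrow> z \<in> T.tube_dom \<and> T.tube_map z \<in> ball 0 \<delta>"
    using T.tube_near_origin[OF Q(5)] by blast
  show ?thesis
  proof (intro exI[of _ Q] conjI ballI)
    show "space_form Q (- (k1 * k2))" using Q(1) by (simp add: T.kap_def)
    fix p\<^sub>0 assume p0: "p\<^sub>0 \<in> points M"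
    obtain V f where V: "openin (mtop M) V" "connectedin (mtop M) V" "p\<^sub>0 \<in> V"
      and f: "continuous_map (subtopology (mtop M) V) euclidean f" "\<forall>p\<in>V. norm (f p) < \<epsilon>"
      and flat: "\<forall>c\<in>atlas M. smooth_on (f \<circ> cinv c) (cmap c ` (V \<inter> cdom c)) \<and>
      (\<forall>x\<in>cmap c ` (V \<inter> cdom c).
        (\<forall>u v. metric M c x u v = deriv_along (f \<circ> cinv c) x u \<bullet> deriv_along (f \<circ> cinv c) x v) \<and>
        det (matrix (deriv_along (f \<circ> cinv c) x)) > 0 \<and>
        (\<forall>d\<in>atlas N. x \<in> rep_dom c d \<longrightarrow> (\<forall>u v. metric M c x (shape_H M N \<phi> c d x u) v
          = a * (deriv_along (f \<circ> cinv c) x u $ 1 * deriv_along (f \<circ> cinv c) x v $ 1)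
            + b * (deriv_along (f \<circ> cinv c) x u $ 2 * deriv_along (f \<circ> cinv c) x v $ 2))))"
      using local_flat_coordinates[OF bi ev ne p0 eps(1)] by blast
    interpret S: tube_surface k1 k2 M V f Q e \<delta>
    proof unfold_locales
      show "riemannian_manifold Q" using Q(1) by (simp add: space_form_def)
    qed (use M V f flat Q eps in blast)+
    show "\<exists>V \<psi>. p\<^sub>0 \<in> V \<and> isoparametric_surface V M Q \<psi> \<and>
      (\<forall>p c d e. charts_at V M N \<phi> p c d \<and> charts_at V M Q \<psi> p c e \<longrightarrow>
        (\<forall>u. shape_unit_normal M Q \<psi> c e (cmap c p) u = \<alpha> *\<^sub>R u + \<beta> *\<^sub>R shape_H M N \<phi> c d (cmap c p) u) \<and>
        mean_curvature_norm M Q \<psi> c e (cmap c p) = (k1 + k2) / 2)"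
    proof (intro exI[of _ V] exI[of _ S.immersion] conjI allI impI)
      show "p\<^sub>0 \<in> V" by fact
      show "isoparametric_surface V M Q S.immersion"
        unfolding isoparametric_surface_def using V S.isometric_immersion S.isoparametric by blast
      fix p c d e'
      assume *: "charts_at V M N \<phi> p c d \<and> charts_at V M Q S.immersion p c e'"
      then have c: "c \<in> atlas M" "p \<in> V" "p \<in> cdom c" and e': "e' = e"
        using S.charts_at_immersion by blast+
      have d: "d \<in> atlas N" "\<phi> p \<in> cdom d" using * by (auto simp: charts_at_def)
      have x: "cmap c p \<in> cmap c ` (V \<inter> cdom c)" using c by blast
      have xr: "cmap c p \<in> rep_dom c d" using c d at_charts_iff unfolding rep_dom_def by blast
      show "mean_curvature_norm M Q S.immersion c e' (cmap c p) = (k1 + k2) / 2"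
        unfolding e' by (rule S.mean_curvature_norm_immersion[OF c(1) x nn])
      fix u
      interpret G: local_metric "metric M c" "cimg c" by (rule manifold_local_metric[OF M c(1)])
      have xi: "cmap c p \<in> cimg c" using c by blast
      show "shape_unit_normal M Q S.immersion c e' (cmap c p) u = \<alpha> *\<^sub>R u + \<beta> *\<^sub>R shape_H M N \<phi> c d (cmap c p) u"
        unfolding e'
      proof (rule G.nondegenerate[OF xi])
        fix w
        have T: "metric M c (cmap c p) (shape_H M N \<phi> c d (cmap c p) u) w
          = a * (deriv_along (f \<circ> cinv c) (cmap c p) u $ 1 * deriv_along (f \<circ> cinv c) (cmap c p) w $ 1)
            + b * (deriv_along (f \<circ> cinv c) (cmap c p) u $ 2 * deriv_along (f \<circ> cinv c) (cmap c p) w $ 2)"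
          using flat c(1) x d(1) xr by blast
        show "metric M c (cmap c p) (shape_unit_normal M Q S.immersion c e (cmap c p) u) w
            = metric M c (cmap c p) (\<alpha> *\<^sub>R u + \<beta> *\<^sub>R shape_H M N \<phi> c d (cmap c p) u) w"
          unfolding S.shape_immersion[OF c(1) x]
          unfolding G.metric_simps[OF xi] T S.f_metric[OF c(1) x, of u w]
          by (simp add: inner_vec_def sum_2 k1_def k2_def algebra_simps)
      qed
    qed
  qed
qed

section \<open>The operators A_H and S_2 as affine functions of A_H\<close>

theorem theorem4p19:
  fixes M :: "('p, 2) riem_mfd" and N :: "('q, 'n::finite) riem_mfd"
    and \<phi> :: "'p \<Rightarrow> 'q" and l\<^sub>1 l\<^sub>2 \<mu> :: "'p \<Rightarrow> real"
  assumes "riemannian_manifold M" and "riemannian_manifold N"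
    and "isometric_immersion_on (points M) M N \<phi>"
    and "biconservative M N \<phi>"
    and "principal_curvatures M N \<phi> l\<^sub>1 l\<^sub>2"
    and "\<forall>p\<in>points M. \<mu> p = l\<^sub>1 p - l\<^sub>2 p"
    and "l\<^sub>1 constant_on points M" and "l\<^sub>2 constant_on points M"
    and "\<forall>p\<in>points M. l\<^sub>1 p > l\<^sub>2 p"
  shows
    "(\<exists>k. (\<forall>p c d. charts_at (points M) M N \<phi> p c d \<longrightarrow>
             k = (\<mu> p)\<^sup>2 / 4 - (mean_curvature_norm M N \<phi> c d (cmap c p)) ^ 4) \<and>
          (\<exists>Q :: (real ^ 4, 3) riem_mfd. space_form Q k \<and>
             (\<forall>p\<^sub>0\<in>points M. \<exists>V \<psi>. p\<^sub>0 \<in> V \<and> isoparametric_surface V M Q \<psi> \<and>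
                (\<forall>p c d e. charts_at V M N \<phi> p c d \<and> charts_at V M Q \<psi> p c e \<longrightarrow>
                   shape_H M N \<phi> c d (cmap c p) = shape_unit_normal M Q \<psi> c e (cmap c p) \<and>
                   mean_curvature_norm M Q \<psi> c e (cmap c p)
                     = (mean_curvature_norm M N \<phi> c d (cmap c p))\<^sup>2)))) \<and>
     (\<exists>k. (\<forall>p c d. charts_at (points M) M N \<phi> p c d \<longrightarrow>
             k = 4 * ((\<mu> p)\<^sup>2 - (mean_curvature_norm M N \<phi> c d (cmap c p)) ^ 4)) \<and>
          (\<exists>Q :: (real ^ 4, 3) riem_mfd. space_form Q k \<and>
             (\<forall>p\<^sub>0\<in>points M. \<exists>V \<psi>. p\<^sub>0 \<in> V \<and> isoparametric_surface V M Q \<psi> \<and>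
                (\<forall>p c d e. charts_at V M N \<phi> p c d \<and> charts_at V M Q \<psi> p c e \<longrightarrow>
                   stress_bienergy M N \<phi> c d (cmap c p) = shape_unit_normal M Q \<psi> c e (cmap c p) \<and>
                   mean_curvature_norm M Q \<psi> c e (cmap c p)
                     = 2 * (mean_curvature_norm M N \<phi> c d (cmap c p))\<^sup>2))))"
proof -
  interpret I: isometric_surface M N \<phi> by unfold_locales fact+
  have ne: "points M \<noteq> {}" using assms(1) by (simp add: riemannian_manifold_def)
  obtain a b where a: "\<And>p. p \<in> points M \<Longrightarrow> l\<^sub>1 p = a" and b: "\<And>p. p \<in> points M \<Longrightarrow> l\<^sub>2 p = b"
    using assms(7,8) unfolding constant_on_def by blast
  have ab: "a > b" using ne a b assms(9) by fastforce
  then have ab': "a \<noteq> b" by simp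
  have ev: "eigenvalues (shape_H M N \<phi> c d x) = {a, b}" if "x \<in> I.rep_dom c d" for c d x
  proof -
    obtain p where p: "I.at_charts p c d" "x = cmap c p" using \<open>x \<in> I.rep_dom c d\<close> by (auto simp: I.rep_dom_def)
    then have "p \<in> points M" by (simp add: charts_at_def)
    then show ?thesis
      using assms(5) p(1) a b unfolding principal_curvatures_def p(2) by (simp del: split_paired_All)
  qed
  have H: "(mean_curvature_norm M N \<phi> c d (cmap c p))\<^sup>2 = (a + b) / 2" if "I.at_charts p c d" for p c d
  proof -
    have "cmap c p \<in> I.rep_dom c d" using that by (auto simp: I.rep_dom_def)
    then show ?thesis
      using I.mean_curvature_norm_trace[OF _ _ _ ev ab'] that by (simp add: charts_at_def)
  qed
  have H4: "(mean_curvature_norm M N \<phi> c d (cmap c p)) ^ 4 = ((a + b) / 2)\<^sup>2" if "I.at_charts p c d" for p c d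
    using H[OF that] by (metis (no_types) power_mult mult_2 numeral_Bit0)
  have \<mu>: "\<mu> p = a - b" if "I.at_charts p c d" for p c d
    using that assms(6) a b by (simp add: charts_at_def)
  \<comment> \<open>The sum is twice the squared norm of H, evaluated at any one point.\<close>
  have nn: "a + b \<ge> 0"
  proof -
    obtain p where p: "p \<in> points M" using ne by blast
    obtain c where c: "c \<in> atlas M" "p \<in> cdom c" using manifold_chart_exists[OF assms(1) p] by blast
    have "\<phi> p \<in> points N" using continuous_map_image_subset_topspace[OF I.continuous_\<phi>] p by blast
    then obtain d where d: "d \<in> atlas N" "\<phi> p \<in> cdom d" using manifold_chart_exists[OF assms(2)] by blast
    have "(mean_curvature_norm M N \<phi> c d (cmap c p))\<^sup>2 = (a + b) / 2"
      by (rule H) (use c d I.at_charts_iff in blast)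
    then have "(a + b) / 2 \<ge> 0" by (metis zero_le_power2)
    then show ?thesis by simp
  qed
  \<comment> \<open>An open \<open>V\<close> consists of points of \<open>M\<close>, so the values
    of |H| found above apply on it.\<close>
  have whole: "I.at_charts p c d" if "isoparametric_surface V M Q \<psi>" "charts_at V M N \<phi> p c d"
    for V p c d and Q :: "(real ^ 4, 3) riem_mfd" and \<psi>
    using that openin_subset unfolding isoparametric_surface_def charts_at_def by blast
  have shape: "shape_H M N \<phi> c d (cmap c p) = shape_unit_normal M Q \<psi> c e (cmap c p) \<and>
      mean_curvature_norm M Q \<psi> c e (cmap c p) = (mean_curvature_norm M N \<phi> c d (cmap c p))\<^sup>2"
    if "\<forall>u. shape_unit_normal M Q \<psi> c e (cmap c p) u = 0 *\<^sub>R u + 1 *\<^sub>R shape_H M N \<phi> c d (cmap c p) u"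
      "mean_curvature_norm M Q \<psi> c e (cmap c p) = (a + b) / 2" "I.at_charts p c d"
    for p c d e and Q :: "(real ^ 4, 3) riem_mfd" and \<psi>
    using that H[OF that(3)] by (auto simp: fun_eq_iff)
  have stress: "stress_bienergy M N \<phi> c d (cmap c p) = shape_unit_normal M Q \<psi> c e (cmap c p) \<and>
      mean_curvature_norm M Q \<psi> c e (cmap c p) = 2 * (mean_curvature_norm M N \<phi> c d (cmap c p))\<^sup>2"
    if "\<forall>u. shape_unit_normal M Q \<psi> c e (cmap c p) u
        = (- (a + b)) *\<^sub>R u + 4 *\<^sub>R shape_H M N \<phi> c d (cmap c p) u"
      "mean_curvature_norm M Q \<psi> c e (cmap c p) = a + b" "I.at_charts p c d"
    for p c d e and Q :: "(real ^ 4, 3) riem_mfd" and \<psi>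
  proof
    have "stress_bienergy M N \<phi> c d (cmap c p) u
        = (- (a + b)) *\<^sub>R u + 4 *\<^sub>R shape_H M N \<phi> c d (cmap c p) u" for u
      unfolding stress_bienergy_def H[OF that(3)] by simp
    then show "stress_bienergy M N \<phi> c d (cmap c p) = shape_unit_normal M Q \<psi> c e (cmap c p)"
      using that(1) by (intro ext) simp
    show "mean_curvature_norm M Q \<psi> c e (cmap c p) = 2 * (mean_curvature_norm M N \<phi> c d (cmap c p))\<^sup>2"
      unfolding H[OF that(3)] that(2) by simp
  qed
  show ?thesis
  proof (rule conjI)
    \<comment> \<open>Here -ab = ((a - b)^2 - (a + b)^2) / 4, and (a + b)^2 / 4 is |H|^4.\<close>
    have k: "- (a * b) = (\<mu> p)\<^sup>2 / 4 - (mean_curvature_norm M N \<phi> c d (cmap c p)) ^ 4"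
      if "I.at_charts p c d" for p c d
      unfolding \<mu>[OF that] H4[OF that] by (simp add: power2_eq_square field_simps)
    \<comment> \<open>The coefficients 0 and 1 select A_H itself.\<close>
    have "0 + 1 * a + (0 + 1 * b) \<ge> 0" using nn by simp
    from I.shape_operator_realization[OF assms(4) ev ab' this]
    obtain Q :: "(real ^ 4, 3) riem_mfd" where Q: "space_form Q (- (a * b))"
      "\<forall>p\<^sub>0\<in>points M. \<exists>V \<psi>. p\<^sub>0 \<in> V \<and> isoparametric_surface V M Q \<psi> \<and>
        (\<forall>p c d e. charts_at V M N \<phi> p c d \<and> charts_at V M Q \<psi> p c e \<longrightarrow>
          (\<forall>u. shape_unit_normal M Q \<psi> c e (cmap c p) u = 0 *\<^sub>R u + 1 *\<^sub>R shape_H M N \<phi> c d (cmap c p) u) \<and>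
          mean_curvature_norm M Q \<psi> c e (cmap c p) = (a + b) / 2)"
      by (auto simp del: split_paired_All scaleR_zero_left scaleR_one)
    show "\<exists>k. (\<forall>p c d. I.at_charts p c d \<longrightarrow>
             k = (\<mu> p)\<^sup>2 / 4 - (mean_curvature_norm M N \<phi> c d (cmap c p)) ^ 4) \<and>
          (\<exists>Q :: (real ^ 4, 3) riem_mfd. space_form Q k \<and>
             (\<forall>p\<^sub>0\<in>points M. \<exists>V \<psi>. p\<^sub>0 \<in> V \<and> isoparametric_surface V M Q \<psi> \<and>
                (\<forall>p c d e. charts_at V M N \<phi> p c d \<and> charts_at V M Q \<psi> p c e \<longrightarrow>
                   shape_H M N \<phi> c d (cmap c p) = shape_unit_normal M Q \<psi> c e (cmap c p) \<and>
                   mean_curvature_norm M Q \<psi> c e (cmap c p)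
                     = (mean_curvature_norm M N \<phi> c d (cmap c p))\<^sup>2)))"
      using k Q shape whole by (intro exI[of _ "- (a * b)"] conjI exI[of _ Q]) (blast, blast, meson)
  next
    \<comment> \<open>The principal curvatures are now 3a - b and 3b - a, with sum 2 (a + b). Minus
      their product is 4 (a - b)^2 - (a + b)^2, and (a + b)^2 is 4 |H|^4.\<close>
    have k: "- ((- (a + b) + 4 * a) * (- (a + b) + 4 * b))
        = 4 * ((\<mu> p)\<^sup>2 - (mean_curvature_norm M N \<phi> c d (cmap c p)) ^ 4)"
      if "I.at_charts p c d" for p c d
      unfolding \<mu>[OF that] H4[OF that] by (simp add: power2_eq_square field_simps)
    have "- (a + b) + 4 * a + (- (a + b) + 4 * b) \<ge> 0" using nn by simp
    moreover have "(- (a + b) + 4 * a + (- (a + b) + 4 * b)) / 2 = a + b" by simp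
    ultimately obtain Q :: "(real ^ 4, 3) riem_mfd" where Q: "space_form Q (- ((- (a + b) + 4 * a) * (- (a + b) + 4 * b)))"
      "\<forall>p\<^sub>0\<in>points M. \<exists>V \<psi>. p\<^sub>0 \<in> V \<and> isoparametric_surface V M Q \<psi> \<and>
        (\<forall>p c d e. charts_at V M N \<phi> p c d \<and> charts_at V M Q \<psi> p c e \<longrightarrow>
          (\<forall>u. shape_unit_normal M Q \<psi> c e (cmap c p) u
            = (- (a + b)) *\<^sub>R u + 4 *\<^sub>R shape_H M N \<phi> c d (cmap c p) u) \<and>
          mean_curvature_norm M Q \<psi> c e (cmap c p) = a + b)"
      using I.shape_operator_realization[OF assms(4) ev ab', of "- (a + b)" 4] by metis
    show "\<exists>k. (\<forall>p c d. I.at_charts p c d \<longrightarrow>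
             k = 4 * ((\<mu> p)\<^sup>2 - (mean_curvature_norm M N \<phi> c d (cmap c p)) ^ 4)) \<and>
          (\<exists>Q :: (real ^ 4, 3) riem_mfd. space_form Q k \<and>
             (\<forall>p\<^sub>0\<in>points M. \<exists>V \<psi>. p\<^sub>0 \<in> V \<and> isoparametric_surface V M Q \<psi> \<and>
                (\<forall>p c d e. charts_at V M N \<phi> p c d \<and> charts_at V M Q \<psi> p c e \<longrightarrow>
                   stress_bienergy M N \<phi> c d (cmap c p) = shape_unit_normal M Q \<psi> c e (cmap c p) \<and>
                   mean_curvature_norm M Q \<psi> c e (cmap c p)
                     = 2 * (mean_curvature_norm M N \<phi> c d (cmap c p))\<^sup>2)))"
      using k Q stress whole
      by (intro exI[of _ "- ((- (a + b) + 4 * a) * (- (a + b) + 4 * b))"] conjI exI[of _ Q]) (blast, blast, meson)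
  qed
qed

end
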